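(* Let $p,q>0$, $a\in\mathbb{R}$ and $\lambda\ge-a^2/2$. Let $h$ be minimal in $\mathcal H^+\bigl(\mathfrak L_a^{\mathrm{Sol}(p,q)},\lambda\bigr)$. Then either $h(x,y,z)=h_1(x,z)$ for all $(x,y,z)$, where $h_1$ is minimal in $\mathcal H^+\bigl(\mathfrak L_a^{\mathbb H(p)},\lambda\bigr)$, or $h(x,y,z)=h_2(y,-z)$ for all $(x,y,z)$, where $h_2$ is minimal in $\mathcal H^+\bigl(\mathfrak L_{-a}^{\mathbb H(q)},\lambda\bigr)$ (the two possibilities are not claimed to be exclusive).
   Context: $\mathrm{Sol}(p,q)$ is $\mathbb{R}^3$ with coordinates $(x,y,z)$ and metric $e^{-2pz}dx^2+e^{2qz}dy^2+dz^2$. For $r>0$, $\mathbb H(r)$ is $\mathbb{R}^2$ with metric $e^{-2rz}dx^2+dz^2$ (hyperbolic plane of curvature $-r^2$ in logarithmic coordinates). The Laplacians with vertical drift are $$\mathfrak L_a^{\mathrm{Sol}(p,q)}=\frac12\Bigl(e^{2pz}\frac{\partial^2}{\partial x^2}+e^{-2qz}\frac{\partial^2}{\partial y^2}+\frac{\partial^2}{\partial z^2}\Bigr)+a\frac{\partial}{\partial z}$$ on $\mathrm{Sol}(p,q)$ and, for $b\in\mathbb{R}$, $r>0$, $$\mathfrak L_b^{\mathbb H(r)}=\frac12\Bigl(e^{2rz}\frac{\partial^2}{\partial x^2}+\frac{\partial^2}{\partial z^2}\Bigr)+b\frac{\partial}{\partial z}$$ on $\mathbb H(r)$ (the first coordinate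 in $\mathbb H(q)$ is denoted $y$ when it comes from $\mathrm{Sol}(p,q)$). For any such operator $\mathfrak L$, $\mathcal H^+(\mathfrak L,\lambda)$ is the cone of all non-negative $C^2$-functions $h$ on the respective space with $\mathfrak L h=\lambda h$ (if not identically zero, such $h$ is strictly positive everywhere). A function $h\in\mathcal H^+(\mathfrak L,\lambda)$ is called minimal if its value at the origin of the space is $1$ and, whenever $f\in\mathcal H^+(\mathfrak L,\lambda)$ satisfies $f\le h$, the function $f/h$ is constant. *)

theory Defs
  imports "HOL-Analysis.Analysis"
begin

definition C2 :: "('a::real_normed_vector \<Rightarrow> real) \<Rightarrow> bool" where
  "C2 f \<longleftrightarrow> (\<exists>(f' :: 'a \<Rightarrow> 'a \<Rightarrow>\<^sub>L real) (f'' :: 'a \<Rightarrow> 'a \<Rightarrow>\<^sub>L 'a \<Rightarrow>\<^sub>L real).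
     (\<forall>x. (f has_derivative blinfun_apply (f' x)) (at x)) \<and>
     (\<forall>x. (f' has_derivative blinfun_apply (f'' x)) (at x)) \<and>
     continuous_on UNIV f'')"

text \<open>Laplacian with vertical drift \<open>a\<close> for the metric
  \<open>e\<^sup>-\<^sup>2\<^sup>p\<^sup>z dx\<^sup>2 + e\<^sup>2\<^sup>q\<^sup>z dy\<^sup>2 + dz\<^sup>2\<close> on the space of triples \<open>(x, y, z)\<close>. The derivatives are
  unspecified values of \<^const>\<open>deriv\<close> where they do not exist; the operator is only
  applied to functions satisfying \<^const>\<open>C2\<close>.\<close>

definition L_Sol :: "real \<Rightarrow> real \<Rightarrow> real \<Rightarrow>
    (real \<times> real \<times> real \<Rightarrow> real) \<Rightarrow> real \<times> real \<times> real \<Rightarrow> real" where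
  "L_Sol p q a f = (\<lambda>(x, y, z).
     1/2 * (exp (2 * p * z) * deriv (deriv (\<lambda>t. f (t, y, z))) x
          + exp (- 2 * q * z) * deriv (deriv (\<lambda>t. f (x, t, z))) y
          + deriv (deriv (\<lambda>t. f (x, y, t))) z)
     + a * deriv (\<lambda>t. f (x, y, t)) z)"

text \<open>The analogue with drift \<open>b\<close> for the hyperbolic plane with metric
  \<open>e\<^sup>-\<^sup>2\<^sup>r\<^sup>z dx\<^sup>2 + dz\<^sup>2\<close> on pairs \<open>(x, z)\<close>.\<close>

definition L_H :: "real \<Rightarrow> real \<Rightarrow>
    (real \<times> real \<Rightarrow> real) \<Rightarrow> real \<times> real \<Rightarrow> real" where
  "L_H r b f = (\<lambda>(x, z).
     1/2 * (exp (2 * r * z) * deriv (deriv (\<lambda>t. f (t, z))) x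
          + deriv (deriv (\<lambda>t. f (x, t))) z)
     + b * deriv (\<lambda>t. f (x, t)) z)"

definition pos_eigen :: "(('a::real_normed_vector \<Rightarrow> real) \<Rightarrow> 'a \<Rightarrow> real) \<Rightarrow> real \<Rightarrow>
    ('a \<Rightarrow> real) set" where
  "pos_eigen L lam = {h. C2 h \<and> (\<forall>x. h x \<ge> 0) \<and> (\<forall>x. L h x = lam * h x)}"

text \<open>For \<^const>\<open>L_Sol\<close> and \<^const>\<open>L_H\<close>, a member \<open>h\<close> of the cone with \<open>h 0 = 1\<close> is strictly positive,
  so the quotients below never have zero denominator.\<close>

definition minimal_eigen :: "(('a::real_normed_vector \<Rightarrow> real) \<Rightarrow> 'a \<Rightarrow> real) \<Rightarrow> real \<Rightarrow>
    ('a \<Rightarrow> real) \<Rightarrow> bool" where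
  "minimal_eigen L lam h \<longleftrightarrow> h \<in> pos_eigen L lam \<and> h 0 = 1 \<and>
     (\<forall>f \<in> pos_eigen L lam. (\<forall>x. f x \<le> h x) \<longrightarrow> (\<exists>c. \<forall>x. f x / h x = c))"

end

theory Submission
  imports Defs
begin

text \<open>
  For \<open>g = e\<^sup>a\<^sup>z h\<close> the eigenvalue equation becomes
  \<open>e\<^sup>2\<^sup>p\<^sup>z g\<^sub>x\<^sub>x + e\<^sup>-\<^sup>2\<^sup>q\<^sup>z g\<^sub>y\<^sub>y + g\<^sub>z\<^sub>z = k g\<close> with \<open>k = 2 \<lambda> + a\<^sup>2 \<ge> 0\<close>. A Bernstein-type gradient
  estimate at the origin is carried everywhere by the left translations of the group and gives
  \<open>\<bar>g\<^sub>x\<bar> \<le> K e\<^sup>-\<^sup>p\<^sup>z g\<close>, \<open>\<bar>g\<^sub>y\<bar> \<le> K e\<^sup>q\<^sup>z g\<close> and \<open>\<bar>g\<^sub>z\<bar> \<le> K g\<close> for positive solutions. So a mixed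
  difference of \<open>g\<close> in \<open>x\<close> and \<open>y\<close> is negligible against the sum of the translates of \<open>g\<close>
  involved, both for \<open>z \<longrightarrow> \<infinity>\<close> and for \<open>z \<longrightarrow> -\<infinity>\<close>; the maximum principle on strips forces it to
  vanish. Hence every non-negative solution has the form \<open>A(x, z) + B(y, z)\<close>. Both summands can be
  made non-negative solutions by shifting a function of \<open>z\<close> between them, and minimality then leaves
  only one of them.
\<close>

subsection \<open>One-variable calculus\<close>

text \<open>Horizontal motion is cheap in opposite places: in \<open>x\<close> where
  \<open>z\<close> is large, in \<open>y\<close> where \<open>z\<close> is very negative. A mixed
  difference is a difference of \<open>x\<close>-differences and also one of
  \<open>y\<close>-differences, so it is small on both boundary planes of a tall strip, although
  neither first difference is. The gradient constant must depend only on \<open>p\<close>,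
  \<open>q\<close>, \<open>k\<close> and not on the solution: only then does one constant serve all
  left translates of a solution at once. The strip is unbounded, so the maximum principle also needs
  control for large \<open>x\<close> and \<open>y\<close>. It comes from the same gradient estimate,
  by carrying out the horizontal motion at a remote height where its cost is as small as desired.
  The condition \<open>k \<ge> 0\<close> gives the right sign at a minimum and keeps the solutions
  in \<open>z\<close> alone from oscillating. For \<open>A + B \<ge> 0\<close> the infimum of
  \<open>A\<close> over \<open>x\<close> separates \<open>A\<close> from \<open>- B\<close> at each
  height, but as a function of \<open>z\<close> it need not solve the equation. A separating
  solution is found strip by strip and survives the limit because solutions in \<open>z\<close>
  alone form a two-dimensional space.\<close>

lemma second_deriv_nonneg_at_local_min:
  fixes f :: "real \<Rightarrow> real"
  assumes f: "\<And>t. (f has_real_derivative f1 t) (at t)"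
    and f1: "(f1 has_real_derivative c) (at a)"
    and d: "d > 0" and min: "\<And>t. \<bar>t - a\<bar> < d \<Longrightarrow> f a \<le> f t"
  shows "f1 a = 0" "c \<ge> 0"
proof -
  show z: "f1 a = 0"
    using DERIV_local_min[OF f d] min by (metis abs_minus_commute)
  show "c \<ge> 0"
  proof (rule ccontr)
    assume "\<not> c \<ge> 0"
    then obtain e where e: "e > 0" "\<And>h. 0 < h \<Longrightarrow> h < e \<Longrightarrow> f1 (a + h) < f1 a"
      using DERIV_neg_dec_right[OF f1] by auto
    define h where "h = min (d/2) (e/2)"
    have h: "0 < h" "h < d" "h < e" using d e(1) by (auto simp: h_def)
    obtain s where s: "s > a" "s < a + h" "f (a + h) - f a = (a + h - a) * f1 s"
      using MVT2[of a "a + h" f f1] f h by auto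
    have "f1 s < 0" using e(2)[of "s - a"] s h z by auto
    hence "h * f1 s < 0" using h(1) by (simp add: mult_pos_neg)
    hence "f (a + h) < f a" using s(3) by simp
    moreover have "f a \<le> f (a + h)" using min[of "a+h"] h by auto
    ultimately show False by simp
  qed
qed

text \<open>The bound on \<open>f1\<close> makes \<open>exp (- c * t) * f t\<close> non-increasing
  and \<open>exp (c * t) * f t\<close> non-decreasing; the two cases compare the values of one of
  them at \<open>s\<close> and \<open>t\<close>.\<close>

lemma log_lipschitz:
  fixes f :: "real \<Rightarrow> real"
  assumes f: "\<And>t. (f has_real_derivative f1 t) (at t)"
    and b: "\<And>t. \<bar>f1 t\<bar> \<le> c * f t"
  shows "f t \<le> exp (c * \<bar>t - s\<bar>) * f s"
proof (cases "s \<le> t")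
  case True
  have "exp (- c * t) * f t \<le> exp (- c * s) * f s"
  proof (rule DERIV_nonpos_imp_nonincreasing[OF True])
    fix r
    have "((\<lambda>r. exp (- c * r) * f r) has_real_derivative (exp (- c * r) * (f1 r - c * f r))) (at r)"
      by (auto intro!: derivative_eq_intros f simp: algebra_simps)
    moreover have "exp (- c * r) * (f1 r - c * f r) \<le> 0"
      using b[of r] by (intro mult_nonneg_nonpos) auto
    ultimately show "\<exists>y. ((\<lambda>r. exp (- c * r) * f r) has_real_derivative y) (at r) \<and> y \<le> 0" by blast
  qed
  hence "exp (c * t) * (exp (- c * t) * f t) \<le> exp (c * t) * (exp (- c * s) * f s)"
    by (intro mult_left_mono) auto
  also have "exp (c * t) * (exp (- c * t) * f t) = f t"
    by (simp flip: mult.assoc exp_add)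
  also have "exp (c * t) * (exp (- c * s) * f s) = exp (c * \<bar>t - s\<bar>) * f s"
    using True by (simp add: algebra_simps flip: mult.assoc exp_add)
  finally show ?thesis .
next
  case False
  have "exp (c * t) * f t \<le> exp (c * s) * f s"
  proof (rule DERIV_nonneg_imp_nondecreasing[of t s])
    show "t \<le> s" using False by simp
    fix r
    have "((\<lambda>r. exp (c * r) * f r) has_real_derivative (exp (c * r) * (f1 r + c * f r))) (at r)"
      by (auto intro!: derivative_eq_intros f simp: algebra_simps)
    moreover have "exp (c * r) * (f1 r + c * f r) \<ge> 0"
      using b[of r] by (intro mult_nonneg_nonneg) auto
    ultimately show "\<exists>y. ((\<lambda>r. exp (c * r) * f r) has_real_derivative y) (at r) \<and> y \<ge> 0" by blast
  qed
  hence "exp (- c * t) * (exp (c * t) * f t) \<le> exp (- c * t) * (exp (c * s) * f s)"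
    by (intro mult_left_mono) auto
  also have "exp (- c * t) * (exp (c * t) * f t) = f t"
    by (simp flip: mult.assoc exp_add)
  also have "exp (- c * t) * (exp (c * s) * f s) = exp (c * \<bar>t - s\<bar>) * f s"
    using False by (simp add: algebra_simps flip: mult.assoc exp_add)
  finally show ?thesis .
qed

subsection \<open>The equation and the left translations of the group\<close>

text \<open>The partial derivatives are explicit arguments, so that linear combinations and
  translates come with formulas for theirs. Only pure second derivatives occur; \<open>C2\<close>
  regularity is tracked separately.\<close>

definition pde_partials where
  "pde_partials p q k f fx fy fz fxx fyy fzz \<longleftrightarrow> (\<forall>x y z :: real.
     ((\<lambda>t. f (t, y, z)) has_real_derivative fx (x, y, z)) (at x) \<and>
     ((\<lambda>t. fx (t, y, z)) has_real_derivative fxx (x, y, z)) (at x) \<and>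
     ((\<lambda>t. f (x, t, z)) has_real_derivative fy (x, y, z)) (at y) \<and>
     ((\<lambda>t. fy (x, t, z)) has_real_derivative fyy (x, y, z)) (at y) \<and>
     ((\<lambda>t. f (x, y, t)) has_real_derivative fz (x, y, z)) (at z) \<and>
     ((\<lambda>t. fz (x, y, t)) has_real_derivative fzz (x, y, z)) (at z) \<and>
     exp (2 * p * z) * fxx (x, y, z) + exp (- 2 * q * z) * fyy (x, y, z) + fzz (x, y, z) = k * f (x, y, z))"

definition pde_sol :: "real \<Rightarrow> real \<Rightarrow> real \<Rightarrow> (real \<times> real \<times> real \<Rightarrow> real) \<Rightarrow> bool" where
  "pde_sol p q k f \<longleftrightarrow> continuous_on UNIV f \<and>
     (\<exists>fx fy fz fxx fyy fzz. pde_partials p q k f fx fy fz fxx fyy fzz)"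

lemma pde_solI:
  "continuous_on UNIV f \<Longrightarrow> pde_partials p q k f fx fy fz fxx fyy fzz \<Longrightarrow> pde_sol p q k f"
  unfolding pde_sol_def by blast

lemma pde_solE:
  assumes "pde_sol p q k f"
  obtains fx fy fz fxx fyy fzz
  where "continuous_on UNIV f" "pde_partials p q k f fx fy fz fxx fyy fzz"
  using assms unfolding pde_sol_def by blast

lemma pde_partialsD:
  assumes "pde_partials p q k f fx fy fz fxx fyy fzz"
  shows "((\<lambda>t. f (t, y, z)) has_real_derivative fx (x, y, z)) (at x)"
    "((\<lambda>t. fx (t, y, z)) has_real_derivative fxx (x, y, z)) (at x)"
    "((\<lambda>t. f (x, t, z)) has_real_derivative fy (x, y, z)) (at y)"
    "((\<lambda>t. fy (x, t, z)) has_real_derivative fyy (x, y, z)) (at y)"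
    "((\<lambda>t. f (x, y, t)) has_real_derivative fz (x, y, z)) (at z)"
    "((\<lambda>t. fz (x, y, t)) has_real_derivative fzz (x, y, z)) (at z)"
    "exp (2 * p * z) * fxx (x, y, z) + exp (- 2 * q * z) * fyy (x, y, z) + fzz (x, y, z) = k * f (x, y, z)"
  using assms unfolding pde_partials_def by auto

lemma pde_partials_lincomb:
  assumes "pde_partials p q k f fx fy fz fxx fyy fzz" and "pde_partials p q k g gx gy gz gxx gyy gzz"
  shows "pde_partials p q k (\<lambda>P. c * f P + d * g P) (\<lambda>P. c * fx P + d * gx P) (\<lambda>P. c * fy P + d * gy P)
     (\<lambda>P. c * fz P + d * gz P) (\<lambda>P. c * fxx P + d * gxx P) (\<lambda>P. c * fyy P + d * gyy P)
     (\<lambda>P. c * fzz P + d * gzz P)"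
  unfolding pde_partials_def
proof (intro allI conjI)
  note f = pde_partialsD[OF assms(1)] and g = pde_partialsD[OF assms(2)]
  fix x y z
  have "exp (2 * p * z) * (c * fxx (x, y, z) + d * gxx (x, y, z)) +
     exp (- 2 * q * z) * (c * fyy (x, y, z) + d * gyy (x, y, z)) +
     (c * fzz (x, y, z) + d * gzz (x, y, z)) =
     c * (exp (2 * p * z) * fxx (x, y, z) + exp (- 2 * q * z) * fyy (x, y, z) + fzz (x, y, z)) +
     d * (exp (2 * p * z) * gxx (x, y, z) + exp (- 2 * q * z) * gyy (x, y, z) + gzz (x, y, z))"
    by algebra
  thus "exp (2 * p * z) * (c * fxx (x, y, z) + d * gxx (x, y, z)) +
     exp (- 2 * q * z) * (c * fyy (x, y, z) + d * gyy (x, y, z)) +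
     (c * fzz (x, y, z) + d * gzz (x, y, z)) = k * (c * f (x, y, z) + d * g (x, y, z))"
    unfolding f(7) g(7) by (simp add: algebra_simps)
qed (intro DERIV_add DERIV_cmult pde_partialsD[OF assms(1)] pde_partialsD[OF assms(2)])+

lemma pde_sol_lincomb:
  assumes "pde_sol p q k f" and "pde_sol p q k g"
  shows "pde_sol p q k (\<lambda>P. c * f P + d * g P)"
  using assms
  by (elim pde_solE) (rule pde_solI, intro continuous_intros, auto intro: pde_partials_lincomb)

text \<open>Left multiplication by \<open>(b, c, d)\<close> in the group Sol(p,q). The factors on
  \<open>x\<close> and \<open>y\<close> compensate the effect of the shift of \<open>z\<close> on
  the metric, so these maps are isometries; they carry the origin to any given point.\<close>

definition left_translate :: "real \<Rightarrow> real \<Rightarrow> real \<times> real \<times> real \<Rightarrow> real \<times> real \<times> real \<Rightarrow> real \<times> real \<times> real" where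
  "left_translate p q = (\<lambda>(b, c, d) (x, y, z). (exp (p * d) * x + b, exp (- q * d) * y + c, z + d))"

lemma DERIV_affine_arg:
  assumes "\<And>t. ((\<lambda>t. f t) has_real_derivative f' t) (at t)"
  shows "((\<lambda>t. f (m * t + b)) has_real_derivative m * f' (m * t + b)) (at t)"
proof -
  have "((\<lambda>t. m * t + b) has_real_derivative m) (at t)"
    by (auto intro!: derivative_eq_intros)
  from DERIV_chain2[OF assms this] show ?thesis by (simp add: mult.commute)
qed

lemma pde_partials_left_translate:
  assumes "pde_partials p q k f fx fy fz fxx fyy fzz"
  shows "pde_partials p q k (\<lambda>P. f (left_translate p q (b, c, d) P))
     (\<lambda>P. exp (p * d) * fx (left_translate p q (b, c, d) P))
     (\<lambda>P. exp (- q * d) * fy (left_translate p q (b, c, d) P))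
     (\<lambda>P. fz (left_translate p q (b, c, d) P))
     (\<lambda>P. exp (p * d) * (exp (p * d) * fxx (left_translate p q (b, c, d) P)))
     (\<lambda>P. exp (- q * d) * (exp (- q * d) * fyy (left_translate p q (b, c, d) P)))
     (\<lambda>P. fzz (left_translate p q (b, c, d) P))"
  unfolding pde_partials_def left_translate_def prod.case
proof (intro allI conjI)
  note f = pde_partialsD[OF assms(1)]
  fix x y z
  show "((\<lambda>t. f (exp (p * d) * t + b, exp (- q * d) * y + c, z + d)) has_real_derivative
        exp (p * d) * fx (exp (p * d) * x + b, exp (- q * d) * y + c, z + d)) (at x)"
    by (rule DERIV_affine_arg) (rule f)
  show "((\<lambda>t. exp (p * d) * fx (exp (p * d) * t + b, exp (- q * d) * y + c, z + d)) has_real_derivative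
        exp (p * d) * (exp (p * d) * fxx (exp (p * d) * x + b, exp (- q * d) * y + c, z + d))) (at x)"
    by (rule DERIV_cmult, rule DERIV_affine_arg) (rule f)
  show "((\<lambda>t. f (exp (p * d) * x + b, exp (- q * d) * t + c, z + d)) has_real_derivative
        exp (- q * d) * fy (exp (p * d) * x + b, exp (- q * d) * y + c, z + d)) (at y)"
    by (rule DERIV_affine_arg) (rule f)
  show "((\<lambda>t. exp (- q * d) * fy (exp (p * d) * x + b, exp (- q * d) * t + c, z + d)) has_real_derivative
        exp (- q * d) * (exp (- q * d) * fyy (exp (p * d) * x + b, exp (- q * d) * y + c, z + d))) (at y)"
    by (rule DERIV_cmult, rule DERIV_affine_arg) (rule f)
  show "((\<lambda>t. f (exp (p * d) * x + b, exp (- q * d) * y + c, t + d)) has_real_derivative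
        fz (exp (p * d) * x + b, exp (- q * d) * y + c, z + d)) (at z)"
    using DERIV_affine_arg[where m = 1 and b = d and t = z, OF f(5)] by simp
  show "((\<lambda>t. fz (exp (p * d) * x + b, exp (- q * d) * y + c, t + d)) has_real_derivative
        fzz (exp (p * d) * x + b, exp (- q * d) * y + c, z + d)) (at z)"
    using DERIV_affine_arg[where m = 1 and b = d and t = z, OF f(6)] by simp
  have e: "exp (2 * p * z) * (exp (p * d) * exp (p * d)) = exp (2 * p * (z + d))"
    "exp (- 2 * q * z) * (exp (- q * d) * exp (- q * d)) = exp (- 2 * q * (z + d))"
    by (simp_all add: algebra_simps flip: exp_add)
  show "exp (2 * p * z) * (exp (p * d) * (exp (p * d) * fxx (exp (p * d) * x + b, exp (- q * d) * y + c, z + d))) +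
       exp (- 2 * q * z) * (exp (- q * d) * (exp (- q * d) * fyy (exp (p * d) * x + b, exp (- q * d) * y + c, z + d))) +
       fzz (exp (p * d) * x + b, exp (- q * d) * y + c, z + d) =
       k * f (exp (p * d) * x + b, exp (- q * d) * y + c, z + d)"
    unfolding f(7)[symmetric] e[symmetric] by (simp add: mult.assoc)
qed

lemma continuous_left_translate: "continuous_on UNIV (left_translate p q g)"
  unfolding left_translate_def case_prod_beta by (intro continuous_intros)

lemma pde_sol_left_translate:
  assumes "pde_sol p q k f"
  shows "pde_sol p q k (\<lambda>P. f (left_translate p q g P))"
  using assms
proof (elim pde_solE)
  fix fx fy fz fxx fyy fzz
  assume f: "continuous_on UNIV f" "pde_partials p q k f fx fy fz fxx fyy fzz"
  obtain b c d where g: "g = (b, c, d)" by (cases g)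
  show ?thesis
    using pde_partials_left_translate[OF f(2), of b c d] unfolding g
    by (rule pde_solI[rotated])
       (rule continuous_on_compose2[OF f(1) continuous_left_translate], simp)
qed

subsection \<open>Maximum principle on strips\<close>

text \<open>Every rate \<open>e\<close> is allowed because the barrier on the strip of half-height
  \<open>N\<close> grows at a rate that shrinks as \<open>N\<close> grows, and it has to dominate
  the solution for each \<open>N\<close>.\<close>

definition subexp_on_strip :: "real \<Rightarrow> (real \<times> real \<times> real \<Rightarrow> real) \<Rightarrow> bool" where
  "subexp_on_strip N f \<longleftrightarrow>
     (\<forall>e>0. \<exists>C. \<forall>x y z. \<bar>z\<bar> \<le> N \<longrightarrow> \<bar>f (x, y, z)\<bar> \<le> C * exp (e * (\<bar>x\<bar> + \<bar>y\<bar>)))"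

lemma cosh_ge_half_exp: "cosh (t::real) \<ge> exp \<bar>t\<bar> / 2"
  by (cases "t \<ge> 0") (auto simp: cosh_field_def field_simps)

text \<open>Phragmen-Lindelof argument with the barrier \<open>cos (d z) cosh (e x) cosh (e y)\<close>, a strict
  supersolution on the strip when \<open>e\<close> is small compared with \<open>d\<close>.\<close>

lemma strip_maximum_principle:
  fixes f :: "real \<times> real \<times> real \<Rightarrow> real"
  assumes sol: "pde_sol p q k f" and k: "k \<ge> 0" and p: "p > 0" and q: "q > 0" and N: "N > 0"
    and growth: "subexp_on_strip N f"
    and bd: "\<And>x y. f (x, y, N) \<ge> 0" "\<And>x y. f (x, y, -N) \<ge> 0"
    and z: "\<bar>z\<bar> \<le> N"
  shows "f (x, y, z) \<ge> 0"
proof -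
  obtain fx fy fz fxx fyy fzz where cont: "continuous_on UNIV f"
    and "pde_partials p q k f fx fy fz fxx fyy fzz"
    using sol unfolding pde_sol_def by blast
  note f = pde_partialsD[OF this(2)]
  \<comment> \<open>\<open>d\<close> keeps the argument of the cosine within \<open>[-1, 1]\<close>,
    hence the cosine above \<open>cos 1\<close>. \<open>M\<close> bounds both coefficients of the
    equation on the strip, and \<open>e\<close> is chosen so that
    \<open>2 * e\<^sup>2 * M = d\<^sup>2 / (2 * M) < d\<^sup>2\<close>, which makes the barrier a
    strict supersolution.\<close>
  define d where "d = 1 / N"
  define M where "M = exp (2 * (p + q) * N)"
  define e where "e = d / (2 * M)"
  have d: "d > 0" using N by (simp add: d_def)
  have M: "M \<ge> 1" using N p q by (simp add: M_def)
  have e: "e > 0" using d M by (simp add: e_def)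
  have coeff: "e\<^sup>2 * exp (2 * p * z) + e\<^sup>2 * exp (- 2 * q * z) < d\<^sup>2" if "\<bar>z\<bar> \<le> N" for z
  proof -
    have "2 * p * z \<le> 2 * (p + q) * N" "- 2 * q * z \<le> 2 * (p + q) * N"
    proof -
      have "p * z \<le> p * N" "q * (-z) \<le> q * N" "p * N \<ge> 0" "q * N \<ge> 0"
        using that p q N by (intro mult_left_mono mult_nonneg_nonneg; linarith)+
      thus "2 * p * z \<le> 2 * (p + q) * N" "- 2 * q * z \<le> 2 * (p + q) * N"
        by (simp_all add: algebra_simps)
    qed
    hence "exp (2 * p * z) \<le> M" "exp (- 2 * q * z) \<le> M" by (simp_all add: M_def)
    hence "e\<^sup>2 * exp (2 * p * z) + e\<^sup>2 * exp (- 2 * q * z) \<le> e\<^sup>2 * M + e\<^sup>2 * M"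
      by (intro add_mono mult_left_mono) auto
    also have "\<dots> = d\<^sup>2 / (2 * M)"
      using M by (simp add: e_def field_simps power2_eq_square)
    also have "\<dots> < d\<^sup>2"
    proof -
      have "d\<^sup>2 > 0" using d by simp
      thus ?thesis using M by (simp add: divide_less_eq)
    qed
    finally show ?thesis .
  qed
  define b where "b = (\<lambda>(x, y, z). cos (d * z) * cosh (e * x) * cosh (e * y))"
  have cos_ge: "cos (d * z) \<ge> cos 1" if "\<bar>z\<bar> \<le> N" for z
  proof -
    have "\<bar>d * z\<bar> \<le> 1" using that N by (simp add: d_def abs_mult field_simps)
    hence "cos \<bar>d * z\<bar> \<ge> cos 1"
      by (intro cos_monotone_0_pi_le) (use pi_ge_two in auto)
    thus ?thesis by simp
  qed
  have cos1: "cos (1::real) > 0"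
    by (rule cos_gt_zero_pi) (use pi_gt3 in auto)
  have bge: "b (x, y, z) \<ge> cos 1 / 4 * exp (e * (\<bar>x\<bar> + \<bar>y\<bar>))" if "\<bar>z\<bar> \<le> N" for x y z
  proof -
    have "cos (d * z) * cosh (e * x) * cosh (e * y) \<ge> cos 1 * (exp \<bar>e * x\<bar> / 2) * (exp \<bar>e * y\<bar> / 2)"
      using cos_ge[OF that] cos1 by (intro mult_mono cosh_ge_half_exp) auto
    moreover have "cos 1 * (exp \<bar>e * x\<bar> / 2) * (exp \<bar>e * y\<bar> / 2) = cos 1 / 4 * exp (e * (\<bar>x\<bar> + \<bar>y\<bar>))"
      using e by (simp add: abs_mult distrib_left exp_add)
    ultimately show ?thesis unfolding b_def by (simp only: prod.case)
  qed
  have bpos: "b (x, y, z) > 0" if "\<bar>z\<bar> \<le> N" for x y z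
    by (rule less_le_trans[OF _ bge[OF that]]) (use cos1 in auto)
  have main: "f (x, y, z) + s * b (x, y, z) \<ge> 0" if s: "s > 0" and z: "\<bar>z\<bar> \<le> N" for s x y z
  proof (rule ccontr)
    assume neg: "\<not> f (x, y, z) + s * b (x, y, z) \<ge> 0"
    \<comment> \<open>Half the rate of the barrier, so that the barrier wins far out.\<close>
    obtain C where C: "\<And>x y z. \<bar>z\<bar> \<le> N \<Longrightarrow> \<bar>f (x, y, z)\<bar> \<le> C * exp (e / 2 * (\<bar>x\<bar> + \<bar>y\<bar>))"
      using growth e unfolding subexp_on_strip_def by (meson half_gt_zero)
    \<comment> \<open>The first entry puts the point of negativity inside; the second makes the
      barrier outweigh \<open>f\<close> wherever
      \<open>\<bar>x'\<bar> + \<bar>y'\<bar> \<ge> R\<close>.\<close>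
    define R where "R = max (\<bar>x\<bar> + \<bar>y\<bar> + 1) (2 / e * (\<bar>4 * C / (s * cos 1)\<bar>))"
    have R: "R \<ge> \<bar>x\<bar> + \<bar>y\<bar> + 1" by (simp add: R_def)
    have out: "f (x', y', z') + s * b (x', y', z') \<ge> 0"
      if "\<bar>z'\<bar> \<le> N" "\<bar>x'\<bar> + \<bar>y'\<bar> \<ge> R" for x' y' z'
    proof -
      let ?r = "\<bar>x'\<bar> + \<bar>y'\<bar>"
      have "e / 2 * (2 / e * \<bar>4 * C / (s * cos 1)\<bar>) \<le> e / 2 * R"
        using e by (intro mult_left_mono) (auto simp: R_def)
      hence "\<bar>4 * C / (s * cos 1)\<bar> \<le> e / 2 * R"
        using e by simp
      also have "\<dots> \<le> e / 2 * ?r" using that e by simp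
      also have "\<dots> \<le> exp (e / 2 * ?r)" using exp_ge_add_one_self[of "e / 2 * ?r"] by linarith
      finally have "4 * C / (s * cos 1) \<le> exp (e / 2 * ?r)" by (rule order_trans[OF abs_ge_self])
      hence "C \<le> s * (cos 1 / 4) * exp (e / 2 * ?r)" using s cos1 by (simp add: field_simps)
      hence "C * exp (e / 2 * ?r) \<le> s * (cos 1 / 4) * exp (e / 2 * ?r) * exp (e / 2 * ?r)"
        by (intro mult_right_mono) auto
      also have "\<dots> = s * (cos 1 / 4 * exp (e * ?r))" by (simp add: mult.assoc flip: exp_add)
      also have "\<dots> \<le> s * b (x', y', z')" using bge[OF that(1)] s by (intro mult_left_mono) auto
      finally show ?thesis using C[OF that(1), of x' y'] by linarith
    qed
    define K where "K = {-R..R} \<times> {-R..R} \<times> {-N..N}"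
    have "compact K" unfolding K_def by (intro compact_Times) auto
    moreover have inK: "(x, y, z) \<in> K" using R z by (auto simp: K_def)
    moreover have "continuous_on K (\<lambda>P. f P + s * b P)"
      unfolding b_def case_prod_beta
      by (intro continuous_intros continuous_on_subset[OF cont]) auto
    ultimately obtain P where P: "P \<in> K" "\<And>P'. P' \<in> K \<Longrightarrow> f P + s * b P \<le> f P' + s * b P'"
      using continuous_attains_inf[of K "\<lambda>P. f P + s * b P"] by blast
    obtain x0 y0 z0 where P0: "P = (x0, y0, z0)" by (cases P)
    have less: "f (x0, y0, z0) + s * b (x0, y0, z0) < 0"
      using P(2)[OF inK] neg P0 by simp
    have z0: "\<bar>z0\<bar> \<le> N" using P(1) P0 by (auto simp: K_def)
    \<comment> \<open>\<open>K\<close> is a box, while \<open>out\<close> concerns the complement of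
      a diamond inside it. The negative minimum lies in the open diamond, which leaves room on the
      \<open>x\<close>- and \<open>y\<close>-lines through it.\<close>
    have r: "\<bar>x0\<bar> + \<bar>y0\<bar> < R" using out[OF z0, of x0 y0] less by linarith
    have z0': "\<bar>z0\<bar> < N"
    proof (rule ccontr)
      assume "\<not> \<bar>z0\<bar> < N"
      hence "z0 = N \<or> z0 = -N" using z0 by linarith
      hence "f (x0, y0, z0) \<ge> 0" using bd by auto
      thus False using less bpos[OF z0, of x0 y0] s by (simp add: not_less add_nonneg_nonneg flip: not_le)
    qed
    let ?b = "b (x0, y0, z0)"
    have "fxx (x0, y0, z0) + s * (e\<^sup>2 * ?b) \<ge> 0"
    proof (rule second_deriv_nonneg_at_local_min(2)[where a = x0 and d = "R - \<bar>x0\<bar>"])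
      show "((\<lambda>t. f (t, y0, z0) + s * b (t, y0, z0)) has_real_derivative
         fx (t, y0, z0) + s * (cos (d * z0) * (e * sinh (e * t)) * cosh (e * y0))) (at t)" for t
        unfolding b_def by (auto intro!: derivative_eq_intros f(1))
      show "((\<lambda>t. fx (t, y0, z0) + s * (cos (d * z0) * (e * sinh (e * t)) * cosh (e * y0))) has_real_derivative
         fxx (x0, y0, z0) + s * (e\<^sup>2 * ?b)) (at x0)"
        unfolding b_def by (auto intro!: derivative_eq_intros f(2) simp: power2_eq_square)
      fix t assume "\<bar>t - x0\<bar> < R - \<bar>x0\<bar>"
      hence "(t, y0, z0) \<in> K" using P(1) P0 by (auto simp: K_def)
      thus "f (x0, y0, z0) + s * ?b \<le> f (t, y0, z0) + s * b (t, y0, z0)" using P(2) P0 by simp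
    qed (use r in auto)
    moreover have "fyy (x0, y0, z0) + s * (e\<^sup>2 * ?b) \<ge> 0"
    proof (rule second_deriv_nonneg_at_local_min(2)[where a = y0 and d = "R - \<bar>y0\<bar>"])
      show "((\<lambda>t. f (x0, t, z0) + s * b (x0, t, z0)) has_real_derivative
         fy (x0, t, z0) + s * (cos (d * z0) * cosh (e * x0) * (e * sinh (e * t)))) (at t)" for t
        unfolding b_def by (auto intro!: derivative_eq_intros f(3))
      show "((\<lambda>t. fy (x0, t, z0) + s * (cos (d * z0) * cosh (e * x0) * (e * sinh (e * t)))) has_real_derivative
         fyy (x0, y0, z0) + s * (e\<^sup>2 * ?b)) (at y0)"
        unfolding b_def by (auto intro!: derivative_eq_intros f(4) simp: power2_eq_square)
      fix t assume "\<bar>t - y0\<bar> < R - \<bar>y0\<bar>"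
      hence "(x0, t, z0) \<in> K" using P(1) P0 by (auto simp: K_def)
      thus "f (x0, y0, z0) + s * ?b \<le> f (x0, t, z0) + s * b (x0, t, z0)" using P(2) P0 by simp
    qed (use r in auto)
    moreover have "fzz (x0, y0, z0) + s * (- d\<^sup>2 * ?b) \<ge> 0"
    proof (rule second_deriv_nonneg_at_local_min(2)[where a = z0 and d = "N - \<bar>z0\<bar>"])
      show "((\<lambda>t. f (x0, y0, t) + s * b (x0, y0, t)) has_real_derivative
         fz (x0, y0, t) + s * (- d * sin (d * t) * cosh (e * x0) * cosh (e * y0))) (at t)" for t
        unfolding b_def by (auto intro!: derivative_eq_intros f(5))
      show "((\<lambda>t. fz (x0, y0, t) + s * (- d * sin (d * t) * cosh (e * x0) * cosh (e * y0))) has_real_derivative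
         fzz (x0, y0, z0) + s * (- d\<^sup>2 * ?b)) (at z0)"
        unfolding b_def by (auto intro!: derivative_eq_intros f(6) simp: power2_eq_square)
      fix t assume "\<bar>t - z0\<bar> < N - \<bar>z0\<bar>"
      hence "(x0, y0, t) \<in> K" using P(1) P0 by (auto simp: K_def)
      thus "f (x0, y0, z0) + s * ?b \<le> f (x0, y0, t) + s * b (x0, y0, t)" using P(2) P0 by simp
    qed (use z0' in auto)
    ultimately have "0 \<le> exp (2 * p * z0) * (fxx (x0, y0, z0) + s * (e\<^sup>2 * ?b)) +
        exp (- 2 * q * z0) * (fyy (x0, y0, z0) + s * (e\<^sup>2 * ?b)) + (fzz (x0, y0, z0) + s * (- d\<^sup>2 * ?b))"
      by (rule add_nonneg_nonneg[OF add_nonneg_nonneg[OF mult_nonneg_nonneg[OF exp_ge_zero]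
          mult_nonneg_nonneg[OF exp_ge_zero]]])
    also have "\<dots> = k * f (x0, y0, z0) + s * ?b * ((e\<^sup>2 * exp (2 * p * z0) + e\<^sup>2 * exp (- 2 * q * z0)) - d\<^sup>2)"
      unfolding f(7)[symmetric] by algebra
    also have "\<dots> < k * f (x0, y0, z0)"
      using coeff[OF z0] bpos[OF z0, of x0 y0] s by (simp add: mult_pos_neg)
    \<comment> \<open>The minimum of \<open>f + s b\<close> is negative and \<open>s b\<close> is
      positive, so \<open>f\<close> itself is negative there; with \<open>k \<ge> 0\<close> this
      contradicts the strict supersolution property.\<close>
    also have "\<dots> \<le> 0"
    proof -
      have "s * ?b > 0" using bpos[OF z0, of x0 y0] s by simp
      hence "f (x0, y0, z0) \<le> 0" using less by linarith
      thus ?thesis using k by (simp add: mult_nonneg_nonpos)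
    qed
    finally show False by simp
  qed
  show ?thesis
  proof (rule ccontr)
    assume "\<not> f (x, y, z) \<ge> 0"
    hence *: "f (x, y, z) < 0" by simp
    \<comment> \<open>Any \<open>s > 0\<close> is admissible in \<open>main\<close>; this one turns
      \<open>f + s b\<close> at the point into \<open>f / 2 < 0\<close>.\<close>
    define s where "s = - f (x, y, z) / (2 * b (x, y, z))"
    have "s > 0" "s * b (x, y, z) = - f (x, y, z) / 2" using * bpos[OF z, of x y] by (auto simp: s_def field_simps)
    thus False using main[OF _ z, of s x y] * by linarith
  qed
qed

subsection \<open>The Bernstein gradient estimate\<close>

text \<open>One coordinate line of the Bernstein argument: \<open>w\<close> will be the cutoff and
  \<open>k1\<close>, \<open>k2\<close>, \<open>k3\<close> the quotients of solutions.
  \<open>Q''\<close> keeps \<open>k1''\<close>, \<open>k2''\<close>, \<open>k3''\<close> visible so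
  that their expression through the drift can be inserted later.\<close>

lemma second_deriv_at_local_max_of_weighted_squares:
  fixes w k1 k2 k3 :: "real \<Rightarrow> real"
  assumes w: "\<And>t. (w has_real_derivative w' t) (at t)" "(w' has_real_derivative w'') (at a)"
    and k1: "\<And>t. (k1 has_real_derivative k1' t) (at t)" "(k1' has_real_derivative k1'') (at a)"
    and k2: "\<And>t. (k2 has_real_derivative k2' t) (at t)" "(k2' has_real_derivative k2'') (at a)"
    and k3: "\<And>t. (k3 has_real_derivative k3' t) (at t)" "(k3' has_real_derivative k3'') (at a)"
    and d: "d > 0" and max: "\<And>t. \<bar>t - a\<bar> < d \<Longrightarrow>
      w t * ((k1 t)\<^sup>2 + (k2 t)\<^sup>2 + (k3 t)\<^sup>2) \<le> w a * ((k1 a)\<^sup>2 + (k2 a)\<^sup>2 + (k3 a)\<^sup>2)"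
  defines "Q \<equiv> (k1 a)\<^sup>2 + (k2 a)\<^sup>2 + (k3 a)\<^sup>2"
    and "Q' \<equiv> 2 * (k1 a * k1' a + k2 a * k2' a + k3 a * k3' a)"
    and "Q'' \<equiv> 2 * ((k1' a)\<^sup>2 + (k2' a)\<^sup>2 + (k3' a)\<^sup>2 + (k1 a * k1'' + k2 a * k2'' + k3 a * k3''))"
  shows "w' a * Q + w a * Q' = 0" "w'' * Q + 2 * w' a * Q' + w a * Q'' \<le> 0"
proof -
  let ?g = "\<lambda>t. - (w t * ((k1 t)\<^sup>2 + (k2 t)\<^sup>2 + (k3 t)\<^sup>2))"
  let ?g1 = "\<lambda>t. - (w' t * ((k1 t)\<^sup>2 + (k2 t)\<^sup>2 + (k3 t)\<^sup>2) +
     w t * (2 * (k1 t * k1' t + k2 t * k2' t + k3 t * k3' t)))"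
  have 1: "(?g has_real_derivative ?g1 t) (at t)" for t
    by (auto intro!: derivative_eq_intros w k1 k2 k3 simp: algebra_simps)
  have 2: "(?g1 has_real_derivative - (w'' * Q + 2 * w' a * Q' + w a * Q'')) (at a)"
    unfolding Q_def Q'_def Q''_def
    by (auto intro!: derivative_eq_intros w k1 k2 k3 simp: algebra_simps power2_eq_square)
  have 3: "?g a \<le> ?g t" if "\<bar>t - a\<bar> < d" for t using max[OF that] by simp
  have "?g1 a = 0" "- (w'' * Q + 2 * w' a * Q' + w a * Q'') \<ge> 0"
    using second_deriv_nonneg_at_local_min[OF 1 2 d 3] by blast+
  thus "w' a * Q + w a * Q' = 0" "w'' * Q + 2 * w' a * Q' + w a * Q'' \<le> 0"
    unfolding Q_def Q'_def by auto
qed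

text \<open>The base point \<open>B n\<close> moves with \<open>n\<close> (it will be the maximum
  point of the \<open>n\<close>-th quotient), so differentiability at \<open>P\<close> does not
  suffice. The mean value theorem on the segment moves the derivative to an intermediate point, and
  joint continuity of \<open>F\<close> gives the limit.\<close>

lemma strict_difference_quotient:
  fixes f :: "'a::real_normed_vector \<Rightarrow> real" and A B :: "nat \<Rightarrow> 'a"
  assumes f: "\<And>P. (f has_derivative F P) (at P)"
    and cont: "\<And>X V v. X \<longlonglongrightarrow> P \<Longrightarrow> V \<longlonglongrightarrow> v \<Longrightarrow> (\<lambda>n. F (X n) (V n)) \<longlonglongrightarrow> F P v"
    and A: "A \<longlonglongrightarrow> P" and B: "B \<longlonglongrightarrow> P" and v: "(\<lambda>n. (A n - B n) /\<^sub>R e n) \<longlonglongrightarrow> v"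
  shows "(\<lambda>n. (f (A n) - f (B n)) / e n) \<longlonglongrightarrow> F P v"
proof -
  have "\<exists>t\<in>{0..1}. f (A n) - f (B n) = F (B n + t *\<^sub>R (A n - B n)) (A n - B n)" for n
  proof -
    have "((\<lambda>t. f (B n + t *\<^sub>R (A n - B n))) has_derivative
        (\<lambda>u. F (B n + t *\<^sub>R (A n - B n)) (u *\<^sub>R (A n - B n)))) (at t within {0..1})" for t
      by (rule has_derivative_compose[OF _ f]) (auto intro!: derivative_eq_intros)
    from mvt_very_simple[OF zero_le_one this]
    show ?thesis by auto
  qed
  then obtain t where t: "\<And>n. t n \<in> {0..1}"
    "\<And>n. f (A n) - f (B n) = F (B n + t n *\<^sub>R (A n - B n)) (A n - B n)" by metis
  have AB: "(\<lambda>n. A n - B n) \<longlonglongrightarrow> 0" using tendsto_diff[OF A B] by simp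
  have "(\<lambda>n. t n *\<^sub>R (A n - B n)) \<longlonglongrightarrow> 0"
  proof (rule Lim_null_comparison[OF _ tendsto_norm_zero[OF AB]])
    show "\<forall>\<^sub>F n in sequentially. norm (t n *\<^sub>R (A n - B n)) \<le> norm (A n - B n)"
      using t(1) by (intro always_eventually) (auto intro!: mult_left_le_one_le)
  qed
  from tendsto_add[OF B this] have "(\<lambda>n. B n + t n *\<^sub>R (A n - B n)) \<longlonglongrightarrow> P" by simp
  from cont[OF this v]
  have "(\<lambda>n. F (B n + t n *\<^sub>R (A n - B n)) ((A n - B n) /\<^sub>R e n)) \<longlonglongrightarrow> F P v" .
  moreover have "F (B n + t n *\<^sub>R (A n - B n)) ((A n - B n) /\<^sub>R e n) = (f (A n) - f (B n)) / e n" for n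
    unfolding t(2) using linear_scale[OF has_derivative_linear[OF f]]
    by (simp add: divide_inverse mult.commute)
  ultimately show ?thesis by simp
qed

lemma C2_partials:
  fixes h :: "real \<times> real \<times> real \<Rightarrow> real"
  assumes "C2 h"
  obtains h' and Hx Hy Hz :: "real \<times> real \<times> real \<Rightarrow> real \<times> real \<times> real \<Rightarrow> real"
  where "\<And>P. (h has_derivative h' P) (at P)"
    "\<And>P. ((\<lambda>P. h' P (1, 0, 0)) has_derivative Hx P) (at P)"
    "\<And>P. ((\<lambda>P. h' P (0, 1, 0)) has_derivative Hy P) (at P)"
    "\<And>P. ((\<lambda>P. h' P (0, 0, 1)) has_derivative Hz P) (at P)"
    "\<And>X V P v. X \<longlonglongrightarrow> P \<Longrightarrow> V \<longlonglongrightarrow> v \<Longrightarrow> (\<lambda>n. h' (X n) (V n)) \<longlonglongrightarrow> h' P v"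
    "\<And>X V P v. X \<longlonglongrightarrow> P \<Longrightarrow> V \<longlonglongrightarrow> v \<Longrightarrow> (\<lambda>n. Hx (X n) (V n)) \<longlonglongrightarrow> Hx P v"
    "\<And>X V P v. X \<longlonglongrightarrow> P \<Longrightarrow> V \<longlonglongrightarrow> v \<Longrightarrow> (\<lambda>n. Hy (X n) (V n)) \<longlonglongrightarrow> Hy P v"
    "\<And>X V P v. X \<longlonglongrightarrow> P \<Longrightarrow> V \<longlonglongrightarrow> v \<Longrightarrow> (\<lambda>n. Hz (X n) (V n)) \<longlonglongrightarrow> Hz P v"
proof -
  obtain f' :: "real \<times> real \<times> real \<Rightarrow> (real \<times> real \<times> real) \<Rightarrow>\<^sub>L real" and f''
    where f: "\<And>x. (h has_derivative blinfun_apply (f' x)) (at x)"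
      "\<And>x. (f' has_derivative blinfun_apply (f'' x)) (at x)" "continuous_on UNIV f''"
    using assms unfolding C2_def by blast
  have D: "((\<lambda>P. f' P e) has_derivative (\<lambda>v. f'' P v e)) (at P)" for P e
    by (auto intro!: derivative_eq_intros f(2))
  have lim1: "(\<lambda>n. f' (X n) (V n)) \<longlonglongrightarrow> f' P v" if "X \<longlonglongrightarrow> P" "V \<longlonglongrightarrow> v" for X V P v
    by (intro tendsto_intros that isCont_tendsto_compose[OF has_derivative_continuous[OF f(2)]])
  have lim2: "(\<lambda>n. f'' (X n) (V n) e) \<longlonglongrightarrow> f'' P v e" if "X \<longlonglongrightarrow> P" "V \<longlonglongrightarrow> v" for X V P v e
  proof -
    have "isCont f'' P" using f(3) continuous_on_eq_continuous_at[OF open_UNIV] by blast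
    thus ?thesis by (intro tendsto_intros that isCont_tendsto_compose[of P f''])
  qed
  show thesis
    by (rule that[of "\<lambda>P. blinfun_apply (f' P)" "\<lambda>P v. f'' P v (1, 0, 0)"
          "\<lambda>P v. f'' P v (0, 1, 0)" "\<lambda>P v. f'' P v (0, 0, 1)"]) (intro f D lim1 lim2; assumption)+
qed

section \<open>Quotients of two solutions and the inequality at a maximum point\<close>

text \<open>The second derivative of \<open>f / h\<close> is split into a drift term
  \<open>- 2 (h'/h) (f/h)'\<close> and the term \<open>(f'' h - f h'') / h\<^sup>2\<close>; the
  weighted sum of the latter over the three directions vanishes when \<open>f\<close> and
  \<open>h\<close> solve the same linear equation.\<close>

lemma ratio_derivs:
  fixes f h :: "real \<Rightarrow> real"
  assumes f: "\<And>t. (f has_real_derivative f1 t) (at t)" "(f1 has_real_derivative f2) (at a)"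
    and h: "\<And>t. (h has_real_derivative h1 t) (at t)" "(h1 has_real_derivative h2) (at a)"
    and h0: "\<And>t. h t \<noteq> 0"
  shows "((\<lambda>t. f t / h t) has_real_derivative (f1 t * h t - f t * h1 t) / (h t)\<^sup>2) (at t)"
    "((\<lambda>t. (f1 t * h t - f t * h1 t) / (h t)\<^sup>2) has_real_derivative
       (f2 * h a - f a * h2) / (h a)\<^sup>2 - 2 * (h1 a / h a) * ((f1 a * h a - f a * h1 a) / (h a)\<^sup>2)) (at a)"
  using h0
  by (auto intro!: derivative_eq_intros f h simp: power2_eq_square field_simps)

text \<open>Multiplying the second order condition by \<open>a * w\<close> lets the first order
  condition \<open>w Q' = - w' Q\<close> replace each derivative of \<open>Q\<close>, including the
  one produced by the drift \<open>- 2 v l\<close>. The terms \<open>r1\<close>, \<open>r2\<close>,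
  \<open>r3\<close> stay apart because they cancel only in the sum over the directions.\<close>

lemma max_point_algebra:
  fixes a w Q :: real
  assumes "w1 * Q + w * (2 * (k1 * l1 + k2 * l2 + k3 * l3)) = 0"
    and "w2 * Q + 2 * w1 * (2 * (k1 * l1 + k2 * l2 + k3 * l3)) +
       w * (2 * (l1\<^sup>2 + l2\<^sup>2 + l3\<^sup>2 + (k1 * m1 + k2 * m2 + k3 * m3))) \<le> 0"
    and m: "m1 = r1 - 2 * v * l1" "m2 = r2 - 2 * v * l2" "m3 = r3 - 2 * v * l3"
    and "w \<ge> 0" "a \<ge> 0"
  shows "2 * w\<^sup>2 * (a * (l1\<^sup>2 + l2\<^sup>2 + l3\<^sup>2)) + 2 * w * Q * (a * v * w1) - 2 * Q * (a * w1\<^sup>2) + w * Q * (a * w2)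
     + 2 * w\<^sup>2 * (k1 * (a * r1) + k2 * (a * r2) + k3 * (a * r3)) \<le> 0"
proof -
  define S where "S = 2 * (k1 * l1 + k2 * l2 + k3 * l3)"
  have S: "w * S = - w1 * Q" using assms(1) by (simp add: S_def)
  have "a * w * (w2 * Q + 2 * w1 * S +
       w * (2 * (l1\<^sup>2 + l2\<^sup>2 + l3\<^sup>2 + (k1 * m1 + k2 * m2 + k3 * m3)))) \<le> 0"
    using assms(2,6,7) unfolding S_def by (intro mult_nonneg_nonpos) auto
  also have "k1 * m1 + k2 * m2 + k3 * m3 = k1 * r1 + k2 * r2 + k3 * r3 - v * S"
    unfolding S_def m by algebra
  also have "a * w * (w2 * Q + 2 * w1 * S +
       w * (2 * (l1\<^sup>2 + l2\<^sup>2 + l3\<^sup>2 + (k1 * r1 + k2 * r2 + k3 * r3 - v * S)))) =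
     2 * w\<^sup>2 * (a * (l1\<^sup>2 + l2\<^sup>2 + l3\<^sup>2)) + w * Q * (a * w2) + 2 * a * w1 * (w * S) - 2 * a * w * v * (w * S)
     + 2 * w\<^sup>2 * (k1 * (a * r1) + k2 * (a * r2) + k3 * (a * r3))" by algebra
  finally show ?thesis unfolding S by (simp add: algebra_simps power2_eq_square)
qed

abbreviation ratio_deriv :: "('a \<Rightarrow> real) \<Rightarrow> ('a \<Rightarrow> real) \<Rightarrow> ('a \<Rightarrow> real) \<Rightarrow> ('a \<Rightarrow> real) \<Rightarrow> 'a \<Rightarrow> real" where
  "ratio_deriv f f' h h' P \<equiv> (f' P * h P - f P * h' P) / (h P)\<^sup>2"

text \<open>Sum over the three directions for the cutoff \<open>w = s\<^sup>2\<close>, with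
  \<open>w' = - 4 x s\<close> and \<open>w'' = 8 x\<^sup>2 - 4 s\<close>. Of the nine squared
  derivatives four are dropped; the five that remain are exactly those from which the equation for
  \<open>log h\<close> can be rebuilt.\<close>

lemma max_point_combine:
  fixes a b Q s x y z :: real
  assumes
    "2 * (s\<^sup>2)\<^sup>2 * (a * (l11\<^sup>2 + l12\<^sup>2 + l13\<^sup>2)) + 2 * s\<^sup>2 * Q * (a * v1 * (- 4 * x * s)) - 2 * Q * (a * (- 4 * x * s)\<^sup>2)
       + s\<^sup>2 * Q * (a * (8 * x\<^sup>2 - 4 * s)) + 2 * (s\<^sup>2)\<^sup>2 * (k1 * (a * r11) + k2 * (a * r12) + k3 * (a * r13)) \<le> 0"
    "2 * (s\<^sup>2)\<^sup>2 * (b * (l21\<^sup>2 + l22\<^sup>2 + l23\<^sup>2)) + 2 * s\<^sup>2 * Q * (b * v2 * (- 4 * y * s)) - 2 * Q * (b * (- 4 * y * s)\<^sup>2)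
       + s\<^sup>2 * Q * (b * (8 * y\<^sup>2 - 4 * s)) + 2 * (s\<^sup>2)\<^sup>2 * (k1 * (b * r21) + k2 * (b * r22) + k3 * (b * r23)) \<le> 0"
    "2 * (s\<^sup>2)\<^sup>2 * (1 * (l31\<^sup>2 + l32\<^sup>2 + l33\<^sup>2)) + 2 * s\<^sup>2 * Q * (1 * v3 * (- 4 * z * s)) - 2 * Q * (1 * (- 4 * z * s)\<^sup>2)
       + s\<^sup>2 * Q * (1 * (8 * z\<^sup>2 - 4 * s)) + 2 * (s\<^sup>2)\<^sup>2 * (k1 * (1 * r31) + k2 * (1 * r32) + k3 * (1 * r33)) \<le> 0"
    and zero: "a * r11 + b * r21 + r31 = 0" "a * r12 + b * r22 + r32 = 0" "a * r13 + b * r23 + r33 = 0"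
    and ab: "a \<ge> 0" "b \<ge> 0"
  shows "2 * s^4 * (a * l11\<^sup>2 + b * l22\<^sup>2 + l33\<^sup>2 + l31\<^sup>2 + l32\<^sup>2)
     \<le> 2 * s\<^sup>2 * Q * (4 * s * (a * v1 * x + b * v2 * y + v3 * z))
       + 2 * Q * (16 * s\<^sup>2 * (a * x\<^sup>2 + b * y\<^sup>2 + z\<^sup>2))
       + s\<^sup>2 * Q * (a * (4 * s - 8 * x\<^sup>2) + b * (4 * s - 8 * y\<^sup>2) + (4 * s - 8 * z\<^sup>2))"
proof -
  have "2 * s^4 * (k1 * (a * r11 + b * r21 + r31) + k2 * (a * r12 + b * r22 + r32) + k3 * (a * r13 + b * r23 + r33)) = 0"
    unfolding zero by simp
  moreover have "0 \<le> 2 * s^4 * (a * (l12\<^sup>2 + l13\<^sup>2) + b * (l21\<^sup>2 + l23\<^sup>2))" using ab by simp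
  ultimately show ?thesis
    using add_mono[OF add_mono[OF assms(1,2)] assms(3)]
    by (simp add: algebra_simps power2_eq_square power4_eq_xxxx)
qed

text \<open>If \<open>f\<close> and \<open>h\<close> solve the same linear equation, then \<open>f / h\<close> solves one without zeroth order
  term, with drift \<open>2 \<nabla> log h\<close>; the left-hand side of that equation maps the sum \<open>Q\<close> of three such
  squared ratios to twice the sum of their squared gradients. The inequality combines this with the
  first and second order conditions at a maximum of \<open>w Q\<close>, where \<open>w = s\<^sup>2\<close> is a cutoff function.\<close>

lemma bernstein_inequality_at_max:
  assumes h: "pde_partials p q k h hx hy hz hxx hyy hzz" and h0: "\<And>P. h P > 0"
    and f1: "pde_partials p q k f1 f1x f1y f1z f1xx f1yy f1zz"
    and f2: "pde_partials p q k f2 f2x f2y f2z f2xx f2yy f2zz"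
    and f3: "pde_partials p q k f3 f3x f3y f3z f3xx f3yy f3zz"
    and P: "x\<^sup>2 + y\<^sup>2 + z\<^sup>2 \<le> 1" "P = (x, y, z)"
  defines "w \<equiv> \<lambda>(x, y, z). (1 - (x\<^sup>2 + y\<^sup>2 + z\<^sup>2))\<^sup>2"
    and "Q \<equiv> \<lambda>P. (f1 P / h P)\<^sup>2 + (f2 P / h P)\<^sup>2 + (f3 P / h P)\<^sup>2"
  assumes max: "\<And>x' y' z'. x'\<^sup>2 + y'\<^sup>2 + z'\<^sup>2 \<le> 1 \<Longrightarrow> w (x', y', z') * Q (x', y', z') \<le> w P * Q P"
  defines "s \<equiv> 1 - (x\<^sup>2 + y\<^sup>2 + z\<^sup>2)"
    and "v1 \<equiv> hx P / h P" and "v2 \<equiv> hy P / h P" and "v3 \<equiv> hz P / h P"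
    and "a \<equiv> exp (2 * p * z)" and "b \<equiv> exp (- 2 * q * z)"
  shows "2 * s^4 * (a * (ratio_deriv f1 f1x h hx P)\<^sup>2 + b * (ratio_deriv f2 f2y h hy P)\<^sup>2 +
       (ratio_deriv f3 f3z h hz P)\<^sup>2 + (ratio_deriv f1 f1z h hz P)\<^sup>2 + (ratio_deriv f2 f2z h hz P)\<^sup>2)
     \<le> 2 * s\<^sup>2 * Q P * (4 * s * (a * v1 * x + b * v2 * y + v3 * z))
       + 2 * Q P * (16 * s\<^sup>2 * (a * x\<^sup>2 + b * y\<^sup>2 + z\<^sup>2))
       + s\<^sup>2 * Q P * (a * (4 * s - 8 * x\<^sup>2) + b * (4 * s - 8 * y\<^sup>2) + (4 * s - 8 * z\<^sup>2))"
proof (cases "s = 0")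
  case False
  hence s: "s > 0" using P by (simp add: s_def)
  \<comment> \<open>For \<open>s = 0\<close> both sides vanish. Otherwise the point is interior: a
    step shorter than \<open>d\<close> in one coordinate raises its square by at most
    \<open>3 * d < s\<close>, so the line stays in the ball on which maximality is known.\<close>
  define d where "d = s / 4"
  have "0 \<le> x\<^sup>2 + y\<^sup>2 + z\<^sup>2" by simp
  hence "s \<le> 1" unfolding s_def by linarith
  hence d: "0 < d" "d \<le> 1/4" using s unfolding d_def by simp_all
  have sq: "t\<^sup>2 \<le> c\<^sup>2 + 3 * d" if "\<bar>t - c\<bar> < d" "\<bar>c\<bar> \<le> 1" for t c :: real
  proof -
    have "t\<^sup>2 = c\<^sup>2 + (t - c) * (2 * c + (t - c))" by algebra
    also have "(t - c) * (2 * c + (t - c)) \<le> \<bar>(t - c)\<bar> * \<bar>2 * c + (t - c)\<bar>"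
      by (simp flip: abs_mult)
    also have "\<dots> \<le> d * 3" using that d by (intro mult_mono) auto
    finally show ?thesis by simp
  qed
  have ab: "\<bar>x\<bar> \<le> 1" "\<bar>y\<bar> \<le> 1" "\<bar>z\<bar> \<le> 1"
  proof -
    have "x\<^sup>2 \<ge> 0" "y\<^sup>2 \<ge> 0" "z\<^sup>2 \<ge> 0" by auto
    hence "x\<^sup>2 \<le> 1" "y\<^sup>2 \<le> 1" "z\<^sup>2 \<le> 1" using P(1) by linarith+
    thus "\<bar>x\<bar> \<le> 1" "\<bar>y\<bar> \<le> 1" "\<bar>z\<bar> \<le> 1" by (simp_all add: abs_square_le_1)
  qed
  have s4: "s = 4 * d" by (simp add: d_def)
  note hD = pde_partialsD[OF h] and f1D = pde_partialsD[OF f1] and f2D = pde_partialsD[OF f2]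
    and f3D = pde_partialsD[OF f3]
  have h0': "h P \<noteq> 0" for P using h0[of P] by simp
  have wP: "w (x, y, z) = s\<^sup>2" by (simp add: w_def s_def)
  note line = second_deriv_at_local_max_of_weighted_squares
  note r1 = ratio_derivs[OF f1D(1,2) hD(1,2) h0'] ratio_derivs[OF f2D(1,2) hD(1,2) h0']
    ratio_derivs[OF f3D(1,2) hD(1,2) h0']
  note r2 = ratio_derivs[OF f1D(3,4) hD(3,4) h0'] ratio_derivs[OF f2D(3,4) hD(3,4) h0']
    ratio_derivs[OF f3D(3,4) hD(3,4) h0']
  note r3 = ratio_derivs[OF f1D(5,6) hD(5,6) h0'] ratio_derivs[OF f2D(5,6) hD(5,6) h0']
    ratio_derivs[OF f3D(5,6) hD(5,6) h0']
  have wx: "((\<lambda>t. w (t, y, z)) has_real_derivative - 4 * t * (1 - (t\<^sup>2 + y\<^sup>2 + z\<^sup>2))) (at t)"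
    "((\<lambda>t. - 4 * t * (1 - (t\<^sup>2 + y\<^sup>2 + z\<^sup>2))) has_real_derivative 8 * x\<^sup>2 - 4 * s) (at x)" for t
    unfolding w_def s_def prod.case by (auto intro!: derivative_eq_intros simp: algebra_simps power2_eq_square)
  have wy: "((\<lambda>t. w (x, t, z)) has_real_derivative - 4 * t * (1 - (x\<^sup>2 + t\<^sup>2 + z\<^sup>2))) (at t)"
    "((\<lambda>t. - 4 * t * (1 - (x\<^sup>2 + t\<^sup>2 + z\<^sup>2))) has_real_derivative 8 * y\<^sup>2 - 4 * s) (at y)" for t
    unfolding w_def s_def prod.case by (auto intro!: derivative_eq_intros simp: algebra_simps power2_eq_square)
  have wz: "((\<lambda>t. w (x, y, t)) has_real_derivative - 4 * t * (1 - (x\<^sup>2 + y\<^sup>2 + t\<^sup>2))) (at t)"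
    "((\<lambda>t. - 4 * t * (1 - (x\<^sup>2 + y\<^sup>2 + t\<^sup>2))) has_real_derivative 8 * z\<^sup>2 - 4 * s) (at z)" for t
    unfolding w_def s_def prod.case by (auto intro!: derivative_eq_intros simp: algebra_simps power2_eq_square)
  have mx: "w (t, y, z) * ((f1 (t, y, z) / h (t, y, z))\<^sup>2 + (f2 (t, y, z) / h (t, y, z))\<^sup>2 + (f3 (t, y, z) / h (t, y, z))\<^sup>2)
     \<le> w (x, y, z) * ((f1 (x, y, z) / h (x, y, z))\<^sup>2 + (f2 (x, y, z) / h (x, y, z))\<^sup>2 + (f3 (x, y, z) / h (x, y, z))\<^sup>2)"
    if "\<bar>t - x\<bar> < d" for t
    using max[of t y z] sq[OF that] s4 d ab unfolding P(2) Q_def s_def by auto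
  have my: "w (x, t, z) * ((f1 (x, t, z) / h (x, t, z))\<^sup>2 + (f2 (x, t, z) / h (x, t, z))\<^sup>2 + (f3 (x, t, z) / h (x, t, z))\<^sup>2)
     \<le> w (x, y, z) * ((f1 (x, y, z) / h (x, y, z))\<^sup>2 + (f2 (x, y, z) / h (x, y, z))\<^sup>2 + (f3 (x, y, z) / h (x, y, z))\<^sup>2)"
    if "\<bar>t - y\<bar> < d" for t
    using max[of x t z] sq[OF that] s4 d ab unfolding P(2) Q_def s_def by auto
  have mz: "w (x, y, t) * ((f1 (x, y, t) / h (x, y, t))\<^sup>2 + (f2 (x, y, t) / h (x, y, t))\<^sup>2 + (f3 (x, y, t) / h (x, y, t))\<^sup>2)
     \<le> w (x, y, z) * ((f1 (x, y, z) / h (x, y, z))\<^sup>2 + (f2 (x, y, z) / h (x, y, z))\<^sup>2 + (f3 (x, y, z) / h (x, y, z))\<^sup>2)"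
    if "\<bar>t - z\<bar> < d" for t
    using max[of x y t] sq[OF that] s4 d ab unfolding P(2) Q_def s_def by auto
  note lx = line[OF wx r1(1,2) r1(3,4) r1(5,6) d(1) mx]
  note ly = line[OF wy r2(1,2) r2(3,4) r2(5,6) d(1) my]
  note lz = line[OF wz r3(1,2) r3(3,4) r3(5,6) d(1) mz]
  have w0: "w (x, y, z) \<ge> 0" "a \<ge> 0" "b \<ge> 0" "(1::real) \<ge> 0" by (simp_all add: w_def a_def b_def)
  note ax = max_point_algebra[OF lx refl refl refl w0(1,2)]
  note ay = max_point_algebra[OF ly refl refl refl w0(1,3)]
  note az = max_point_algebra[OF lz refl refl refl w0(1,4)]
  have zero: "a * ((fxx * h P - f * hxx P) / (h P)\<^sup>2) + b * ((fyy * h P - f * hyy P) / (h P)\<^sup>2) +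
      (fzz * h P - f * hzz P) / (h P)\<^sup>2 = 0"
    if "a * fxx + b * fyy + fzz = k * f" for f fxx fyy fzz
  proof -
    have "a * ((fxx * h P - f * hxx P) / (h P)\<^sup>2) + b * ((fyy * h P - f * hyy P) / (h P)\<^sup>2) +
      (fzz * h P - f * hzz P) / (h P)\<^sup>2 =
      ((a * fxx + b * fyy + fzz) * h P - f * (a * hxx P + b * hyy P + hzz P)) / (h P)\<^sup>2"
      by (simp add: add_divide_distrib diff_divide_distrib algebra_simps)
    also have "\<dots> = 0" using hD(7)[of z x y] that unfolding P(2) a_def b_def by simp
    finally show ?thesis .
  qed
  note Z = zero[unfolded P(2)]
  show ?thesis
    unfolding P(2) v1_def v2_def v3_def Q_def
    by (rule max_point_combine[OF ax[unfolded wP, folded s_def] ay[unfolded wP, folded s_def]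
        az[unfolded wP, folded s_def] Z Z Z w0(2,3)];
        use f1D(7)[of z x y] f2D(7)[of z x y] f3D(7)[of z x y] in \<open>simp add: a_def b_def\<close>)
qed (auto)

section \<open>From the inequality at the maximum to a bound for the logarithmic gradient\<close>

text \<open>Beyond the stated maximum, \<open>sqrt t\<close> exceeds \<open>A + B\<close> and is at
  least 1 (the reason for the summand 1), so
  \<open>A * sqrt t + B \<le> (A + B) * sqrt t < t\<close>, against the assumed inequality divided
  by \<open>t\<close>.\<close>

lemma sqrt_growth_bound:
  fixes t :: real
  assumes "t \<ge> 0" "A \<ge> 0" "B \<ge> 0" "k \<ge> 0" and le: "t \<ge> 2 * k \<Longrightarrow> t\<^sup>2 \<le> A * t * sqrt t + B * t"
  shows "t \<le> max (2 * k) ((A + B + 1)\<^sup>2)"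
proof (rule ccontr)
  assume "\<not> ?thesis"
  hence t: "t > 2 * k" "t > (A + B + 1)\<^sup>2" by auto
  have "sqrt t > A + B + 1" using t(2) assms by (simp add: real_less_rsqrt)
  hence st: "sqrt t > A + B" "sqrt t \<ge> 1" using assms(2,3) by linarith+
  have pos: "t > 0" using t assms by linarith
  have "t = sqrt t * sqrt t" using pos by simp
  have "A * sqrt t + B \<le> (A + B) * sqrt t" using st assms by (simp add: algebra_simps mult_le_cancel_left1)
  also have "\<dots> < sqrt t * sqrt t" using st by (intro mult_strict_right_mono) auto
  finally have "A * sqrt t + B < t" using pos by simp
  hence "t * (A * sqrt t + B) < t * t" using pos by simp
  thus False using le t by (simp add: algebra_simps power2_eq_square)
qed

text \<open>\<open>T\<close> is the squared gradient of \<open>log h\<close>, and the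
  \<open>E\<close>s are derivatives of the components of that gradient. The equation writes
  \<open>k - T\<close> as a linear combination of the \<open>E\<close>s, so Cauchy-Schwarz bounds
  \<open>(k - T)\<^sup>2\<close> by their weighted squares \<open>S\<close>. The inequality at the
  maximum bounds \<open>s^4 * S\<close> by order \<open>t * sqrt t\<close> with
  \<open>t = s\<^sup>2 * T\<close>, while \<open>t\<^sup>2\<close> is of the order of
  \<open>s^4 * (k - T)\<^sup>2\<close> once \<open>t \<ge> 2 * k\<close>. \<open>C0\<close> bounds
  the squared coefficients of the combination, and \<open>C1\<close> compares \<open>Q\<close> with
  \<open>T\<close>.\<close>

lemma bernstein_algebra:
  fixes a b x y z p q k M :: real
  assumes a: "a > 0" "a \<le> M" "1 \<le> M * a" and b: "b > 0" "b \<le> M" "1 \<le> M * b" and M: "M \<ge> 1"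
    and p: "p \<ge> 0" and q: "q \<ge> 0" and k: "k \<ge> 0"
    and s: "s = 1 - (x\<^sup>2 + y\<^sup>2 + z\<^sup>2)" "s \<ge> 0"
    and pde: "a * E11 + b * E22 + E33 - p * x * E13 + q * y * E23 + (a * v1\<^sup>2 + b * v2\<^sup>2 + v3\<^sup>2) = k"
    and Q: "Q = v1\<^sup>2 + v2\<^sup>2 + (v3 + p * x * v1 - q * y * v2)\<^sup>2"
    and le: "2 * s^4 * (a * E11\<^sup>2 + b * E22\<^sup>2 + E33\<^sup>2 + E13\<^sup>2 + E23\<^sup>2)
     \<le> 2 * s\<^sup>2 * Q * (4 * s * (a * v1 * x + b * v2 * y + v3 * z))
       + 2 * Q * (16 * s\<^sup>2 * (a * x\<^sup>2 + b * y\<^sup>2 + z\<^sup>2))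
       + s\<^sup>2 * Q * (a * (4 * s - 8 * x\<^sup>2) + b * (4 * s - 8 * y\<^sup>2) + (4 * s - 8 * z\<^sup>2))"
  defines "C0 \<equiv> 2 * M + 1 + p\<^sup>2 + q\<^sup>2" and "C1 \<equiv> 3 + M + 3 * M * (p\<^sup>2 + q\<^sup>2)"
  shows "s\<^sup>2 * Q \<le> C1 * max (2 * k) ((16 * C0 * C1 * M + (64 * M + 24 * M) * C0 * C1 + 1)\<^sup>2)"
proof -
  define T where "T = a * v1\<^sup>2 + b * v2\<^sup>2 + v3\<^sup>2"
  define S where "S = a * E11\<^sup>2 + b * E22\<^sup>2 + E33\<^sup>2 + E13\<^sup>2 + E23\<^sup>2"
  define t where "t = s\<^sup>2 * T"
  have x: "x\<^sup>2 \<le> 1" "y\<^sup>2 \<le> 1" "z\<^sup>2 \<le> 1" "x\<^sup>2 + y\<^sup>2 + z\<^sup>2 \<le> 1" "s \<le> 1"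
    using s zero_le_power2[of x] zero_le_power2[of y] zero_le_power2[of z] by linarith+
  have T0: "T \<ge> 0" "t \<ge> 0" using a b by (auto simp: T_def t_def)
  have S0: "S \<ge> 0" using a b by (auto simp: S_def)
  have C: "C0 \<ge> 0" "C1 \<ge> 0" using M by (auto simp: C0_def C1_def)
  have QT: "Q \<le> C1 * T"
  proof -
    have *: "(u + v + w)\<^sup>2 \<le> 3 * (u\<^sup>2 + v\<^sup>2 + w\<^sup>2)" for u v w :: real
    proof -
      have "3 * (u\<^sup>2 + v\<^sup>2 + w\<^sup>2) - (u + v + w)\<^sup>2 = (u - v)\<^sup>2 + (v - w)\<^sup>2 + (u - w)\<^sup>2" by algebra
      moreover have "\<dots> \<ge> 0" by simp
      ultimately show ?thesis by linarith
    qed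
    have v1: "v1\<^sup>2 \<le> M * (a * v1\<^sup>2)" using mult_right_mono[OF a(3) zero_le_power2[of v1]] by (simp add: mult.assoc)
    have v2: "v2\<^sup>2 \<le> M * (b * v2\<^sup>2)" using mult_right_mono[OF b(3) zero_le_power2[of v2]] by (simp add: mult.assoc)
    have "(p * x * v1)\<^sup>2 \<le> p\<^sup>2 * v1\<^sup>2"
      using mult_left_mono[OF x(1), of "p\<^sup>2 * v1\<^sup>2"] by (simp add: power_mult_distrib mult_ac)
    also have "\<dots> \<le> p\<^sup>2 * (M * (a * v1\<^sup>2))" using v1 by (intro mult_left_mono) auto
    finally have 1: "(p * x * v1)\<^sup>2 \<le> p\<^sup>2 * (M * (a * v1\<^sup>2))" .
    have "(q * y * v2)\<^sup>2 \<le> q\<^sup>2 * v2\<^sup>2"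
      using mult_left_mono[OF x(2), of "q\<^sup>2 * v2\<^sup>2"] by (simp add: power_mult_distrib mult_ac)
    also have "\<dots> \<le> q\<^sup>2 * (M * (b * v2\<^sup>2))" using v2 by (intro mult_left_mono) auto
    finally have 2: "(q * y * v2)\<^sup>2 \<le> q\<^sup>2 * (M * (b * v2\<^sup>2))" .
    have "Q \<le> M * (a * v1\<^sup>2) + M * (b * v2\<^sup>2) + 3 * (v3\<^sup>2 + p\<^sup>2 * (M * (a * v1\<^sup>2)) + q\<^sup>2 * (M * (b * v2\<^sup>2)))"
      using *[of v3 "p * x * v1" "- (q * y * v2)"] v1 v2 1 2 unfolding Q by simp
    also have "\<dots> = (M + 3 * M * p\<^sup>2) * (a * v1\<^sup>2) + (M + 3 * M * q\<^sup>2) * (b * v2\<^sup>2) + 3 * v3\<^sup>2" by algebra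
    also have "\<dots> \<le> C1 * (a * v1\<^sup>2) + C1 * (b * v2\<^sup>2) + C1 * v3\<^sup>2"
    proof -
      have "3 * M * p\<^sup>2 \<ge> 0" "3 * M * q\<^sup>2 \<ge> 0" using M by auto
      thus ?thesis
        using a b M unfolding C1_def by (intro add_mono mult_right_mono) (auto simp: distrib_left)
    qed
    finally show ?thesis by (simp add: T_def algebra_simps)
  qed
  have Q0: "Q \<ge> 0" by (simp add: Q)
  have cauchy: "(k - T)\<^sup>2 \<le> C0 * S"
  proof -
    have c5: "(c1*w1 + c2*w2 + c3*w3 + c4*w4 + c5*w5)\<^sup>2 \<le> (c1\<^sup>2 + c2\<^sup>2 + c3\<^sup>2 + c4\<^sup>2 + c5\<^sup>2) * (w1\<^sup>2 + w2\<^sup>2 + w3\<^sup>2 + w4\<^sup>2 + w5\<^sup>2)"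
      for c1 c2 c3 c4 c5 w1 w2 w3 w4 w5 :: real
    proof -
      have "(c1\<^sup>2 + c2\<^sup>2 + c3\<^sup>2 + c4\<^sup>2 + c5\<^sup>2) * (w1\<^sup>2 + w2\<^sup>2 + w3\<^sup>2 + w4\<^sup>2 + w5\<^sup>2) - (c1*w1 + c2*w2 + c3*w3 + c4*w4 + c5*w5)\<^sup>2
        = (c1*w2-c2*w1)\<^sup>2 + (c1*w3-c3*w1)\<^sup>2 + (c1*w4-c4*w1)\<^sup>2 + (c1*w5-c5*w1)\<^sup>2 + (c2*w3-c3*w2)\<^sup>2
         + (c2*w4-c4*w2)\<^sup>2 + (c2*w5-c5*w2)\<^sup>2 + (c3*w4-c4*w3)\<^sup>2 + (c3*w5-c5*w3)\<^sup>2 + (c4*w5-c5*w4)\<^sup>2"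
        by (simp add: power2_eq_square algebra_simps)
      moreover have "\<dots> \<ge> 0" by simp
      ultimately show ?thesis by linarith
    qed
    \<comment> \<open>One root of the weight goes to each Cauchy-Schwarz factor, so that the second
      factor is \<open>S\<close> with its weights.\<close>
    have sq: "sqrt a * (sqrt a * E11) = a * E11" "sqrt b * (sqrt b * E22) = b * E22"
      using a b by (simp_all flip: mult.assoc)
    have "k - T = sqrt a * (sqrt a * E11) + sqrt b * (sqrt b * E22) + 1 * E33 + (- (p * x)) * E13 + (q * y) * E23"
      unfolding sq using pde by (simp add: T_def)
    hence "(k - T)\<^sup>2 \<le> ((sqrt a)\<^sup>2 + (sqrt b)\<^sup>2 + 1\<^sup>2 + (- (p * x))\<^sup>2 + (q * y)\<^sup>2) *
       ((sqrt a * E11)\<^sup>2 + (sqrt b * E22)\<^sup>2 + E33\<^sup>2 + E13\<^sup>2 + E23\<^sup>2)"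
      using c5[of "sqrt a" "sqrt a * E11" "sqrt b" "sqrt b * E22" 1 E33 "- (p * x)" E13 "q * y" E23] by simp
    also have "\<dots> = (a + b + 1 + p\<^sup>2 * x\<^sup>2 + q\<^sup>2 * y\<^sup>2) * S"
      using a b by (simp add: S_def power_mult_distrib)
    also have "\<dots> \<le> C0 * S"
    proof (rule mult_right_mono[OF _ S0])
      have "p\<^sup>2 * x\<^sup>2 \<le> p\<^sup>2" "q\<^sup>2 * y\<^sup>2 \<le> q\<^sup>2" using x by (auto intro: mult_left_le)
      thus "a + b + 1 + p\<^sup>2 * x\<^sup>2 + q\<^sup>2 * y\<^sup>2 \<le> C0" using a b unfolding C0_def by linarith
    qed
    finally show ?thesis .
  qed
  have ax: "a * x\<^sup>2 + b * y\<^sup>2 + z\<^sup>2 \<le> M"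
  proof -
    have "a * x\<^sup>2 + b * y\<^sup>2 + z\<^sup>2 \<le> M * x\<^sup>2 + M * y\<^sup>2 + M * z\<^sup>2"
      using a b M by (intro add_mono mult_right_mono) (auto simp: mult_le_cancel_right1)
    also have "\<dots> = M * (x\<^sup>2 + y\<^sup>2 + z\<^sup>2)" by algebra
    also have "\<dots> \<le> M" using x M by (intro mult_left_le) auto
    finally show ?thesis .
  qed
  have grad: "s * (a * v1 * x + b * v2 * y + v3 * z) \<le> M * sqrt t"
  proof -
    have "(a * v1 * x + b * v2 * y + v3 * z)\<^sup>2 \<le> T * (a * x\<^sup>2 + b * y\<^sup>2 + z\<^sup>2)"
    proof -
      have "T * (a * x\<^sup>2 + b * y\<^sup>2 + z\<^sup>2) - (a * v1 * x + b * v2 * y + v3 * z)\<^sup>2 =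
         a * b * (v1 * y - v2 * x)\<^sup>2 + a * (v1 * z - v3 * x)\<^sup>2 + b * (v2 * z - v3 * y)\<^sup>2"
        unfolding T_def by algebra
      moreover have "\<dots> \<ge> 0" using a b by simp
      ultimately show ?thesis by linarith
    qed
    also have "\<dots> \<le> T * M\<^sup>2"
      using ax M T0 by (intro mult_left_mono order_trans[OF ax]) (auto simp: power2_eq_square mult_le_cancel_left1)
    finally have "(a * v1 * x + b * v2 * y + v3 * z)\<^sup>2 \<le> T * M\<^sup>2" .
    hence "(s * (a * v1 * x + b * v2 * y + v3 * z))\<^sup>2 \<le> s\<^sup>2 * (T * M\<^sup>2)"
      by (simp add: power_mult_distrib mult_left_mono)
    also have "\<dots> = (M * sqrt t)\<^sup>2" using T0 by (simp add: t_def power_mult_distrib)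
    finally show ?thesis by (rule power2_le_imp_le) (use M T0 in auto)
  qed
  have QL: "s\<^sup>2 * Q \<le> C1 * t" using mult_left_mono[OF QT, of "s\<^sup>2"] by (simp add: t_def mult_ac)
  have SB: "2 * (s^4 * S) \<le> C1 * (8 * M * (t * sqrt t)) + C1 * (32 * M * t) + C1 * (12 * M * t)"
  proof -
    have "2 * s\<^sup>2 * Q * (4 * s * (a * v1 * x + b * v2 * y + v3 * z)) \<le> C1 * (8 * M * (t * sqrt t))"
    proof -
      have "2 * s\<^sup>2 * Q * (4 * s * (a * v1 * x + b * v2 * y + v3 * z)) =
          (s\<^sup>2 * Q) * (8 * (s * (a * v1 * x + b * v2 * y + v3 * z)))" by algebra
      also have "\<dots> \<le> (s\<^sup>2 * Q) * (8 * (M * sqrt t))"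
        using grad Q0 by (intro mult_left_mono) auto
      also have "\<dots> \<le> (C1 * t) * (8 * (M * sqrt t))" using QL M T0 by (intro mult_right_mono) auto
      also have "\<dots> = C1 * (8 * M * (t * sqrt t))" by algebra
      finally show ?thesis .
    qed
    moreover have "2 * Q * (16 * s\<^sup>2 * (a * x\<^sup>2 + b * y\<^sup>2 + z\<^sup>2)) \<le> C1 * (32 * M * t)"
    proof -
      have "2 * Q * (16 * s\<^sup>2 * (a * x\<^sup>2 + b * y\<^sup>2 + z\<^sup>2)) =
          (s\<^sup>2 * Q) * (32 * (a * x\<^sup>2 + b * y\<^sup>2 + z\<^sup>2))" by algebra
      also have "\<dots> \<le> (s\<^sup>2 * Q) * (32 * M)"
        using ax Q0 by (intro mult_left_mono) auto
      also have "\<dots> \<le> (C1 * t) * (32 * M)" using QL M by (intro mult_right_mono) auto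
      also have "\<dots> = C1 * (32 * M * t)" by algebra
      finally show ?thesis .
    qed
    moreover have "s\<^sup>2 * Q * (a * (4 * s - 8 * x\<^sup>2) + b * (4 * s - 8 * y\<^sup>2) + (4 * s - 8 * z\<^sup>2)) \<le> C1 * (12 * M * t)"
    proof -
      have "a * (4 * s - 8 * x\<^sup>2) \<le> M * 4" "b * (4 * s - 8 * y\<^sup>2) \<le> M * 4"
      proof -
        have "a * (4 * s - 8 * x\<^sup>2) \<le> a * 4" "b * (4 * s - 8 * y\<^sup>2) \<le> b * 4"
          using a b x(5) zero_le_power2[of x] zero_le_power2[of y] by (intro mult_left_mono; linarith)+
        thus "a * (4 * s - 8 * x\<^sup>2) \<le> M * 4" "b * (4 * s - 8 * y\<^sup>2) \<le> M * 4" using a(2) b(2) by linarith+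
      qed
      moreover have "4 * s - 8 * z\<^sup>2 \<le> M * 4" using x M zero_le_power2[of z] by linarith
      ultimately have "s\<^sup>2 * Q * (a * (4 * s - 8 * x\<^sup>2) + b * (4 * s - 8 * y\<^sup>2) + (4 * s - 8 * z\<^sup>2)) \<le> s\<^sup>2 * Q * (12 * M)"
        using Q0 by (intro mult_left_mono) auto
      also have "\<dots> \<le> (C1 * t) * (12 * M)" using QL M by (intro mult_right_mono) auto
      finally show ?thesis by (simp add: mult_ac)
    qed
    ultimately show ?thesis using le unfolding S_def[symmetric] by simp
  qed
  \<comment> \<open>The constants come from \<open>t\<^sup>2 / 4 \<le> C0 / 2 * (...)\<close>: four
    times \<open>C0 / 2\<close> times \<open>8 M C1\<close> is \<open>16 C0 C1 M\<close>, and times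
    \<open>(32 + 12) M C1\<close> it is \<open>(64 + 24) M C0 C1\<close>.\<close>
  have "t \<le> max (2 * k) ((16 * C0 * C1 * M + (64 * M + 24 * M) * C0 * C1 + 1)\<^sup>2)"
  proof (rule sqrt_growth_bound)
    assume tk: "t \<ge> 2 * k"
    have "s\<^sup>2 * k \<le> k" using x s k by (intro mult_left_le_one_le) (auto simp: power_le_one)
    hence "t / 2 \<le> t - s\<^sup>2 * k" using tk by simp
    hence "(t / 2)\<^sup>2 \<le> (t - s\<^sup>2 * k)\<^sup>2" using T0 by (intro power_mono) auto
    also have "\<dots> = s^4 * (k - T)\<^sup>2" by (simp add: t_def) algebra
    also have "\<dots> \<le> s^4 * (C0 * S)" using cauchy by (intro mult_left_mono) auto
    also have "\<dots> = C0 / 2 * (2 * (s^4 * S))" by simp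
    also have "\<dots> \<le> C0 / 2 * (C1 * (8 * M * (t * sqrt t)) + C1 * (32 * M * t) + C1 * (12 * M * t))"
      using SB C by (intro mult_left_mono) auto
    finally show "t\<^sup>2 \<le> 16 * C0 * C1 * M * t * sqrt t + (64 * M + 24 * M) * C0 * C1 * t"
      by (simp add: power_divide algebra_simps)
  qed (use T0 C M k in auto)
  hence "C1 * t \<le> C1 * max (2 * k) ((16 * C0 * C1 * M + (64 * M + 24 * M) * C0 * C1 + 1)\<^sup>2)"
    using C by (intro mult_left_mono)
  thus ?thesis using QL by linarith
qed

section \<open>Difference quotients along the flows of the group and their limits\<close>

lemma DERIV_along_axes:
  fixes f :: "real \<times> real \<times> real \<Rightarrow> real"
  assumes "(f has_derivative F) (at (x, y, z))"
  shows "((\<lambda>t. f (t, y, z)) has_real_derivative F (1, 0, 0)) (at x)"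
    "((\<lambda>t. f (x, t, z)) has_real_derivative F (0, 1, 0)) (at y)"
    "((\<lambda>t. f (x, y, t)) has_real_derivative F (0, 0, 1)) (at z)"
proof -
  have s: "F (t, 0, 0) = F (1, 0, 0) * t" "F (0, t, 0) = F (0, 1, 0) * t" "F (0, 0, t) = F (0, 0, 1) * t" for t
    using linear_scale[OF has_derivative_linear[OF assms], of t "(1, 0, 0)"]
      linear_scale[OF has_derivative_linear[OF assms], of t "(0, 1, 0)"]
      linear_scale[OF has_derivative_linear[OF assms], of t "(0, 0, 1)"] by (simp_all add: mult.commute)
  have "((\<lambda>t. f (t, y, z)) has_derivative (\<lambda>t. F (t, 0, 0))) (at x)"
    by (rule has_derivative_compose[of "\<lambda>t. (t, y, z)" "\<lambda>t. (t, 0, 0)", OF _ assms])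
       (intro has_derivative_Pair has_derivative_ident has_derivative_const)
  moreover have "(\<lambda>t. F (t, 0, 0)) = (*) (F (1, 0, 0))" by (intro ext s)
  ultimately show "((\<lambda>t. f (t, y, z)) has_real_derivative F (1, 0, 0)) (at x)"
    by (simp add: has_field_derivative_def)
  have "((\<lambda>t. f (x, t, z)) has_derivative (\<lambda>t. F (0, t, 0))) (at y)"
    by (rule has_derivative_compose[of "\<lambda>t. (x, t, z)" "\<lambda>t. (0, t, 0)", OF _ assms])
       (intro has_derivative_Pair has_derivative_ident has_derivative_const)
  moreover have "(\<lambda>t. F (0, t, 0)) = (*) (F (0, 1, 0))" by (intro ext s)
  ultimately show "((\<lambda>t. f (x, t, z)) has_real_derivative F (0, 1, 0)) (at y)"
    by (simp add: has_field_derivative_def)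
  have "((\<lambda>t. f (x, y, t)) has_derivative (\<lambda>t. F (0, 0, t))) (at z)"
    by (rule has_derivative_compose[of "\<lambda>t. (x, y, t)" "\<lambda>t. (0, 0, t)", OF _ assms])
       (intro has_derivative_Pair has_derivative_ident has_derivative_const)
  moreover have "(\<lambda>t. F (0, 0, t)) = (*) (F (0, 0, 1))" by (intro ext s)
  ultimately show "((\<lambda>t. f (x, y, t)) has_real_derivative F (0, 0, 1)) (at z)"
    by (simp add: has_field_derivative_def)
qed

lemma exp_difference_quotient_tendsto:
  fixes e :: "nat \<Rightarrow> real"
  assumes "e \<longlonglongrightarrow> 0" and "\<And>n. e n \<noteq> 0"
  shows "(\<lambda>n. (exp (c * e n) - 1) / e n) \<longlonglongrightarrow> c"
proof -
  have "((\<lambda>t. exp (c * t)) has_real_derivative c) (at 0)"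
    by (auto intro!: derivative_eq_intros)
  hence "((\<lambda>h. (exp (c * h) - 1) / h) \<longlongrightarrow> c) (at 0)"
    by (simp add: DERIV_def)
  moreover have "filterlim e (at 0) sequentially"
    using assms by (simp add: filterlim_at)
  ultimately show ?thesis by (rule filterlim_compose)
qed

text \<open>The limit velocity is the right-invariant vector field with value
  \<open>(\<alpha>, \<beta>, \<gamma>)\<close> at the origin, that is, a generator of left
  translations. The base point may vary with \<open>n\<close>, as
  \<open>strict_difference_quotient\<close> requires.\<close>

lemma left_translate_tendsto:
  fixes e :: "nat \<Rightarrow> real"
  assumes e: "e \<longlonglongrightarrow> 0" "\<And>n. e n \<noteq> 0" and X: "X \<longlonglongrightarrow> (x, y, z)"
  shows "(\<lambda>n. left_translate p q (e n *\<^sub>R (\<alpha>, \<beta>, \<gamma>)) (X n)) \<longlonglongrightarrow> (x, y, z)"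
    "(\<lambda>n. (left_translate p q (e n *\<^sub>R (\<alpha>, \<beta>, \<gamma>)) (X n) - X n) /\<^sub>R e n) \<longlonglongrightarrow>
       (p * \<gamma> * x + \<alpha>, - q * \<gamma> * y + \<beta>, \<gamma>)"
proof -
  have c: "(\<lambda>n. fst (X n)) \<longlonglongrightarrow> x" "(\<lambda>n. fst (snd (X n))) \<longlonglongrightarrow> y" "(\<lambda>n. snd (snd (X n))) \<longlonglongrightarrow> z"
    using tendsto_fst[OF X] tendsto_fst[OF tendsto_snd[OF X]] tendsto_snd[OF tendsto_snd[OF X]] by simp_all
  have "(\<lambda>n. (exp (p * (e n * \<gamma>)) * fst (X n) + e n * \<alpha>, exp (- q * (e n * \<gamma>)) * fst (snd (X n)) + e n * \<beta>,
      snd (snd (X n)) + e n * \<gamma>)) \<longlonglongrightarrow> (exp (p * (0 * \<gamma>)) * x + 0 * \<alpha>, exp (- q * (0 * \<gamma>)) * y + 0 * \<beta>, z + 0 * \<gamma>)"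
    by (intro tendsto_intros c e)
  thus "(\<lambda>n. left_translate p q (e n *\<^sub>R (\<alpha>, \<beta>, \<gamma>)) (X n)) \<longlonglongrightarrow> (x, y, z)"
    by (simp add: left_translate_def case_prod_beta)
  have "(\<lambda>n. ((exp ((p * \<gamma>) * e n) - 1) / e n * fst (X n) + \<alpha>,
      (exp ((- q * \<gamma>) * e n) - 1) / e n * fst (snd (X n)) + \<beta>, \<gamma>)) \<longlonglongrightarrow> (p * \<gamma> * x + \<alpha>, - q * \<gamma> * y + \<beta>, \<gamma>)"
    by (intro tendsto_intros c exp_difference_quotient_tendsto e)
  moreover have "((exp ((p * \<gamma>) * e n) - 1) / e n * fst (X n) + \<alpha>,
      (exp ((- q * \<gamma>) * e n) - 1) / e n * fst (snd (X n)) + \<beta>, \<gamma>) =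
      (left_translate p q (e n *\<^sub>R (\<alpha>, \<beta>, \<gamma>)) (X n) - X n) /\<^sub>R e n" for n
    using e(2)[of n] by (cases "X n") (simp add: left_translate_def field_simps)
  ultimately show "(\<lambda>n. (left_translate p q (e n *\<^sub>R (\<alpha>, \<beta>, \<gamma>)) (X n) - X n) /\<^sub>R e n) \<longlonglongrightarrow>
       (p * \<gamma> * x + \<alpha>, - q * \<gamma> * y + \<beta>, \<gamma>)" by simp
qed

text \<open>Bernstein's method for \<open>log h\<close>, differentiated along the generators \<open>\<partial>\<^sub>x\<close>, \<open>\<partial>\<^sub>y\<close>,
  \<open>\<partial>\<^sub>z + p x \<partial>\<^sub>x - q y \<partial>\<^sub>y\<close> of the left translations, which commute with the operator and span all
  directions. Since \<open>h\<close> is only \<open>C\<^sup>2\<close>, difference quotients along their flows replace the derivatives and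
  the limit is taken at a convergent sequence of maximum points.\<close>

lemma gradient_bound_at_origin:
  assumes p: "p > 0" and q: "q > 0" and k: "k \<ge> 0"
  obtains K where "K \<ge> 0"
    "\<And>h hx hy hz hxx hyy hzz. C2 h \<Longrightarrow> pde_partials p q k h hx hy hz hxx hyy hzz \<Longrightarrow> (\<And>P. h P > 0) \<Longrightarrow>
       \<bar>hx (0, 0, 0)\<bar> \<le> K * h (0, 0, 0) \<and> \<bar>hy (0, 0, 0)\<bar> \<le> K * h (0, 0, 0) \<and> \<bar>hz (0, 0, 0)\<bar> \<le> K * h (0, 0, 0)"
proof -
  define M where "M = exp (2 * (p + q))"
  define C0 where "C0 = 2 * M + 1 + p\<^sup>2 + q\<^sup>2"
  define C1 where "C1 = 3 + M + 3 * M * (p\<^sup>2 + q\<^sup>2)"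
  \<comment> \<open>\<open>M\<close> bounds the coefficients and their reciprocals on the unit ball.
    All constants depend on \<open>p\<close>, \<open>q\<close>, \<open>k\<close> only, hence are the
    same for every solution.\<close>
  define K0 where "K0 = C1 * max (2 * k) ((16 * C0 * C1 * M + (64 * M + 24 * M) * C0 * C1 + 1)\<^sup>2)"
  have M: "M \<ge> 1" using p q by (simp add: M_def)
  show thesis
  proof (rule that[of "sqrt K0"])
    show "sqrt K0 \<ge> 0" using M k by (simp add: K0_def C1_def le_max_iff_disj)
    fix h :: "real \<times> real \<times> real \<Rightarrow> real" and hx hy hz hxx hyy hzz
    assume C2: "C2 h" and pde: "pde_partials p q k h hx hy hz hxx hyy hzz" and pos: "\<And>P. h P > 0"
    obtain h' Hx Hy Hz where D: "\<And>P. (h has_derivative h' P) (at P)"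
      "\<And>P. ((\<lambda>P. h' P (1, 0, 0)) has_derivative Hx P) (at P)"
      "\<And>P. ((\<lambda>P. h' P (0, 1, 0)) has_derivative Hy P) (at P)"
      "\<And>P. ((\<lambda>P. h' P (0, 0, 1)) has_derivative Hz P) (at P)"
      and cont: "\<And>X V P v. X \<longlonglongrightarrow> P \<Longrightarrow> V \<longlonglongrightarrow> v \<Longrightarrow> (\<lambda>n. h' (X n) (V n)) \<longlonglongrightarrow> h' P v"
      "\<And>X V P v. X \<longlonglongrightarrow> P \<Longrightarrow> V \<longlonglongrightarrow> v \<Longrightarrow> (\<lambda>n. Hx (X n) (V n)) \<longlonglongrightarrow> Hx P v"
      "\<And>X V P v. X \<longlonglongrightarrow> P \<Longrightarrow> V \<longlonglongrightarrow> v \<Longrightarrow> (\<lambda>n. Hy (X n) (V n)) \<longlonglongrightarrow> Hy P v"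
      "\<And>X V P v. X \<longlonglongrightarrow> P \<Longrightarrow> V \<longlonglongrightarrow> v \<Longrightarrow> (\<lambda>n. Hz (X n) (V n)) \<longlonglongrightarrow> Hz P v"
      by (rule C2_partials[OF C2], rule that)
    note pD = pde_partialsD[OF pde]
    have d1: "((\<lambda>t. h (t, y, z)) has_real_derivative h' (x, y, z) (1, 0, 0)) (at x)"
      "((\<lambda>t. h (x, t, z)) has_real_derivative h' (x, y, z) (0, 1, 0)) (at y)"
      "((\<lambda>t. h (x, y, t)) has_real_derivative h' (x, y, z) (0, 0, 1)) (at z)" for x y z
      by (rule DERIV_along_axes, rule D)+
    have "hx (x, y, z) = h' (x, y, z) (1, 0, 0)" "hy (x, y, z) = h' (x, y, z) (0, 1, 0)"
      "hz (x, y, z) = h' (x, y, z) (0, 0, 1)" for x y z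
      by (rule DERIV_unique, rule pD, rule d1)+
    hence eq1: "hx = (\<lambda>P. h' P (1, 0, 0))" "hy = (\<lambda>P. h' P (0, 1, 0))" "hz = (\<lambda>P. h' P (0, 0, 1))"
      by (simp_all add: fun_eq_iff split_paired_all)
    note D' = D(2-4)[folded eq1]
    have d2: "((\<lambda>t. hx (t, y, z)) has_real_derivative Hx (x, y, z) (1, 0, 0)) (at x)"
      "((\<lambda>t. hy (x, t, z)) has_real_derivative Hy (x, y, z) (0, 1, 0)) (at y)"
      "((\<lambda>t. hz (x, y, t)) has_real_derivative Hz (x, y, z) (0, 0, 1)) (at z)" for x y z
      by (rule DERIV_along_axes, rule D')+
    have eq2: "hxx (x, y, z) = Hx (x, y, z) (1, 0, 0)" "hyy (x, y, z) = Hy (x, y, z) (0, 1, 0)"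
      "hzz (x, y, z) = Hz (x, y, z) (0, 0, 1)" for x y z
      by (rule DERIV_unique, rule pD, rule d2)+
    define e where "e = (\<lambda>n. 1 / real (Suc n))"
    have e: "e \<longlonglongrightarrow> 0" "\<And>n. e n \<noteq> 0"
      unfolding e_def using LIMSEQ_inverse_real_of_nat by (auto simp: inverse_eq_divide)
    define A where "A = (\<lambda>v n P. left_translate p q (e n *\<^sub>R v) P)"
    \<comment> \<open>Written as a linear combination, so that \<open>pde_partials_lincomb\<close>
      shows each quotient to be a solution; the exponential factors in \<open>fx\<close> and
      \<open>fy\<close> are those of the chain rule for \<open>left_translate\<close>.\<close>
    define f where "f = (\<lambda>v n P. 1 / e n * h (A v n P) + - 1 / e n * h P)"
    define fx where "fx = (\<lambda>v n P. 1 / e n * (exp (p * snd (snd (e n *\<^sub>R v))) * hx (A v n P)) + - 1 / e n * hx P)"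
    define fy where "fy = (\<lambda>v n P. 1 / e n * (exp (- q * snd (snd (e n *\<^sub>R v))) * hy (A v n P)) + - 1 / e n * hy P)"
    define fz where "fz = (\<lambda>v n P. 1 / e n * hz (A v n P) + - 1 / e n * hz P)"
    have fpde: "\<exists>fxx fyy fzz. pde_partials p q k (f v n) (fx v n) (fy v n) (fz v n) fxx fyy fzz" for v n
    proof -
      obtain a b c where v: "e n *\<^sub>R v = (a, b, c)" by (metis surj_pair)
      show ?thesis
        unfolding f_def fx_def fy_def fz_def A_def v snd_conv
        by (intro exI) (rule pde_partials_lincomb[OF pde_partials_left_translate[OF pde] pde])
    qed
    define w :: "real \<times> real \<times> real \<Rightarrow> real" where "w = (\<lambda>(x, y, z). (1 - (x\<^sup>2 + y\<^sup>2 + z\<^sup>2))\<^sup>2)"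
    define e1 e2 e3 :: "real \<times> real \<times> real" where "e1 = (1, 0, 0)" and "e2 = (0, 1, 0)" and "e3 = (0, 0, 1)"
    define Q where "Q = (\<lambda>n P. (f e1 n P / h P)\<^sup>2 + (f e2 n P / h P)\<^sup>2 + (f e3 n P / h P)\<^sup>2)"
    define B :: "(real \<times> real \<times> real) set" where "B = cball 0 1"
    have B: "(x, y, z) \<in> B \<longleftrightarrow> x\<^sup>2 + y\<^sup>2 + z\<^sup>2 \<le> 1" for x y z
      by (simp add: B_def norm_Pair add.assoc)
    have hcont: "continuous_on S h" for S
      using has_derivative_continuous_on[of S h h'] D(1) by (meson has_derivative_at_withinI)
    have Acont: "continuous_on S (A v n)" for S v n
      unfolding A_def by (rule continuous_on_subset[OF continuous_left_translate]) simp
    have "continuous_on B (\<lambda>P. w P * Q n P)" for n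
      unfolding w_def Q_def f_def case_prod_beta
      by (intro continuous_intros hcont Acont continuous_on_compose2[OF hcont Acont]) (use pos in \<open>auto simp: less_imp_neq[THEN not_sym]\<close>)
    moreover have "compact B" "B \<noteq> {}" by (auto simp: B_def)
    ultimately have "\<exists>P\<in>B. \<forall>P'\<in>B. w P' * Q n P' \<le> w P * Q n P" for n
      by (intro continuous_attains_sup) auto
    \<comment> \<open>Every \<open>n\<close> has its own maximum point. The inequality is used at
      these points and then passed to the limit \<open>P\<close> of a subsequence, where true
      derivatives of \<open>h\<close> appear.\<close>
    then obtain Y where Y: "\<And>n. Y n \<in> B" "\<And>n P. P \<in> B \<Longrightarrow> w P * Q n P \<le> w (Y n) * Q n (Y n)"
      by metis
    obtain P r where P: "P \<in> B" and r: "strict_mono r" and lim: "(Y \<circ> r) \<longlonglongrightarrow> P"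
      using \<open>compact B\<close> Y(1) unfolding compact_def by metis
    obtain x y z where Pxyz: "P = (x, y, z)" by (cases P)
    define X where "X = (\<lambda>n. Y (r n))"
    have X: "X \<longlonglongrightarrow> (x, y, z)" using lim by (simp add: X_def Pxyz comp_def)
    have er: "(\<lambda>n. e (r n)) \<longlonglongrightarrow> 0" using LIMSEQ_subseq_LIMSEQ[OF e(1) r] by (simp add: comp_def)
    have quot: "(\<lambda>n. 1 / e (r n) * \<phi> (A (\<alpha>, \<beta>, \<gamma>) (r n) (Z n)) + - 1 / e (r n) * \<phi> (Z n)) \<longlonglongrightarrow>
        \<Phi> (x, y, z) (p * \<gamma> * x + \<alpha>, - q * \<gamma> * y + \<beta>, \<gamma>)"
      if "Z \<longlonglongrightarrow> (x, y, z)" "\<And>P. (\<phi> has_derivative \<Phi> P) (at P)"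
        "\<And>X V P v. X \<longlonglongrightarrow> P \<Longrightarrow> V \<longlonglongrightarrow> v \<Longrightarrow> (\<lambda>n. \<Phi> (X n) (V n)) \<longlonglongrightarrow> \<Phi> P v"
      for Z \<phi> \<Phi> x y z \<alpha> \<beta> \<gamma>
    proof -
      have eq: "1 / c * u + - 1 / c * v = (u - v) / c" for c u v :: real
        by (simp add: diff_divide_distrib)
      show ?thesis
        unfolding eq A_def
      proof (rule strict_difference_quotient[where f = \<phi> and F = \<Phi> and B = Z and e = "\<lambda>n. e (r n)"
            and A = "\<lambda>n. left_translate p q (e (r n) *\<^sub>R (\<alpha>, \<beta>, \<gamma>)) (Z n)"])
        show "(\<lambda>n. left_translate p q (e (r n) *\<^sub>R (\<alpha>, \<beta>, \<gamma>)) (Z n)) \<longlonglongrightarrow> (x, y, z)"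
          by (rule left_translate_tendsto(1)[where e = "\<lambda>n. e (r n)", OF er e(2) that(1)])
        show "(\<lambda>n. (left_translate p q (e (r n) *\<^sub>R (\<alpha>, \<beta>, \<gamma>)) (Z n) - Z n) /\<^sub>R e (r n)) \<longlonglongrightarrow>
            (p * \<gamma> * x + \<alpha>, - q * \<gamma> * y + \<beta>, \<gamma>)"
          by (rule left_translate_tendsto(2)[where e = "\<lambda>n. e (r n)", OF er e(2) that(1)])
      qed (rule that; assumption?)+
    qed
    have limf: "(\<lambda>n. f (\<alpha>, \<beta>, \<gamma>) (r n) (Z n)) \<longlonglongrightarrow> h' (x, y, z) (p * \<gamma> * x + \<alpha>, - q * \<gamma> * y + \<beta>, \<gamma>)"
      if "Z \<longlonglongrightarrow> (x, y, z)" for Z x y z \<alpha> \<beta> \<gamma>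
      unfolding f_def by (rule quot[OF that D(1) cont(1)])
    have hlim: "(\<lambda>n. h (Z n)) \<longlonglongrightarrow> h P" if "Z \<longlonglongrightarrow> P" for Z P
      using isCont_tendsto_compose[OF has_derivative_continuous[OF D(1)] that] .
    have hlim': "(\<lambda>n. hx (Z n)) \<longlonglongrightarrow> hx P" "(\<lambda>n. hy (Z n)) \<longlonglongrightarrow> hy P" "(\<lambda>n. hz (Z n)) \<longlonglongrightarrow> hz P"
      if "Z \<longlonglongrightarrow> P" for Z P
      using isCont_tendsto_compose[OF has_derivative_continuous[OF D'(1)] that]
        isCont_tendsto_compose[OF has_derivative_continuous[OF D'(2)] that]
        isCont_tendsto_compose[OF has_derivative_continuous[OF D'(3)] that] .
    define v3 where "v3 = (p * x, - q * y, 1 :: real)"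
    have l1: "(\<lambda>n. f e1 (r n) (X n)) \<longlonglongrightarrow> h' P e1" "(\<lambda>n. f e2 (r n) (X n)) \<longlonglongrightarrow> h' P e2"
      "(\<lambda>n. f e3 (r n) (X n)) \<longlonglongrightarrow> h' P v3"
      using limf[OF X, of 1 0 0] limf[OF X, of 0 1 0] limf[OF X, of 0 0 1]
      by (simp_all add: e1_def e2_def e3_def v3_def Pxyz)
    have l2: "(\<lambda>n. fx e1 (r n) (X n)) \<longlonglongrightarrow> Hx P e1" "(\<lambda>n. fy e2 (r n) (X n)) \<longlonglongrightarrow> Hy P e2"
      "(\<lambda>n. fz e1 (r n) (X n)) \<longlonglongrightarrow> Hz P e1" "(\<lambda>n. fz e2 (r n) (X n)) \<longlonglongrightarrow> Hz P e2"
      "(\<lambda>n. fz e3 (r n) (X n)) \<longlonglongrightarrow> Hz P v3"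
    proof -
      have qx: "(\<lambda>n. 1 / e (r n) * hx (A (\<alpha>, \<beta>, \<gamma>) (r n) (X n)) + - 1 / e (r n) * hx (X n)) \<longlonglongrightarrow>
          Hx P (p * \<gamma> * x + \<alpha>, - q * \<gamma> * y + \<beta>, \<gamma>)" for \<alpha> \<beta> \<gamma>
        unfolding Pxyz by (rule quot[OF X D'(1) cont(2)])
      have qy: "(\<lambda>n. 1 / e (r n) * hy (A (\<alpha>, \<beta>, \<gamma>) (r n) (X n)) + - 1 / e (r n) * hy (X n)) \<longlonglongrightarrow>
          Hy P (p * \<gamma> * x + \<alpha>, - q * \<gamma> * y + \<beta>, \<gamma>)" for \<alpha> \<beta> \<gamma>
        unfolding Pxyz by (rule quot[OF X D'(2) cont(3)])
      have qz: "(\<lambda>n. 1 / e (r n) * hz (A (\<alpha>, \<beta>, \<gamma>) (r n) (X n)) + - 1 / e (r n) * hz (X n)) \<longlonglongrightarrow>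
          Hz P (p * \<gamma> * x + \<alpha>, - q * \<gamma> * y + \<beta>, \<gamma>)" for \<alpha> \<beta> \<gamma>
        unfolding Pxyz by (rule quot[OF X D'(3) cont(4)])
      have one: "exp (p * snd (snd (c *\<^sub>R e1))) = 1" "exp (- q * snd (snd (c *\<^sub>R e2))) = 1" for c
        by (simp_all add: e1_def e2_def)
      have v: "(p * 0 * x + 1, - q * 0 * y + 0, 0) = e1" "(p * 0 * x + 0, - q * 0 * y + 1, 0) = e2"
        "(p * 1 * x + 0, - q * 1 * y + 0, 1) = v3"
        by (simp_all add: e1_def e2_def v3_def)
      show "(\<lambda>n. fx e1 (r n) (X n)) \<longlonglongrightarrow> Hx P e1" "(\<lambda>n. fy e2 (r n) (X n)) \<longlonglongrightarrow> Hy P e2"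
        "(\<lambda>n. fz e1 (r n) (X n)) \<longlonglongrightarrow> Hz P e1" "(\<lambda>n. fz e2 (r n) (X n)) \<longlonglongrightarrow> Hz P e2"
        "(\<lambda>n. fz e3 (r n) (X n)) \<longlonglongrightarrow> Hz P v3"
        unfolding fx_def fy_def fz_def one mult_1_left
        using qx[of 1 0 0, unfolded v] qy[of 0 1 0, unfolded v] qz[of 1 0 0, unfolded v]
          qz[of 0 1 0, unfolded v] qz[of 0 0 1, unfolded v] unfolding e1_def e2_def e3_def by blast+
    qed
    have lx: "(\<lambda>n. fst (X n)) \<longlonglongrightarrow> x" "(\<lambda>n. fst (snd (X n))) \<longlonglongrightarrow> y" "(\<lambda>n. snd (snd (X n))) \<longlonglongrightarrow> z"
      using tendsto_fst[OF X] tendsto_fst[OF tendsto_snd[OF X]] tendsto_snd[OF tendsto_snd[OF X]] by simp_all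
    have hP: "h P \<noteq> 0" for P using pos[of P] by simp
    define E11 where "E11 = (Hx P e1 * h P - h' P e1 * hx P) / (h P)\<^sup>2"
    define E22 where "E22 = (Hy P e2 * h P - h' P e2 * hy P) / (h P)\<^sup>2"
    define E33 where "E33 = (Hz P v3 * h P - h' P v3 * hz P) / (h P)\<^sup>2"
    define E13 where "E13 = (Hz P e1 * h P - h' P e1 * hz P) / (h P)\<^sup>2"
    define E23 where "E23 = (Hz P e2 * h P - h' P e2 * hz P) / (h P)\<^sup>2"
    define QP where "QP = (h' P e1 / h P)\<^sup>2 + (h' P e2 / h P)\<^sup>2 + (h' P v3 / h P)\<^sup>2"
    define s where "s = 1 - (x\<^sup>2 + y\<^sup>2 + z\<^sup>2)"
    define a where "a = exp (2 * p * z)"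
    define b where "b = exp (- 2 * q * z)"
    define u1 u2 u3 where "u1 = hx P / h P" and "u2 = hy P / h P" and "u3 = hz P / h P"
    have QX: "(\<lambda>n. Q (r n) (X n)) \<longlonglongrightarrow> QP"
      unfolding Q_def QP_def using X unfolding Pxyz[symmetric] by (intro tendsto_intros l1 hlim hP)
    let ?s = "\<lambda>n. 1 - ((fst (X n))\<^sup>2 + (fst (snd (X n)))\<^sup>2 + (snd (snd (X n)))\<^sup>2)"
    let ?a = "\<lambda>n. exp (2 * p * snd (snd (X n)))" and ?b = "\<lambda>n. exp (- 2 * q * snd (snd (X n)))"
    define L where "L = (\<lambda>n. 2 * ?s n^4 * (?a n * (ratio_deriv (f e1 (r n)) (fx e1 (r n)) h hx (X n))\<^sup>2
          + ?b n * (ratio_deriv (f e2 (r n)) (fy e2 (r n)) h hy (X n))\<^sup>2 + (ratio_deriv (f e3 (r n)) (fz e3 (r n)) h hz (X n))\<^sup>2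
          + (ratio_deriv (f e1 (r n)) (fz e1 (r n)) h hz (X n))\<^sup>2 + (ratio_deriv (f e2 (r n)) (fz e2 (r n)) h hz (X n))\<^sup>2))"
    define R where "R = (\<lambda>n. 2 * (?s n)\<^sup>2 * Q (r n) (X n) * (4 * ?s n * (?a n * (hx (X n) / h (X n)) * fst (X n)
            + ?b n * (hy (X n) / h (X n)) * fst (snd (X n)) + (hz (X n) / h (X n)) * snd (snd (X n))))
       + 2 * Q (r n) (X n) * (16 * (?s n)\<^sup>2 * (?a n * (fst (X n))\<^sup>2 + ?b n * (fst (snd (X n)))\<^sup>2 + (snd (snd (X n)))\<^sup>2))
       + (?s n)\<^sup>2 * Q (r n) (X n) * (?a n * (4 * ?s n - 8 * (fst (X n))\<^sup>2) + ?b n * (4 * ?s n - 8 * (fst (snd (X n)))\<^sup>2)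
          + (4 * ?s n - 8 * (snd (snd (X n)))\<^sup>2)))"
    have LR: "L n \<le> R n" for n
    proof -
        obtain f1xx f1yy f1zz f2xx f2yy f2zz f3xx f3yy f3zz where
          ff: "pde_partials p q k (f e1 (r n)) (fx e1 (r n)) (fy e1 (r n)) (fz e1 (r n)) f1xx f1yy f1zz"
          "pde_partials p q k (f e2 (r n)) (fx e2 (r n)) (fy e2 (r n)) (fz e2 (r n)) f2xx f2yy f2zz"
          "pde_partials p q k (f e3 (r n)) (fx e3 (r n)) (fy e3 (r n)) (fz e3 (r n)) f3xx f3yy f3zz"
          using fpde by metis
        obtain x' y' z' where X': "X n = (x', y', z')" by (cases "X n")
        have in1: "x'\<^sup>2 + y'\<^sup>2 + z'\<^sup>2 \<le> 1" using Y(1)[of "r n"] X' B by (simp add: X_def)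
        have mx: "w (a, b, c) * Q (r n) (a, b, c) \<le> w (X n) * Q (r n) (X n)" if "a\<^sup>2 + b\<^sup>2 + c\<^sup>2 \<le> 1" for a b c
          using Y(2)[of "(a, b, c)" "r n"] that B by (simp add: X_def)
      show "L n \<le> R n"
        using bernstein_inequality_at_max[OF pde pos ff in1 X' mx[unfolded w_def Q_def]]
        unfolding L_def R_def Q_def X' by simp
    qed
    have "2 * s^4 * (a * E11\<^sup>2 + b * E22\<^sup>2 + E33\<^sup>2 + E13\<^sup>2 + E23\<^sup>2)
     \<le> 2 * s\<^sup>2 * QP * (4 * s * (a * u1 * x + b * u2 * y + u3 * z))
       + 2 * QP * (16 * s\<^sup>2 * (a * x\<^sup>2 + b * y\<^sup>2 + z\<^sup>2))
       + s\<^sup>2 * QP * (a * (4 * s - 8 * x\<^sup>2) + b * (4 * s - 8 * y\<^sup>2) + (4 * s - 8 * z\<^sup>2))"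
    proof (rule LIMSEQ_le)
      show "L
        \<longlonglongrightarrow> 2 * s^4 * (a * E11\<^sup>2 + b * E22\<^sup>2 + E33\<^sup>2 + E13\<^sup>2 + E23\<^sup>2)"
        unfolding L_def s_def a_def b_def E11_def E22_def E33_def E13_def E23_def
        using X unfolding Pxyz[symmetric]
        by (intro tendsto_intros lx l1 l2 hlim hlim') (auto simp: hP)
      show "R
       \<longlonglongrightarrow> 2 * s\<^sup>2 * QP * (4 * s * (a * u1 * x + b * u2 * y + u3 * z))
       + 2 * QP * (16 * s\<^sup>2 * (a * x\<^sup>2 + b * y\<^sup>2 + z\<^sup>2))
       + s\<^sup>2 * QP * (a * (4 * s - 8 * x\<^sup>2) + b * (4 * s - 8 * y\<^sup>2) + (4 * s - 8 * z\<^sup>2))"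
        unfolding R_def s_def a_def b_def u1_def u2_def u3_def
        using X unfolding Pxyz[symmetric]
        by (intro tendsto_intros lx QX hlim hlim') (auto simp: hP)
      show "\<exists>N. \<forall>n\<ge>N. L n \<le> R n" using LR by blast
    qed
    hence le: "2 * s^4 * (a * E11\<^sup>2 + b * E22\<^sup>2 + E33\<^sup>2 + E13\<^sup>2 + E23\<^sup>2)
     \<le> 2 * s\<^sup>2 * QP * (4 * s * (a * u1 * x + b * u2 * y + u3 * z))
       + 2 * QP * (16 * s\<^sup>2 * (a * x\<^sup>2 + b * y\<^sup>2 + z\<^sup>2))
       + s\<^sup>2 * QP * (a * (4 * s - 8 * x\<^sup>2) + b * (4 * s - 8 * y\<^sup>2) + (4 * s - 8 * z\<^sup>2))" .
    have s0: "s \<ge> 0" using P B by (simp add: s_def Pxyz)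
    have z1: "\<bar>z\<bar> \<le> 1"
    proof -
      have "z\<^sup>2 \<le> 1" using s0 zero_le_power2[of x] zero_le_power2[of y] unfolding s_def by linarith
      thus ?thesis by (simp add: abs_square_le_1)
    qed
    have pz: "\<bar>p * z\<bar> \<le> p" "\<bar>q * z\<bar> \<le> q" using z1 p q by (simp_all add: abs_mult mult_left_le)
    have aM: "a > 0" "a \<le> M" "1 \<le> M * a" "b > 0" "b \<le> M" "1 \<le> M * b"
      using pz p q unfolding a_def b_def M_def by (simp_all flip: exp_add)
    have v3h: "h' P v3 = p * x * hx P - q * y * hy P + hz P" "Hz P v3 = p * x * Hz P e1 - q * y * Hz P e2 + Hz P (0, 0, 1)"
    proof -
      have v3: "v3 = (p * x) *\<^sub>R e1 + (- (q * y)) *\<^sub>R e2 + (0, 0, 1)" by (simp add: v3_def e1_def e2_def)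
      have l: "F v3 = p * x * F e1 - q * y * F e2 + F (0, 0, 1)" if "linear F" for F :: "_ \<Rightarrow> real"
        unfolding v3 by (simp only: linear_add[OF that] linear_scale[OF that]) simp
      show "h' P v3 = p * x * hx P - q * y * hy P + hz P" "Hz P v3 = p * x * Hz P e1 - q * y * Hz P e2 + Hz P (0, 0, 1)"
        using l[OF has_derivative_linear[OF D(1)]] l[OF has_derivative_linear[OF D'(3)]]
        by (simp_all add: eq1 e1_def e2_def)
    qed
    have he: "h' P e1 = hx P" "h' P e2 = hy P" by (simp_all add: eq1 e1_def e2_def)
    \<comment> \<open>The equation for \<open>log h\<close>. The second \<open>z\<close>-derivative
      is recovered from the derivative of \<open>hz\<close> along \<open>v3\<close> by removing its
      \<open>x\<close>- and \<open>y\<close>-parts, which is where \<open>E13\<close> and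
      \<open>E23\<close> come from.\<close>
    have pdeE: "a * E11 + b * E22 + E33 - p * x * E13 + q * y * E23 + (a * u1\<^sup>2 + b * u2\<^sup>2 + u3\<^sup>2) = k"
    proof -
      have "(h P)\<^sup>2 * (a * E11 + b * E22 + E33 - p * x * E13 + q * y * E23 + (a * u1\<^sup>2 + b * u2\<^sup>2 + u3\<^sup>2)) =
        h P * (a * Hx P e1 + b * Hy P e2 + Hz P (0, 0, 1))"
        unfolding E11_def E22_def E33_def E13_def E23_def u1_def u2_def u3_def v3h he using hP[of P]
        by (simp add: field_simps power2_eq_square)
      also have "\<dots> = (h P)\<^sup>2 * k"
        using pD(7)[of z x y] unfolding eq2 Pxyz a_def b_def e1_def e2_def by (simp add: power2_eq_square)
      finally show ?thesis using hP[of P] by simp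
    qed
    have QPe: "QP = u1\<^sup>2 + u2\<^sup>2 + (u3 + p * x * u1 - q * y * u2)\<^sup>2"
      unfolding QP_def he v3h u1_def u2_def u3_def by (simp add: add_divide_distrib diff_divide_distrib algebra_simps)
    have bound: "s\<^sup>2 * QP \<le> K0"
      unfolding K0_def C0_def C1_def
      by (rule bernstein_algebra[OF aM M less_imp_le[OF p] less_imp_le[OF q] k s_def s0 pdeE QPe le])
    \<comment> \<open>At the origin the cutoff equals 1 and the third generator reduces to the
      \<open>z\<close>-direction, so maximality bounds all three components of the logarithmic
      gradient there.\<close>
    define orig where "orig = (0::real, 0::real, 0::real)"
    have "(\<lambda>n. Q (r n) orig) \<longlonglongrightarrow> (hx orig / h orig)\<^sup>2 + (hy orig / h orig)\<^sup>2 + (hz orig / h orig)\<^sup>2"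
    proof -
      have c: "(\<lambda>n. orig) \<longlonglongrightarrow> (0, 0, 0)" by (simp add: orig_def)
      have "(\<lambda>n. f e1 (r n) orig) \<longlonglongrightarrow> hx orig" "(\<lambda>n. f e2 (r n) orig) \<longlonglongrightarrow> hy orig" "(\<lambda>n. f e3 (r n) orig) \<longlonglongrightarrow> hz orig"
        using limf[OF c, of 1 0 0] limf[OF c, of 0 1 0] limf[OF c, of 0 0 1]
        by (simp_all add: e1_def e2_def e3_def orig_def eq1)
      thus ?thesis unfolding Q_def by (intro tendsto_intros hP)
    qed
    moreover have "(\<lambda>n. w (X n) * Q (r n) (X n)) \<longlonglongrightarrow> s\<^sup>2 * QP"
      unfolding w_def case_prod_beta s_def by (intro tendsto_intros lx QX)
    moreover have "Q (r n) orig \<le> w (X n) * Q (r n) (X n)" for n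
      using Y(2)[of orig "r n"] by (simp add: orig_def w_def X_def B)
    ultimately have "(hx orig / h orig)\<^sup>2 + (hy orig / h orig)\<^sup>2 + (hz orig / h orig)\<^sup>2 \<le> s\<^sup>2 * QP"
      by (intro LIMSEQ_le) auto
    hence "(hx orig / h orig)\<^sup>2 + (hy orig / h orig)\<^sup>2 + (hz orig / h orig)\<^sup>2 \<le> K0" using bound by linarith
    hence "(hx orig / h orig)\<^sup>2 \<le> K0" "(hy orig / h orig)\<^sup>2 \<le> K0" "(hz orig / h orig)\<^sup>2 \<le> K0"
      using zero_le_power2[of "hx orig / h orig"] zero_le_power2[of "hy orig / h orig"] zero_le_power2[of "hz orig / h orig"] by linarith+
    hence "\<bar>hx orig / h orig\<bar> \<le> sqrt K0" "\<bar>hy orig / h orig\<bar> \<le> sqrt K0" "\<bar>hz orig / h orig\<bar> \<le> sqrt K0"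
      by (metis real_sqrt_abs real_sqrt_le_mono)+
    thus "\<bar>hx (0, 0, 0)\<bar> \<le> sqrt K0 * h (0, 0, 0) \<and> \<bar>hy (0, 0, 0)\<bar> \<le> sqrt K0 * h (0, 0, 0) \<and> \<bar>hz (0, 0, 0)\<bar> \<le> sqrt K0 * h (0, 0, 0)"
      using pos[of orig] by (simp add: orig_def abs_divide divide_le_eq)
  qed
qed

subsection \<open>Closure properties of \<open>C\<^sup>2\<close> functions\<close>

lemma C2_compose_affine:
  fixes f :: "'a::real_normed_vector \<Rightarrow> real" and B :: "'b::real_normed_vector \<Rightarrow> 'a"
  assumes "C2 f" and B: "bounded_linear B"
  shows "C2 (\<lambda>x. f (c + B x))"
proof -
  obtain f' f'' where f: "\<And>x. (f has_derivative blinfun_apply (f' x)) (at x)"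
    "\<And>x. (f' has_derivative blinfun_apply (f'' x)) (at x)" "continuous_on UNIV f''"
    using assms unfolding C2_def by blast
  define L where "L = Blinfun B"
  have L: "blinfun_apply L = B" unfolding L_def by (rule bounded_linear_Blinfun_apply[OF B])
  define R where "R = Blinfun (\<lambda>F :: 'a \<Rightarrow>\<^sub>L real. F o\<^sub>L L)"
  have blR: "bounded_linear (\<lambda>F :: 'a \<Rightarrow>\<^sub>L real. F o\<^sub>L L)"
    by (rule bounded_bilinear.bounded_linear_left[OF bounded_bilinear_blinfun_compose])
  have R: "blinfun_apply R = (\<lambda>F. F o\<^sub>L L)"
    unfolding R_def by (rule bounded_linear_Blinfun_apply[OF blR])
  have aff: "((\<lambda>x. c + B x) has_derivative B) (at x)" for x
    by (rule has_derivative_eq_rhs, rule has_derivative_add[OF has_derivative_const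
          bounded_linear_imp_has_derivative[OF B]]) auto
  show ?thesis
    unfolding C2_def
  proof (intro exI conjI allI)
    fix x
    show "((\<lambda>x. f (c + B x)) has_derivative blinfun_apply (f' (c + B x) o\<^sub>L L)) (at x)"
      by (rule has_derivative_eq_rhs[OF has_derivative_compose[OF aff f(1)]]) (auto simp: L)
    show "((\<lambda>x. f' (c + B x) o\<^sub>L L) has_derivative blinfun_apply (R o\<^sub>L f'' (c + B x) o\<^sub>L L)) (at x)"
      by (rule has_derivative_eq_rhs[OF bounded_linear.has_derivative[OF blR has_derivative_compose[OF aff f(2)]]])
         (auto simp: L R)
    have "continuous_on UNIV (\<lambda>x. f'' (c + B x))"
      by (rule continuous_on_compose2[OF f(3)])
         (auto intro!: continuous_intros linear_continuous_on[OF B])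
    thus "continuous_on UNIV (\<lambda>x. R o\<^sub>L f'' (c + B x) o\<^sub>L L)"
      by (intro continuous_intros)
  qed
qed

lemma C2_lincomb:
  assumes "C2 f" and "C2 g"
  shows "C2 (\<lambda>x. c * f x + d * g x)"
proof -
  obtain f' f'' where f: "\<And>x. (f has_derivative blinfun_apply (f' x)) (at x)"
    "\<And>x. (f' has_derivative blinfun_apply (f'' x)) (at x)" "continuous_on UNIV f''"
    using assms(1) unfolding C2_def by blast
  obtain g' g'' where g: "\<And>x. (g has_derivative blinfun_apply (g' x)) (at x)"
    "\<And>x. (g' has_derivative blinfun_apply (g'' x)) (at x)" "continuous_on UNIV g''"
    using assms(2) unfolding C2_def by blast
  show ?thesis
    unfolding C2_def
  proof (intro exI conjI allI)
    fix x
    show "((\<lambda>x. c * f x + d * g x) has_derivative blinfun_apply (c *\<^sub>R f' x + d *\<^sub>R g' x)) (at x)"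
      by (rule has_derivative_eq_rhs[OF has_derivative_add[OF has_derivative_mult_right[OF f(1)]
            has_derivative_mult_right[OF g(1)]]]) (auto simp: blinfun.bilinear_simps)
    show "((\<lambda>x. c *\<^sub>R f' x + d *\<^sub>R g' x) has_derivative blinfun_apply (c *\<^sub>R f'' x + d *\<^sub>R g'' x)) (at x)"
      by (rule has_derivative_eq_rhs[OF has_derivative_add[OF has_derivative_scaleR_right[OF f(2)]
            has_derivative_scaleR_right[OF g(2)]]]) (auto simp: blinfun.bilinear_simps)
    show "continuous_on UNIV (\<lambda>x. c *\<^sub>R f'' x + d *\<^sub>R g'' x)"
      by (intro continuous_intros f g)
  qed
qed

lemma C2_realI:
  fixes m :: "real \<Rightarrow> real"
  assumes "\<And>t. (m has_real_derivative m1 t) (at t)" "\<And>t. (m1 has_real_derivative m2 t) (at t)"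
    and "continuous_on UNIV m2"
  shows "C2 m"
  unfolding C2_def
  proof (intro exI conjI allI)
    fix x
    show "(m has_derivative blinfun_apply (m1 x *\<^sub>R id_blinfun)) (at x)"
      using assms(1)[of x] unfolding has_field_derivative_def
      by (rule has_derivative_eq_rhs) (auto simp: blinfun.scaleR_left)
    have "((\<lambda>t. m1 t *\<^sub>R (id_blinfun :: real \<Rightarrow>\<^sub>L real)) has_derivative (\<lambda>u. (m2 x * u) *\<^sub>R id_blinfun)) (at x)"
      using assms(2)[of x] unfolding has_field_derivative_def by (rule has_derivative_scaleR_left)
    thus "((\<lambda>t. m1 t *\<^sub>R (id_blinfun :: real \<Rightarrow>\<^sub>L real)) has_derivative blinfun_apply (m2 x *\<^sub>R blinfun_scaleR_left id_blinfun)) (at x)"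
      by (rule has_derivative_eq_rhs) (simp add: fun_eq_iff blinfun.scaleR_left)
    show "continuous_on UNIV (\<lambda>t. m2 t *\<^sub>R blinfun_scaleR_left id_blinfun :: real \<Rightarrow>\<^sub>L (real \<Rightarrow>\<^sub>L real))" using assms(3) by (intro continuous_intros)
  qed

lemma C2_imp_continuous: "C2 f \<Longrightarrow> continuous_on S f"
  unfolding C2_def by (meson has_derivative_at_withinI has_derivative_continuous_on)

lemma C2_left_translate:
  assumes "C2 h"
  shows "C2 (\<lambda>P. h (left_translate p q g P))"
proof -
  obtain b c d where g: "g = (b, c, d)" by (cases g)
  have "bounded_linear (\<lambda>P :: real \<times> real \<times> real. (exp (p * d) * fst P, exp (- q * d) * fst (snd P), snd (snd P)))"
    by (intro bounded_linear_Pair bounded_linear_const_mult bounded_linear_fst_comp bounded_linear_fst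
        bounded_linear_snd_comp bounded_linear_snd)
  from C2_compose_affine[OF assms this, of "(b, c, d)"]
  show ?thesis by (simp add: g left_translate_def case_prod_beta' add.commute)
qed

lemma C2_mult:
  assumes "C2 f" and "C2 g"
  shows "C2 (\<lambda>x. f x * g x)"
proof -
  obtain f' f'' where f: "\<And>x. (f has_derivative blinfun_apply (f' x)) (at x)"
    "\<And>x. (f' has_derivative blinfun_apply (f'' x)) (at x)" "continuous_on UNIV f''"
    using assms(1) unfolding C2_def by blast
  obtain g' g'' where g: "\<And>x. (g has_derivative blinfun_apply (g' x)) (at x)"
    "\<And>x. (g' has_derivative blinfun_apply (g'' x)) (at x)" "continuous_on UNIV g''"
    using assms(2) unfolding C2_def by blast
  have c: "continuous_on UNIV f" "continuous_on UNIV g" "continuous_on UNIV f'" "continuous_on UNIV g'"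
    by (rule has_derivative_continuous_on, rule f g)+
  show ?thesis
    unfolding C2_def
  proof (intro exI conjI allI)
    fix x
    show "((\<lambda>x. f x * g x) has_derivative blinfun_apply (f x *\<^sub>R g' x + g x *\<^sub>R f' x)) (at x)"
      by (rule has_derivative_eq_rhs[OF has_derivative_mult[OF f(1) g(1)]]) (auto simp: blinfun.bilinear_simps)
    show "((\<lambda>x. f x *\<^sub>R g' x + g x *\<^sub>R f' x) has_derivative blinfun_apply
        ((f x *\<^sub>R g'' x + (blinfun_scaleR_left (g' x) o\<^sub>L f' x)) +
         (g x *\<^sub>R f'' x + (blinfun_scaleR_left (f' x) o\<^sub>L g' x)))) (at x)"
      by (rule has_derivative_eq_rhs[OF has_derivative_add[OF has_derivative_scaleR[OF f(1) g(2)]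
            has_derivative_scaleR[OF g(1) f(2)]]]) (auto simp: blinfun.bilinear_simps)
    show "continuous_on UNIV (\<lambda>x. (f x *\<^sub>R g'' x + (blinfun_scaleR_left (g' x) o\<^sub>L f' x)) +
         (g x *\<^sub>R f'' x + (blinfun_scaleR_left (f' x) o\<^sub>L g' x)))"
      by (intro continuous_intros c f g bounded_linear.continuous_on[OF bounded_linear_blinfun_scaleR_left])
  qed
qed

subsection \<open>Growth and mixed differences of non-negative solutions\<close>

text \<open>The translate of \<open>h\<close> by \<open>(x, y, z)\<close> has
  \<open>x\<close>-derivative \<open>exp (p * z) * hx (x, y, z)\<close> at the origin, and similarly
  for \<open>y\<close> with \<open>exp (- q * z)\<close>; undoing these factors gives the weights.
  Each rate is constant along its coordinate line, so \<open>log_lipschitz\<close> integrates the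
  estimate.\<close>

lemma log_gradient_bound:
  assumes p: "p > 0" and q: "q > 0" and k: "k \<ge> 0"
    and h: "C2 h" "pde_sol p q k h" "\<And>P. h P > 0"
  obtains K where "K \<ge> 0"
    "\<And>x y z u. h (x + u, y, z) \<le> exp (K * exp (- p * z) * \<bar>u\<bar>) * h (x, y, z)"
    "\<And>x y z v. h (x, y + v, z) \<le> exp (K * exp (q * z) * \<bar>v\<bar>) * h (x, y, z)"
    "\<And>x y z t. h (x, y, z + t) \<le> exp (K * \<bar>t\<bar>) * h (x, y, z)"
proof (rule gradient_bound_at_origin[OF p q k])
  obtain hx hy hz hxx hyy hzz where pde: "pde_partials p q k h hx hy hz hxx hyy hzz"
    using h(2) by (rule pde_solE)
  fix K :: real
  assume K: "K \<ge> 0"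
    "\<And>h hx hy hz hxx hyy hzz. C2 h \<Longrightarrow> pde_partials p q k h hx hy hz hxx hyy hzz \<Longrightarrow> (\<And>P. h P > 0) \<Longrightarrow>
       \<bar>hx (0, 0, 0)\<bar> \<le> K * h (0, 0, 0) \<and> \<bar>hy (0, 0, 0)\<bar> \<le> K * h (0, 0, 0) \<and> \<bar>hz (0, 0, 0)\<bar> \<le> K * h (0, 0, 0)"
  have g: "\<bar>hx (x, y, z)\<bar> \<le> K * exp (- p * z) * h (x, y, z) \<and> \<bar>hy (x, y, z)\<bar> \<le> K * exp (q * z) * h (x, y, z) \<and>
      \<bar>hz (x, y, z)\<bar> \<le> K * h (x, y, z)" for x y z
  proof -
    have 0: "left_translate p q (x, y, z) (0, 0, 0) = (x, y, z)" by (simp add: left_translate_def)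
    from K(2)[OF C2_left_translate[OF h(1)] pde_partials_left_translate[OF pde] h(3), of z x y]
    have *: "exp (p * z) * \<bar>hx (x, y, z)\<bar> \<le> K * h (x, y, z)" "exp (- q * z) * \<bar>hy (x, y, z)\<bar> \<le> K * h (x, y, z)"
      "\<bar>hz (x, y, z)\<bar> \<le> K * h (x, y, z)" unfolding 0 by (simp_all add: abs_mult)
    have "exp (- p * z) * (exp (p * z) * \<bar>hx (x, y, z)\<bar>) \<le> exp (- p * z) * (K * h (x, y, z))"
      "exp (q * z) * (exp (- q * z) * \<bar>hy (x, y, z)\<bar>) \<le> exp (q * z) * (K * h (x, y, z))"
      using * by (intro mult_left_mono; simp)+
    thus ?thesis using *(3) by (simp flip: mult.assoc exp_add) (simp add: mult_ac)
  qed
  show thesis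
  proof (rule that[OF K(1)])
    fix x y z u
    show "h (x + u, y, z) \<le> exp (K * exp (- p * z) * \<bar>u\<bar>) * h (x, y, z)"
      using log_lipschitz[OF pde_partialsD(1)[OF pde] g[THEN conjunct1], where t = "x + u" and s = x] by simp
    show "h (x, y + u, z) \<le> exp (K * exp (q * z) * \<bar>u\<bar>) * h (x, y, z)"
      using log_lipschitz[OF pde_partialsD(3)[OF pde] g[THEN conjunct2, THEN conjunct1], where t = "y + u" and s = y] by simp
    show "h (x, y, z + u) \<le> exp (K * \<bar>u\<bar>) * h (x, y, z)"
      using log_lipschitz[OF pde_partialsD(5)[OF pde] g[THEN conjunct2, THEN conjunct2], where t = "z + u" and s = z] by simp
  qed
qed

lemma ex_height_small_exp:
  fixes p q e :: real
  assumes "p > 0" "q > 0" "e > 0"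
  obtains Z where "Z \<ge> N" "Z > 0" "K1 * exp (- p * Z) \<le> e" "K2 * exp (- q * Z) \<le> e"
proof -
  define Z where "Z = max N (max 1 (max (K1 / (e * p)) (K2 / (e * q))))"
  have *: "K * exp (- r * Z) \<le> e" if "r > 0" "K / (e * r) \<le> Z" for K r
  proof -
    have "K \<le> e * (r * Z)" using that assms by (simp add: field_simps)
    also have "r * Z \<le> exp (r * Z)" using exp_ge_add_one_self[of "r * Z"] by linarith
    finally have "K \<le> e * exp (r * Z)" using assms by simp
    hence "K * exp (- r * Z) \<le> e * exp (r * Z) * exp (- r * Z)" by (intro mult_right_mono) auto
    thus ?thesis by (simp flip: exp_add add: mult.assoc)
  qed
  show thesis
  proof (rule that[of Z])
    show "K1 * exp (- p * Z) \<le> e" by (rule *[OF assms(1)]) (simp add: Z_def)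
    show "K2 * exp (- q * Z) \<le> e" by (rule *[OF assms(2)]) (simp add: Z_def)
  qed (auto simp: Z_def)
qed

text \<open>Compare \<open>h (x, y, z)\<close> with \<open>h (0, 0, - Z)\<close> along a detour: up
  to height \<open>Z\<close>, where moving in \<open>x\<close> costs rate at most \<open>e\<close>,
  then down to \<open>- Z\<close>, where moving in \<open>y\<close> does. The vertical parts, of
  lengths at most \<open>N + Z\<close> and \<open>2 * Z\<close>, cost a factor independent of
  \<open>x\<close> and \<open>y\<close>.\<close>

lemma positive_solution_subexp:
  assumes p: "p > 0" and q: "q > 0" and k: "k \<ge> 0"
    and h: "C2 h" "pde_sol p q k h" "\<And>P. h P > 0"
  shows "subexp_on_strip N h"
  unfolding subexp_on_strip_def
proof (intro allI impI)
  fix e :: real assume e: "e > 0"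
  obtain K where K: "K \<ge> 0"
    and KK: "\<And>x y z u. h (x + u, y, z) \<le> exp (K * exp (- p * z) * \<bar>u\<bar>) * h (x, y, z)"
    "\<And>x y z v. h (x, y + v, z) \<le> exp (K * exp (q * z) * \<bar>v\<bar>) * h (x, y, z)"
    "\<And>x y z t. h (x, y, z + t) \<le> exp (K * \<bar>t\<bar>) * h (x, y, z)"
    using log_gradient_bound[OF p q k h] by metis
  obtain Z where Z: "Z \<ge> N" "Z > 0" "K * exp (- p * Z) \<le> e" "K * exp (- q * Z) \<le> e"
    using ex_height_small_exp[OF p q e] by metis
  define C where "C = exp (K * (N + Z)) * exp (K * (2 * Z)) * h (0, 0, - Z)"
  show "\<exists>C. \<forall>x y z. \<bar>z\<bar> \<le> N \<longrightarrow> \<bar>h (x, y, z)\<bar> \<le> C * exp (e * (\<bar>x\<bar> + \<bar>y\<bar>))"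
  proof (intro exI[of _ C] allI impI)
    fix x y z :: real assume z: "\<bar>z\<bar> \<le> N"
    have "h (x, y, z) \<le> exp (K * \<bar>z - Z\<bar>) * h (x, y, Z)" using KK(3)[of x y Z "z - Z"] by simp
    also have "\<dots> \<le> exp (K * (N + Z)) * h (x, y, Z)"
      using z Z K(1) h(3)[of "(x, y, Z)"] by (intro mult_right_mono) (auto intro!: mult_left_mono)
    also have "h (x, y, Z) \<le> exp (K * exp (- p * Z) * \<bar>x\<bar>) * h (0, y, Z)" using KK(1)[of 0 x y Z] by simp
    also have "\<dots> \<le> exp (e * \<bar>x\<bar>) * h (0, y, Z)"
      using Z(3) h(3)[of "(0, y, Z)"] by (intro mult_right_mono) (auto intro!: mult_right_mono simp del: mult_minus_left)
    also have "h (0, y, Z) \<le> exp (K * (2 * Z)) * h (0, y, - Z)" using KK(3)[of 0 y "- Z" "2 * Z"] Z by simp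
    also have "h (0, y, - Z) \<le> exp (K * exp (- q * Z) * \<bar>y\<bar>) * h (0, 0, - Z)" using KK(2)[of 0 0 y "- Z"] by simp
    also have "\<dots> \<le> exp (e * \<bar>y\<bar>) * h (0, 0, - Z)"
      using Z(4) h(3)[of "(0, 0, - Z)"] by (intro mult_right_mono) (auto intro!: mult_right_mono simp del: mult_minus_left)
    finally have "h (x, y, z) \<le> exp (K * (N + Z)) * (exp (e * \<bar>x\<bar>) * (exp (K * (2 * Z)) * (exp (e * \<bar>y\<bar>) * h (0, 0, - Z))))"
      by simp
    also have "\<dots> = C * exp (e * (\<bar>x\<bar> + \<bar>y\<bar>))" by (simp add: C_def distrib_left exp_add)
    finally show "\<bar>h (x, y, z)\<bar> \<le> C * exp (e * (\<bar>x\<bar> + \<bar>y\<bar>))" using h(3)[of "(x, y, z)"] by simp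
  qed
qed

lemma subexp_on_strip_lincomb:
  assumes "subexp_on_strip N f" and "subexp_on_strip N g"
  shows "subexp_on_strip N (\<lambda>P. c * f P + d * g P)"
  unfolding subexp_on_strip_def
proof (intro allI impI)
  fix e :: real assume e: "e > 0"
  obtain C where C: "\<And>x y z. \<bar>z\<bar> \<le> N \<Longrightarrow> \<bar>f (x, y, z)\<bar> \<le> C * exp (e * (\<bar>x\<bar> + \<bar>y\<bar>))"
    using assms(1) e unfolding subexp_on_strip_def by meson
  obtain D where D: "\<And>x y z. \<bar>z\<bar> \<le> N \<Longrightarrow> \<bar>g (x, y, z)\<bar> \<le> D * exp (e * (\<bar>x\<bar> + \<bar>y\<bar>))"
    using assms(2) e unfolding subexp_on_strip_def by meson
  show "\<exists>C. \<forall>x y z. \<bar>z\<bar> \<le> N \<longrightarrow> \<bar>c * f (x, y, z) + d * g (x, y, z)\<bar> \<le> C * exp (e * (\<bar>x\<bar> + \<bar>y\<bar>))"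
  proof (intro exI[of _ "\<bar>c\<bar> * C + \<bar>d\<bar> * D"] allI impI)
    fix x y z :: real assume z: "\<bar>z\<bar> \<le> N"
    have "\<bar>c * f (x, y, z) + d * g (x, y, z)\<bar> \<le> \<bar>c\<bar> * \<bar>f (x, y, z)\<bar> + \<bar>d\<bar> * \<bar>g (x, y, z)\<bar>"
      by (rule order_trans[OF abs_triangle_ineq]) (simp add: abs_mult)
    also have "\<dots> \<le> \<bar>c\<bar> * (C * exp (e * (\<bar>x\<bar> + \<bar>y\<bar>))) + \<bar>d\<bar> * (D * exp (e * (\<bar>x\<bar> + \<bar>y\<bar>)))"
      using C[OF z] D[OF z] by (intro add_mono mult_left_mono) auto
    finally show "\<bar>c * f (x, y, z) + d * g (x, y, z)\<bar> \<le> (\<bar>c\<bar> * C + \<bar>d\<bar> * D) * exp (e * (\<bar>x\<bar> + \<bar>y\<bar>))"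
      by (simp add: algebra_simps)
  qed
qed

lemma subexp_on_strip_shift:
  assumes "subexp_on_strip N f"
  shows "subexp_on_strip N (\<lambda>(x, y, z). f (x + u, y + v, z))"
  unfolding subexp_on_strip_def
proof (intro allI impI)
  fix e :: real assume e: "e > 0"
  obtain C where C: "\<And>x y z. \<bar>z\<bar> \<le> N \<Longrightarrow> \<bar>f (x, y, z)\<bar> \<le> C * exp (e * (\<bar>x\<bar> + \<bar>y\<bar>))"
    using assms(1) e unfolding subexp_on_strip_def by meson
  show "\<exists>C. \<forall>x y z. \<bar>z\<bar> \<le> N \<longrightarrow> \<bar>case (x, y, z) of (x, y, z) \<Rightarrow> f (x + u, y + v, z)\<bar> \<le> C * exp (e * (\<bar>x\<bar> + \<bar>y\<bar>))"
  proof (intro exI[of _ "C * exp (e * (\<bar>u\<bar> + \<bar>v\<bar>))"] allI impI)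
    fix x y z :: real assume z: "\<bar>z\<bar> \<le> N"
    have "0 \<le> C * exp (e * (\<bar>0\<bar> + \<bar>0\<bar>))" using C[OF z, of 0 0] abs_ge_zero order_trans by blast
    hence C0: "C \<ge> 0" by simp
    have "\<bar>f (x + u, y + v, z)\<bar> \<le> C * exp (e * (\<bar>x + u\<bar> + \<bar>y + v\<bar>))" by (rule C[OF z])
    also have "\<dots> \<le> C * exp (e * ((\<bar>u\<bar> + \<bar>v\<bar>) + (\<bar>x\<bar> + \<bar>y\<bar>)))"
      using C0 e by (intro mult_left_mono) auto
    finally show "\<bar>case (x, y, z) of (x, y, z) \<Rightarrow> f (x + u, y + v, z)\<bar> \<le> C * exp (e * (\<bar>u\<bar> + \<bar>v\<bar>)) * exp (e * (\<bar>x\<bar> + \<bar>y\<bar>))"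
      by (simp add: distrib_left exp_add mult.assoc)
  qed
qed

lemma pde_sol_shift:
  assumes "pde_sol p q k f"
  shows "pde_sol p q k (\<lambda>(x, y, z). f (x + u, y + v, z))"
  using pde_sol_left_translate[OF assms, of "(u, v, 0)"] by (simp add: left_translate_def case_prod_beta')

text \<open>\<open>w\<close> is the mixed difference and \<open>m\<close> the sum of the same four
  translates; both solve the equation. Grouping \<open>w\<close> into \<open>x\<close>-differences
  at height \<open>N\<close> and into \<open>y\<close>-differences at height \<open>- N\<close>
  gives \<open>\<bar>w\<bar> \<le> e * m\<close> on both boundary planes, and the maximum principle
  for \<open>e * m \<plusminus> w\<close> carries this inside.\<close>

lemma mixed_difference_eq_0_of_pos:
  assumes p: "p > 0" and q: "q > 0" and k: "k \<ge> 0"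
    and h: "C2 h" "pde_sol p q k h" "\<And>P. h P > 0"
  shows "h (x + u, y + v, z) - h (x + u, y, z) - h (x, y + v, z) + h (x, y, z) = 0"
proof -
  obtain K where K: "K \<ge> 0"
    and KK: "\<And>x y z u. h (x + u, y, z) \<le> exp (K * exp (- p * z) * \<bar>u\<bar>) * h (x, y, z)"
    "\<And>x y z v. h (x, y + v, z) \<le> exp (K * exp (q * z) * \<bar>v\<bar>) * h (x, y, z)"
    "\<And>x y z t. h (x, y, z + t) \<le> exp (K * \<bar>t\<bar>) * h (x, y, z)"
    using log_gradient_bound[OF p q k h] by metis
  define T where "T = (\<lambda>s t. \<lambda>(x, y, z). h (x + s, y + t, z))"
  define w where "w = (\<lambda>P. 1 * (1 * T u v P + -1 * T u 0 P) + 1 * (-1 * T 0 v P + 1 * T 0 0 P))"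
  define m where "m = (\<lambda>P. 1 * (1 * T u v P + 1 * T u 0 P) + 1 * (1 * T 0 v P + 1 * T 0 0 P))"
  have T: "pde_sol p q k (T s t)" "subexp_on_strip N (T s t)" for s t N
    unfolding T_def by (intro pde_sol_shift subexp_on_strip_shift h positive_solution_subexp[OF p q k h])+
  have wm: "pde_sol p q k w" "subexp_on_strip N w" "pde_sol p q k m" "subexp_on_strip N m" for N
    unfolding w_def m_def by (intro pde_sol_lincomb subexp_on_strip_lincomb T)+
  \<comment> \<open>The threshold \<open>ln (1 + e)\<close> makes both ratios at most
    \<open>1 + e\<close>; this turns the multiplicative gradient bound into an additive one.\<close>
  have diff: "\<bar>a - b\<bar> \<le> e * (a + b)" if "a > 0" "b > 0" "a \<le> exp c * b" "b \<le> exp c * a" "c \<le> ln (1 + e)" "e > 0"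
    for a b c e :: real
  proof -
    have "exp c \<le> 1 + e" using that by (metis exp_le_cancel_iff exp_ln add_pos_pos zero_less_one)
    hence "a \<le> (1 + e) * b" "b \<le> (1 + e) * a"
      using that by (meson mult_right_mono less_imp_le order_trans)+
    moreover have "e * a \<ge> 0" "e * b \<ge> 0" using that by auto
    ultimately show ?thesis by (simp add: algebra_simps abs_le_iff)
  qed
  have pos: "T s t P > 0" for s t P by (cases P) (simp add: T_def h)
  have small: "\<bar>w (x, y, z)\<bar> \<le> e * m (x, y, z)" if e: "e > 0" for e x y z
  proof -
    have lpos: "ln (1 + e) > 0" using e by simp
    obtain N where N: "N \<ge> \<bar>z\<bar>" "N > 0" "(K * \<bar>u\<bar>) * exp (- p * N) \<le> ln (1 + e)"
      "(K * \<bar>v\<bar>) * exp (- q * N) \<le> ln (1 + e)"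
      using ex_height_small_exp[OF p q lpos] by metis
    have top: "\<bar>w (x, y, N)\<bar> \<le> e * m (x, y, N)" for x y
    proof -
      have *: "\<bar>T u t (x, y, N) - T 0 t (x, y, N)\<bar> \<le> e * (T u t (x, y, N) + T 0 t (x, y, N))" for t
      proof (rule diff[OF pos pos])
        show "T u t (x, y, N) \<le> exp (K * exp (- p * N) * \<bar>u\<bar>) * T 0 t (x, y, N)"
          using KK(1)[of x u "y + t" N] by (simp add: T_def)
        show "T 0 t (x, y, N) \<le> exp (K * exp (- p * N) * \<bar>u\<bar>) * T u t (x, y, N)"
          using KK(1)[of "x + u" "- u" "y + t" N] by (simp add: T_def)
      qed (use N(3) e in \<open>simp_all add: mult_ac\<close>)
      show ?thesis using *[of v] *[of 0] unfolding w_def m_def by (simp add: distrib_left)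
    qed
    have bot: "\<bar>w (x, y, - N)\<bar> \<le> e * m (x, y, - N)" for x y
    proof -
      have *: "\<bar>T s v (x, y, - N) - T s 0 (x, y, - N)\<bar> \<le> e * (T s v (x, y, - N) + T s 0 (x, y, - N))" for s
      proof (rule diff[OF pos pos])
        show "T s v (x, y, - N) \<le> exp (K * exp (- q * N) * \<bar>v\<bar>) * T s 0 (x, y, - N)"
          using KK(2)[of "x + s" y v "- N"] by (simp add: T_def)
        show "T s 0 (x, y, - N) \<le> exp (K * exp (- q * N) * \<bar>v\<bar>) * T s v (x, y, - N)"
          using KK(2)[of "x + s" "y + v" "- v" "- N"] by (simp add: T_def)
      qed (use N(4) e in \<open>simp_all add: mult_ac\<close>)
      show ?thesis using *[of u] *[of 0] unfolding w_def m_def by (simp add: distrib_left)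
    qed
    have A: "0 \<le> c + -1 * d" "0 \<le> c + 1 * d" if "\<bar>d\<bar> \<le> c" for c d :: real using that by linarith+
    have "e * m (x, y, z) + -1 * w (x, y, z) \<ge> 0"
      by (rule strip_maximum_principle[OF pde_sol_lincomb[OF wm(3,1)] k p q N(2)
            subexp_on_strip_lincomb[OF wm(4,2)] _ _ N(1)])
         (intro A(1) top bot)+
    moreover have "e * m (x, y, z) + 1 * w (x, y, z) \<ge> 0"
      by (rule strip_maximum_principle[OF pde_sol_lincomb[OF wm(3,1)] k p q N(2)
            subexp_on_strip_lincomb[OF wm(4,2)] _ _ N(1)])
         (intro A(2) top bot)+
    ultimately show ?thesis by (simp add: abs_le_iff)
  qed
  \<comment> \<open>\<open>m\<close> does not depend on \<open>e\<close>, so \<open>e\<close> may be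
    chosen at the point: \<open>\<bar>w\<bar> / (2 * m)\<close> yields
    \<open>\<bar>w\<bar> \<le> \<bar>w\<bar> / 2\<close>.\<close>
  have "w (x, y, z) = 0"
  proof (rule ccontr)
    assume "w (x, y, z) \<noteq> 0"
    moreover have mpos: "m (x, y, z) > 0" unfolding m_def using pos by (simp add: add_pos_pos)
    ultimately have "\<bar>w (x, y, z)\<bar> / (2 * m (x, y, z)) > 0" by simp
    from small[OF this, of x y z] show False using mpos \<open>w (x, y, z) \<noteq> 0\<close> by simp
  qed
  thus ?thesis by (simp add: w_def T_def)
qed

section \<open>From positive to non-negative solutions\<close>

lemma C2_vertical:
  assumes "C2 m"
  shows "C2 (\<lambda>(x :: real, y :: real, z :: real). m z)"
  using C2_compose_affine[OF assms, of "\<lambda>P :: real \<times> real \<times> real. snd (snd P)" 0]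
  by (simp add: case_prod_beta' bounded_linear_snd_comp bounded_linear_snd)

lemma pde_sol_vertical:
  assumes m: "\<And>t. (m has_real_derivative m1 t) (at t)" "\<And>t. (m1 has_real_derivative k * m t) (at t)"
  shows "pde_sol p q k (\<lambda>(x, y, z). m z)"
proof (rule pde_solI)
  have "continuous_on UNIV m" using DERIV_continuous_on m(1) by blast
  thus "continuous_on UNIV (\<lambda>(x, y, z). m z)"
    unfolding case_prod_beta by (rule continuous_on_compose2) (auto intro!: continuous_intros)
  show "pde_partials p q k (\<lambda>(x, y, z). m z) (\<lambda>P. 0) (\<lambda>P. 0) (\<lambda>(x, y, z). m1 z) (\<lambda>P. 0) (\<lambda>P. 0)
     (\<lambda>(x, y, z). k * m z)"
    unfolding pde_partials_def by (simp add: m)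
qed

lemma
  assumes p: "p > 0" and q: "q > 0" and k: "k \<ge> 0"
    and h: "C2 h" "pde_sol p q k h" "\<And>P. h P \<ge> 0"
  shows mixed_difference_eq_0: "h (x + u, y + v, z) - h (x + u, y, z) - h (x, y + v, z) + h (x, y, z) = 0"
    and nonneg_solution_subexp: "subexp_on_strip N h"
proof -
  \<comment> \<open>adding a positive solution avoids the strong maximum principle for \<open>h\<close>\<close>
  define E where "E = (\<lambda>t. exp (sqrt k * t))"
  have E: "(E has_real_derivative sqrt k * E t) (at t)" "((\<lambda>t. sqrt k * E t) has_real_derivative k * E t) (at t)" for t
    unfolding E_def using k by (auto intro!: derivative_eq_intros)
  have cE: "continuous_on UNIV (\<lambda>t. k * E t)" unfolding E_def by (intro continuous_intros)
  define H where "H = (\<lambda>P. 1 * h P + 1 * (\<lambda>(x, y, z). E z) P)"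
  have H: "C2 H" "pde_sol p q k H" "H P > 0" for P
  proof -
    show "C2 H" unfolding H_def by (intro C2_lincomb h C2_vertical C2_realI[OF E cE])
    show "pde_sol p q k H" unfolding H_def by (intro pde_sol_lincomb h pde_sol_vertical[OF E])
    show "H P > 0" using h(3)[of P] by (simp add: H_def E_def case_prod_beta add_nonneg_pos)
  qed
  \<comment> \<open>The added solution depends on \<open>z\<close> only and cancels from the mixed
    difference.\<close>
  show "h (x + u, y + v, z) - h (x + u, y, z) - h (x, y + v, z) + h (x, y, z) = 0"
    using mixed_difference_eq_0_of_pos[OF p q k H, of x u y v z] by (simp add: H_def)
  show "subexp_on_strip N h"
    unfolding subexp_on_strip_def
  proof (intro allI impI)
    fix e :: real assume "e > 0"
    then obtain C where C: "\<And>x y z. \<bar>z\<bar> \<le> N \<Longrightarrow> \<bar>H (x, y, z)\<bar> \<le> C * exp (e * (\<bar>x\<bar> + \<bar>y\<bar>))"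
      using positive_solution_subexp[OF p q k H] unfolding subexp_on_strip_def by meson
    have "\<bar>h (x, y, z)\<bar> \<le> \<bar>H (x, y, z)\<bar>" for x y z
      using h(3)[of "(x, y, z)"] by (simp add: H_def E_def)
    thus "\<exists>C. \<forall>x y z. \<bar>z\<bar> \<le> N \<longrightarrow> \<bar>h (x, y, z)\<bar> \<le> C * exp (e * (\<bar>x\<bar> + \<bar>y\<bar>))"
      using C by (meson order_trans)
  qed
qed

subsection \<open>Splitting non-negative solutions\<close>

text \<open>Continuity is recorded for \<open>hyy\<close> because this derivative becomes the
  inhomogeneity of an ordinary differential equation in
  \<open>nonneg_solution_splits\<close>.\<close>

lemma C2_axis_derivs:
  fixes h :: "real \<times> real \<times> real \<Rightarrow> real"
  assumes "C2 h"
  obtains hx hy hz hxx hyy hzz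
  where "\<And>x y z. ((\<lambda>t. h (t, y, z)) has_real_derivative hx (x, y, z)) (at x)"
    "\<And>x y z. ((\<lambda>t. hx (t, y, z)) has_real_derivative hxx (x, y, z)) (at x)"
    "\<And>x y z. ((\<lambda>t. h (x, t, z)) has_real_derivative hy (x, y, z)) (at y)"
    "\<And>x y z. ((\<lambda>t. hy (x, t, z)) has_real_derivative hyy (x, y, z)) (at y)"
    "\<And>x y z. ((\<lambda>t. h (x, y, t)) has_real_derivative hz (x, y, z)) (at z)"
    "\<And>x y z. ((\<lambda>t. hz (x, y, t)) has_real_derivative hzz (x, y, z)) (at z)"
    "continuous_on UNIV hyy"
proof (rule C2_partials[OF assms])
  fix h' and Hx Hy Hz :: "real \<times> real \<times> real \<Rightarrow> real \<times> real \<times> real \<Rightarrow> real"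
  assume D: "\<And>P. (h has_derivative h' P) (at P)"
    "\<And>P. ((\<lambda>P. h' P (1, 0, 0)) has_derivative Hx P) (at P)"
    "\<And>P. ((\<lambda>P. h' P (0, 1, 0)) has_derivative Hy P) (at P)"
    "\<And>P. ((\<lambda>P. h' P (0, 0, 1)) has_derivative Hz P) (at P)"
    and cont: "\<And>X V P v. X \<longlonglongrightarrow> P \<Longrightarrow> V \<longlonglongrightarrow> v \<Longrightarrow> (\<lambda>n. Hy (X n) (V n)) \<longlonglongrightarrow> Hy P v"
  show thesis
  proof (rule that)
    show "continuous_on UNIV (\<lambda>P. Hy P (0, 1, 0))"
      by (rule continuous_on_sequentiallyI) (rule cont, assumption, rule tendsto_const)
  qed (rule DERIV_along_axes, rule D)+
qed

section \<open>The ordinary differential equation in the vertical variable\<close>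

text \<open>These are \<open>cosh (m t)\<close> and \<open>sinh (m t) / m\<close> with
  \<open>m = sqrt k\<close>; the division by \<open>m\<close> makes \<open>1\<close> and
  \<open>t\<close> the matching pair for \<open>k = 0\<close>. The identity
  \<open>(c t)\<^sup>2 - k * (s t)\<^sup>2 = 1\<close> says that their Wronskian is 1.\<close>

lemma fundamental_solutions:
  fixes k :: real
  assumes "k \<ge> 0"
  obtains c s :: "real \<Rightarrow> real"
  where "\<And>t. (c has_real_derivative k * s t) (at t)" "\<And>t. (s has_real_derivative c t) (at t)"
    "\<And>t. (c t)\<^sup>2 - k * (s t)\<^sup>2 = 1" "\<And>t. c (- t) = c t" "\<And>t. s (- t) = - s t"
    "\<And>t. c t \<ge> 1" "\<And>t. t > 0 \<Longrightarrow> s t > 0" "s 0 = 0" "c 0 = 1"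
proof (cases "k = 0")
  case True
  show thesis
    by (rule that[of "\<lambda>t. 1" "\<lambda>t. t"]) (use True in \<open>auto intro!: derivative_eq_intros\<close>)
next
  case False
  define m where "m = sqrt k"
  have m: "m > 0" "k = m * m" using assms False by (auto simp: m_def)
  show thesis
  proof (rule that[of "\<lambda>t. cosh (m * t)" "\<lambda>t. sinh (m * t) / m"])
    show "(cosh (m * t))\<^sup>2 - k * (sinh (m * t) / m)\<^sup>2 = 1" for t
      using m hyperbolic_pythagoras[of "m * t"] by (simp add: power2_eq_square)
    show "((\<lambda>t. cosh (m * t)) has_real_derivative k * (sinh (m * t) / m)) (at t)"
      "((\<lambda>t. sinh (m * t) / m) has_real_derivative cosh (m * t)) (at t)" for t
      using m by (auto intro!: derivative_eq_intros)
  qed (use m in \<open>auto simp: cosh_real_ge_1\<close>)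
qed

lemma DERIV_imp_continuous_on:
  "(\<And>t. (f has_real_derivative f' t) (at t)) \<Longrightarrow> continuous_on S f"
  by (meson DERIV_isCont continuous_at_imp_continuous_on)

lemma ex_antiderivative:
  fixes g :: "real \<Rightarrow> real"
  assumes "continuous_on UNIV g"
  obtains G where "\<And>t. (G has_real_derivative g t) (at t)"
proof -
  have "isCont g x" for x using assms by (simp add: continuous_on_eq_continuous_at)
  hence "\<exists>F. \<forall>x::real. -\<infinity> < ereal x \<longrightarrow> ereal x < \<infinity> \<longrightarrow> (F has_vector_derivative g x) (at x)"
    by (intro einterval_antiderivative) auto
  thus thesis using that by (auto simp: has_real_derivative_iff_has_vector_derivative)
qed

text \<open>Variation of constants: with Wronskian 1 the solution is \<open>s * I - c * J\<close>,
  where \<open>I\<close> and \<open>J\<close> are antiderivatives of \<open>c * r\<close> and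
  \<open>s * r\<close>.\<close>

lemma ex_particular_solution:
  fixes r :: "real \<Rightarrow> real"
  assumes "k \<ge> 0" and r: "continuous_on UNIV r"
  obtains g g' where "\<And>t. (g has_real_derivative g' t) (at t)"
    "\<And>t. (g' has_real_derivative k * g t + r t) (at t)"
proof -
  obtain c s :: "real \<Rightarrow> real" where cs: "\<And>t. (c has_real_derivative k * s t) (at t)"
    "\<And>t. (s has_real_derivative c t) (at t)" "\<And>t. (c t)\<^sup>2 - k * (s t)\<^sup>2 = 1"
    using fundamental_solutions[OF assms(1)] by metis
  have cont: "continuous_on UNIV c" "continuous_on UNIV s" by (rule DERIV_imp_continuous_on, rule cs)+
  obtain I where I: "\<And>t. (I has_real_derivative c t * r t) (at t)"
    using ex_antiderivative[of "\<lambda>t. c t * r t"] cont r by (auto intro: continuous_intros)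
  obtain J where J: "\<And>t. (J has_real_derivative s t * r t) (at t)"
    using ex_antiderivative[of "\<lambda>t. s t * r t"] cont r by (auto intro: continuous_intros)
  show thesis
  proof (rule that[of "\<lambda>t. s t * I t - c t * J t" "\<lambda>t. c t * I t - k * s t * J t"])
    fix t
    show "((\<lambda>t. s t * I t - c t * J t) has_real_derivative c t * I t - k * s t * J t) (at t)"
      by (auto intro!: derivative_eq_intros cs I J simp: algebra_simps)
    have "((\<lambda>t. c t * I t - k * s t * J t) has_real_derivative
       k * (s t * I t - c t * J t) + ((c t)\<^sup>2 - k * (s t)\<^sup>2) * r t) (at t)"
      by (auto intro!: derivative_eq_intros cs I J simp: algebra_simps power2_eq_square)
    thus "((\<lambda>t. c t * I t - k * s t * J t) has_real_derivative k * (s t * I t - c t * J t) + r t) (at t)"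
      by (simp add: cs(3))
  qed
qed

lemma subexp_on_strip_vertical:
  assumes "continuous_on UNIV m"
  shows "subexp_on_strip N (\<lambda>(x, y, z). m z)"
proof -
  have "compact (m ` {-N..N})" by (intro compact_continuous_image continuous_on_subset[OF assms]) auto
  then obtain B where B': "\<forall>y \<in> m ` {-N..N}. norm y \<le> B"
    using compact_imp_bounded bounded_iff by metis
  have B: "\<bar>m z\<bar> \<le> B" if "\<bar>z\<bar> \<le> N" for z
  proof -
    have "m z \<in> m ` {-N..N}" using that by (intro imageI) auto
    thus ?thesis using B' by auto
  qed
  have "\<bar>m z\<bar> \<le> B * exp (e * (\<bar>x\<bar> + \<bar>y\<bar>))" if "e > 0" "\<bar>z\<bar> \<le> N" for e x y z
  proof -
    have "B \<ge> 0" using B[OF that(2)] by linarith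
    hence "B * 1 \<le> B * exp (e * (\<bar>x\<bar> + \<bar>y\<bar>))" using that by (intro mult_left_mono) auto
    thus ?thesis using B[OF that(2)] by simp
  qed
  thus ?thesis unfolding subexp_on_strip_def by (simp, blast)
qed

lemma subexp_on_strip_slice:
  assumes "subexp_on_strip N h"
  shows "subexp_on_strip N (\<lambda>(x, y, z). h (x, 0, z))"
  unfolding subexp_on_strip_def
proof (intro allI impI)
  fix e :: real assume e: "e > 0"
  obtain C where C: "\<And>x y z. \<bar>z\<bar> \<le> N \<Longrightarrow> \<bar>h (x, y, z)\<bar> \<le> C * exp (e * (\<bar>x\<bar> + \<bar>y\<bar>))"
    using assms(1) e unfolding subexp_on_strip_def by meson
  have "\<bar>h (x, 0, z)\<bar> \<le> C * exp (e * (\<bar>x\<bar> + \<bar>y\<bar>))" if z: "\<bar>z\<bar> \<le> N" for x y z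
  proof -
    have "0 \<le> C * exp (e * (\<bar>0\<bar> + \<bar>0\<bar>))" using C[OF z, of 0 0] abs_ge_zero order_trans by blast
    hence "C * exp (e * (\<bar>x\<bar> + \<bar>0\<bar>)) \<le> C * exp (e * (\<bar>x\<bar> + \<bar>y\<bar>))" using e by (intro mult_left_mono) auto
    thus ?thesis using C[OF z, of x 0] by linarith
  qed
  thus "\<exists>C. \<forall>x y z. \<bar>z\<bar> \<le> N \<longrightarrow> \<bar>case (x, y, z) of (x, y, z) \<Rightarrow> h (x, 0, z)\<bar> \<le> C * exp (e * (\<bar>x\<bar> + \<bar>y\<bar>))"
    by auto
qed

text \<open>The slice \<open>h (x, 0, z)\<close> is not itself a solution, because the
  \<open>y\<close>-term of the equation is missing; subtracting a suitable \<open>g z\<close>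
  repairs this and gives \<open>A\<close>, and \<open>B = h - A\<close> is free of \<open>x\<close>.
  Non-negativity of \<open>h\<close> says \<open>A \<ge> - B\<close> for all independent
  \<open>x\<close> and \<open>y\<close>, so a solution \<open>V\<close> in \<open>z\<close> alone is
  sought with \<open>- B \<le> V \<le> A\<close>; then \<open>l = g + V\<close>.\<close>

lemma nonneg_solution_splits:
  assumes p: "p > 0" and q: "q > 0" and k: "k \<ge> 0"
    and h: "C2 h" "pde_sol p q k h" "\<And>P. h P \<ge> 0"
  obtains l where "C2 l" "pde_sol p q k (\<lambda>(x, y, z). h (x, 0, z) - l z)"
    "\<And>x z. l z \<le> h (x, 0, z)" "\<And>x y z. h (x, 0, z) - l z \<le> h (x, y, z)"
proof -
  have mixed: "h (x, y, z) = h (x, 0, z) + h (0, y, z) - h (0, 0, z)" for x y z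
    using mixed_difference_eq_0[OF p q k h, of 0 x 0 y z] by simp
  obtain hx hy hz hxx hyy hzz where pde: "pde_partials p q k h hx hy hz hxx hyy hzz"
    using h(2) by (rule pde_solE)
  note D = pde_partialsD[OF pde]
  \<comment> \<open>The derivatives in \<open>pde_partials\<close> carry no continuity. This second
    set, obtained from \<open>C2\<close>, does, and uniqueness of derivatives identifies the
    two.\<close>
  obtain hy' hyy'
    where D': "\<And>x y z. ((\<lambda>t. h (x, t, z)) has_real_derivative hy' (x, y, z)) (at y)"
    "\<And>x y z. ((\<lambda>t. hy' (x, t, z)) has_real_derivative hyy' (x, y, z)) (at y)" and cont': "continuous_on UNIV hyy'"
    using C2_axis_derivs[OF h(1)] by metis
  have hy': "hy (x, y, z) = hy' (x, y, z)" for x y z by (rule DERIV_unique, rule D, rule D')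
  have hyy': "hyy (x, y, z) = hyy' (x, y, z)" for x y z
    by (rule DERIV_unique[OF D(4)]) (unfold hy', rule D')
  have hyeq: "hy (x, y, z) = hy (0, y, z)" for x y z
  proof -
    have "((\<lambda>t. h (x, 0, z) + h (0, t, z) - h (0, 0, z)) has_real_derivative hy (0, y, z)) (at y)"
      by (auto intro!: derivative_eq_intros D)
    hence "((\<lambda>t. h (x, t, z)) has_real_derivative hy (0, y, z)) (at y)" by (simp flip: mixed)
    thus ?thesis by (rule DERIV_unique[OF D(3)])
  qed
  have hyyeq: "hyy (x, y, z) = hyy (0, y, z)" for x y z
    by (rule DERIV_unique[OF D(4)]) (simp add: hyeq[of x] D)
  \<comment> \<open>The missing \<open>y\<close>-term of the slice, with opposite sign. By
    \<open>hyyeq\<close> it is the same for all \<open>x\<close>, so a correction depending on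
    \<open>z\<close> alone can absorb it.\<close>
  define r where "r = (\<lambda>z. - (exp (- 2 * q * z) * hyy' (0, 0, z)))"
  have r: "continuous_on UNIV r"
    unfolding r_def by (intro continuous_intros continuous_on_compose2[OF cont']) auto
  obtain g g' where g: "\<And>t. (g has_real_derivative g' t) (at t)" "\<And>t. (g' has_real_derivative k * g t + r t) (at t)"
    using ex_particular_solution[OF k r] by metis
  have gcont: "continuous_on S g" for S
    by (rule DERIV_imp_continuous_on, rule g)
  obtain c s :: "real \<Rightarrow> real" where c: "\<And>t. (c has_real_derivative k * s t) (at t)" and s: "\<And>t. (s has_real_derivative c t) (at t)"
    and cs: "\<And>t. c (- t) = c t" "\<And>t. s (- t) = - s t"
    "\<And>t. c t \<ge> 1" "\<And>t. t > 0 \<Longrightarrow> s t > 0" "s 0 = 0" "c 0 = 1"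
    by (rule fundamental_solutions[OF k], rule that)
  define A where "A = (\<lambda>(x, y :: real, z). h (x, 0, z) - g z)"
  define B where "B = (\<lambda>P. 1 * h P + -1 * A P)"
  have Asol: "pde_sol p q k A"
    unfolding A_def
  proof (rule pde_solI)
    show "continuous_on UNIV (\<lambda>(x, y :: real, z). h (x, 0, z) - g z)"
      unfolding case_prod_beta'
      by (intro continuous_intros continuous_on_compose2[OF C2_imp_continuous[OF h(1), of UNIV]]
          continuous_on_compose2[OF gcont[of UNIV]]) auto
    show "pde_partials p q k (\<lambda>(x, y :: real, z). h (x, 0, z) - g z) (\<lambda>(x, y, z). hx (x, 0, z)) (\<lambda>P. 0)
       (\<lambda>(x, y, z). hz (x, 0, z) - g' z) (\<lambda>(x, y, z). hxx (x, 0, z)) (\<lambda>P. 0) (\<lambda>(x, y, z). hzz (x, 0, z) - (k * g z + r z))"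
      unfolding pde_partials_def prod.case
    proof (intro allI conjI)
      fix x y z
      show "exp (2 * p * z) * hxx (x, 0, z) + exp (- 2 * q * z) * 0 + (hzz (x, 0, z) - (k * g z + r z)) =
         k * (h (x, 0, z) - g z)"
        using D(7)[of z x 0] hyyeq[of x 0 z] hyy' unfolding r_def by (simp add: algebra_simps)
    qed (auto intro!: derivative_eq_intros D g)
  qed
  have Bsol: "pde_sol p q k B" unfolding B_def by (intro pde_sol_lincomb h Asol)
  have hsub: "subexp_on_strip N h" for N by (rule nonneg_solution_subexp[OF p q k h])
  have Asub: "subexp_on_strip N A" for N
  proof -
    have "subexp_on_strip N (\<lambda>P. 1 * (\<lambda>(x, y, z). h (x, 0, z)) P + -1 * (\<lambda>(x, y, z). g z) P)"
      by (intro subexp_on_strip_lincomb subexp_on_strip_slice hsub subexp_on_strip_vertical gcont)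
    thus ?thesis by (simp add: A_def case_prod_beta')
  qed
  have Bsub: "subexp_on_strip N B" for N unfolding B_def by (intro subexp_on_strip_lincomb hsub Asub)
  have Aind: "A (x, y, z) = A (x, 0, z)" for x y z by (simp add: A_def)
  have Bind: "B (x, y, z) = B (0, y, z)" for x y z using mixed[of x y z] by (simp add: A_def B_def)
  have AB: "A (x, 0, z) \<ge> - B (0, y, z)" for x y z
    using h(3)[of "(x, y, z)"] Bind[of x y z] by (simp add: A_def B_def)
  define V where "V = (\<lambda>\<alpha> \<beta>. \<lambda>(x :: real, y :: real, z). \<alpha> * c z + \<beta> * s z)"
  have V: "pde_sol p q k (V \<alpha> \<beta>)" "subexp_on_strip N (V \<alpha> \<beta>)" for \<alpha> \<beta> N
  proof -
    have "((\<lambda>t. \<alpha> * c t + \<beta> * s t) has_real_derivative k * (\<alpha> * s t) + \<beta> * c t) (at t)"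
      "((\<lambda>t. k * (\<alpha> * s t) + \<beta> * c t) has_real_derivative k * (\<alpha> * c t + \<beta> * s t)) (at t)" for t
      by (auto intro!: derivative_eq_intros c s simp: algebra_simps)
    note d = this
    show "pde_sol p q k (V \<alpha> \<beta>)" unfolding V_def by (rule pde_sol_vertical[OF d])
    show "subexp_on_strip N (V \<alpha> \<beta>)" unfolding V_def
      by (rule subexp_on_strip_vertical, rule DERIV_imp_continuous_on, rule d)
  qed
  \<comment> \<open>on \<open>\<bar>z\<bar> \<le> N\<close>, take the solution in \<open>z\<close> alone with boundary values \<open>inf\<^sub>x A(x, \<plusminus>N)\<close>\<close>
  have "\<exists>\<alpha> \<beta>. \<forall>x y z. \<bar>z\<bar> \<le> N \<longrightarrow> V \<alpha> \<beta> (x, y, z) \<le> A (x, y, z) \<and> - B (x, y, z) \<le> V \<alpha> \<beta> (x, y, z)"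
    if N: "N > 0" for N
  proof -
    define I where "I = (\<lambda>z. INF x. A (x, 0, z))"
    have bdd: "bdd_below (range (\<lambda>x. A (x, 0, z)))" for z
      by (rule bdd_belowI2[of _ "- B (0, 0, z)"]) (rule AB)
    have I1: "I z \<le> A (x, y, z)" for x y z
      unfolding I_def Aind[of x y] by (rule cINF_lower[OF bdd]) simp
    have I2: "- B (x, y, z) \<le> I z" for x y z
      unfolding I_def Bind[of x y] by (rule cINF_greatest) (auto intro: AB)
    \<comment> \<open>Since \<open>c\<close> is even and \<open>s\<close> is odd, the boundary
      values \<open>I N\<close> and \<open>I (- N)\<close> fix the even part through
      \<open>c N\<close> and the odd part through \<open>s N\<close>.\<close>
    define \<alpha> where "\<alpha> = (I N + I (- N)) / (2 * c N)"
    define \<beta> where "\<beta> = (I N - I (- N)) / (2 * s N)"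
    have c0: "c N > 0" using cs(3)[of N] by linarith
    have e: "V \<alpha> \<beta> (x, y, N) = I N" "V \<alpha> \<beta> (x, y, - N) = I (- N)" for x y
      using c0 cs(4)[OF N] by (simp_all add: V_def \<alpha>_def \<beta>_def cs(1,2) field_simps)
    have a1: "1 * A (x, y, z) + -1 * V \<alpha> \<beta> (x, y, z) \<ge> 0" if "\<bar>z\<bar> \<le> N" for x y z
      by (rule strip_maximum_principle[OF pde_sol_lincomb[OF Asol V(1)] k p q N
            subexp_on_strip_lincomb[OF Asub V(2)] _ _ that]) (simp_all add: e I1)
    have a2: "1 * B (x, y, z) + 1 * V \<alpha> \<beta> (x, y, z) \<ge> 0" if "\<bar>z\<bar> \<le> N" for x y z
    proof (rule strip_maximum_principle[OF pde_sol_lincomb[OF Bsol V(1)] k p q N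
            subexp_on_strip_lincomb[OF Bsub V(2)] _ _ that])
      show "0 \<le> 1 * B (x, y, N) + 1 * V \<alpha> \<beta> (x, y, N)" for x y using I2[of x y N] e by simp
      show "0 \<le> 1 * B (x, y, - N) + 1 * V \<alpha> \<beta> (x, y, - N)" for x y using I2[of x y "- N"] e by simp
    qed
    have "V \<alpha> \<beta> (x, y, z) \<le> A (x, y, z) \<and> - B (x, y, z) \<le> V \<alpha> \<beta> (x, y, z)" if "\<bar>z\<bar> \<le> N" for x y z
      using a1[OF that, of x y] a2[OF that, of x y] by linarith
    thus ?thesis by blast
  qed
  hence "\<exists>\<alpha> \<beta>. \<forall>x y z. \<bar>z\<bar> \<le> real (Suc n) \<longrightarrow> V \<alpha> \<beta> (x, y, z) \<le> A (x, y, z) \<and> - B (x, y, z) \<le> V \<alpha> \<beta> (x, y, z)"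
    for n by simp
  then obtain \<alpha> \<beta> where ab: "\<And>n x y z. \<bar>z\<bar> \<le> real (Suc n) \<Longrightarrow>
      V (\<alpha> n) (\<beta> n) (x, y, z) \<le> A (x, y, z) \<and> - B (x, y, z) \<le> V (\<alpha> n) (\<beta> n) (x, y, z)" by metis
  \<comment> \<open>The half-height \<open>Suc n\<close> is at least 1, so the heights 0 and 1
    belong to every strip. At height 0 the sandwich bounds \<open>\<alpha> n\<close>, as
    \<open>c 0 = 1\<close> and \<open>s 0 = 0\<close>; at height 1 it then bounds
    \<open>\<beta> n\<close>, as \<open>s 1 > 0\<close>.\<close>
  define M where "M = \<bar>A (0, 0, 0)\<bar> + \<bar>B (0, 0, 0)\<bar>"
  define M' where "M' = \<bar>A (0, 0, 1)\<bar> + \<bar>B (0, 0, 1)\<bar>"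
  have \<alpha>: "\<bar>\<alpha> n\<bar> \<le> M" for n
  proof -
    have "\<alpha> n \<le> A (0, 0, 0)" "- B (0, 0, 0) \<le> \<alpha> n"
      using ab[of 0 n 0 0] by (simp_all add: V_def cs)
    thus ?thesis unfolding M_def by linarith
  qed
  have \<beta>: "\<bar>\<beta> n\<bar> \<le> (M' + M * c 1) / s 1" for n
  proof -
    have "\<bar>\<alpha> n * c 1 + \<beta> n * s 1\<bar> \<le> M'"
    proof -
      have "\<alpha> n * c 1 + \<beta> n * s 1 \<le> A (0, 0, 1)" "- B (0, 0, 1) \<le> \<alpha> n * c 1 + \<beta> n * s 1"
        using ab[of 1 n 0 0] by (simp_all add: V_def)
      thus ?thesis unfolding M'_def by linarith
    qed
    moreover have "\<bar>\<alpha> n * c 1\<bar> \<le> M * c 1"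
      using \<alpha>[of n] cs(3)[of 1] by (simp add: abs_mult mult_right_mono)
    ultimately have "\<bar>\<beta> n * s 1\<bar> \<le> M' + M * c 1" by linarith
    thus ?thesis using cs(4)[of 1] by (simp add: abs_mult field_simps)
  qed
  have "bounded (range (\<lambda>n. (\<alpha> n, \<beta> n)))"
    using \<alpha> \<beta> by (intro boundedI[where B = "M + (M' + M * c 1) / s 1"])
      (auto intro!: order_trans[OF norm_Pair_le] add_mono)
  then obtain L r' where r': "strict_mono r'" "((\<lambda>n. (\<alpha> n, \<beta> n)) \<circ> r') \<longlonglongrightarrow> L"
    using bounded_imp_convergent_subsequence by blast
  obtain \<alpha>' \<beta>' where L: "L = (\<alpha>', \<beta>')" by (cases L)
  have lim: "(\<lambda>n. \<alpha> (r' n)) \<longlonglongrightarrow> \<alpha>'" "(\<lambda>n. \<beta> (r' n)) \<longlonglongrightarrow> \<beta>'"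
    using tendsto_fst[OF r'(2)] tendsto_snd[OF r'(2)] by (simp_all add: L comp_def)
  have fin: "V \<alpha>' \<beta>' (x, y, z) \<le> A (x, y, z) \<and> - B (x, y, z) \<le> V \<alpha>' \<beta>' (x, y, z)" for x y z
  proof -
    have vl: "(\<lambda>n. V (\<alpha> (r' n)) (\<beta> (r' n)) (x, y, z)) \<longlonglongrightarrow> V \<alpha>' \<beta>' (x, y, z)"
      unfolding V_def prod.case by (intro tendsto_intros lim)
    obtain n0 where n0: "\<bar>z\<bar> \<le> real n0" using real_arch_simple by blast
    have ev: "\<bar>z\<bar> \<le> real (Suc (r' n))" if "n \<ge> n0" for n
      using seq_suble[OF r'(1), of n] that n0 by linarith
    show ?thesis
      using LIMSEQ_le_const2[OF vl, of "A (x, y, z)"] LIMSEQ_le_const[OF vl, of "- B (x, y, z)"] ab[OF ev] by blast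
  qed
  define l where "l = (\<lambda>z. g z + (\<alpha>' * c z + \<beta>' * s z))"
  show thesis
  proof (rule that[of l])
    have d: "(l has_real_derivative g' t + (k * (\<alpha>' * s t) + \<beta>' * c t)) (at t)"
      "((\<lambda>t. g' t + (k * (\<alpha>' * s t) + \<beta>' * c t)) has_real_derivative (k * l t + r t)) (at t)" for t
      unfolding l_def by (auto intro!: derivative_eq_intros g c s simp: algebra_simps)
    have "continuous_on UNIV l" by (rule DERIV_imp_continuous_on, rule d)
    hence "continuous_on UNIV (\<lambda>t. k * l t + r t)" using r by (intro continuous_intros)
    thus "C2 l" by (rule C2_realI[OF d])
    have "pde_sol p q k (\<lambda>P. 1 * A P + -1 * V \<alpha>' \<beta>' P)" by (rule pde_sol_lincomb[OF Asol V(1)])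
    thus "pde_sol p q k (\<lambda>(x, y, z). h (x, 0, z) - l z)"
      by (simp add: A_def V_def l_def case_prod_beta' algebra_simps)
    show "l z \<le> h (x, 0, z)" for x z using fin[of x 0 z] by (simp add: A_def V_def l_def)
    show "h (x, 0, z) - l z \<le> h (x, y, z)" for x y z using fin[of x y z] by (simp add: A_def B_def V_def l_def)
  qed
qed

subsection \<open>Eigenfunctions of the Laplacians with drift\<close>

lemma L_Sol_eq:
  assumes "\<And>x y z. ((\<lambda>t. h (t, y, z)) has_real_derivative hx (x, y, z)) (at x)"
    "\<And>x y z. ((\<lambda>t. hx (t, y, z)) has_real_derivative hxx (x, y, z)) (at x)"
    "\<And>x y z. ((\<lambda>t. h (x, t, z)) has_real_derivative hy (x, y, z)) (at y)"
    "\<And>x y z. ((\<lambda>t. hy (x, t, z)) has_real_derivative hyy (x, y, z)) (at y)"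
    "\<And>x y z. ((\<lambda>t. h (x, y, t)) has_real_derivative hz (x, y, z)) (at z)"
    "\<And>x y z. ((\<lambda>t. hz (x, y, t)) has_real_derivative hzz (x, y, z)) (at z)"
  shows "L_Sol p q a h (x, y, z) =
     1/2 * (exp (2 * p * z) * hxx (x, y, z) + exp (- 2 * q * z) * hyy (x, y, z) + hzz (x, y, z)) + a * hz (x, y, z)"
proof -
  have "deriv (\<lambda>t. h (t, y, z)) = (\<lambda>t. hx (t, y, z))" "deriv (\<lambda>t. h (x, t, z)) = (\<lambda>t. hy (x, t, z))"
    "deriv (\<lambda>t. h (x, y, t)) = (\<lambda>t. hz (x, y, t))"
    by (intro ext DERIV_imp_deriv assms)+
  moreover have "deriv (\<lambda>t. hx (t, y, z)) x = hxx (x, y, z)" "deriv (\<lambda>t. hy (x, t, z)) y = hyy (x, y, z)"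
    "deriv (\<lambda>t. hz (x, y, t)) z = hzz (x, y, z)"
    by (intro DERIV_imp_deriv assms)+
  ultimately show ?thesis by (simp add: L_Sol_def)
qed

lemma pde_sol_of_L_Sol:
  assumes C2: "C2 h" and L: "\<And>P. L_Sol p q a h P = lam * h P"
  shows "pde_sol p q (2 * lam + a\<^sup>2) (\<lambda>(x, y, z). exp (a * z) * h (x, y, z))"
proof -
  obtain hx hy hz hxx hyy hzz
    where D: "\<And>x y z. ((\<lambda>t. h (t, y, z)) has_real_derivative hx (x, y, z)) (at x)"
    "\<And>x y z. ((\<lambda>t. hx (t, y, z)) has_real_derivative hxx (x, y, z)) (at x)"
    "\<And>x y z. ((\<lambda>t. h (x, t, z)) has_real_derivative hy (x, y, z)) (at y)"
    "\<And>x y z. ((\<lambda>t. hy (x, t, z)) has_real_derivative hyy (x, y, z)) (at y)"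
    "\<And>x y z. ((\<lambda>t. h (x, y, t)) has_real_derivative hz (x, y, z)) (at z)"
    "\<And>x y z. ((\<lambda>t. hz (x, y, t)) has_real_derivative hzz (x, y, z)) (at z)"
    using C2_axis_derivs[OF C2] by metis
  show ?thesis
  proof (rule pde_solI)
    show "continuous_on UNIV (\<lambda>(x, y, z). exp (a * z) * h (x, y, z))"
      unfolding case_prod_beta' by (intro continuous_intros continuous_on_compose2[OF C2_imp_continuous[OF C2, of UNIV]]) auto
    show "pde_partials p q (2 * lam + a\<^sup>2) (\<lambda>(x, y, z). exp (a * z) * h (x, y, z))
       (\<lambda>(x, y, z). exp (a * z) * hx (x, y, z)) (\<lambda>(x, y, z). exp (a * z) * hy (x, y, z))
       (\<lambda>(x, y, z). exp (a * z) * (a * h (x, y, z) + hz (x, y, z)))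
       (\<lambda>(x, y, z). exp (a * z) * hxx (x, y, z)) (\<lambda>(x, y, z). exp (a * z) * hyy (x, y, z))
       (\<lambda>(x, y, z). exp (a * z) * (a\<^sup>2 * h (x, y, z) + 2 * a * hz (x, y, z) + hzz (x, y, z)))"
      unfolding pde_partials_def prod.case
    proof (intro allI conjI)
      fix x y z
      have "1/2 * (exp (2 * p * z) * hxx (x, y, z) + exp (- 2 * q * z) * hyy (x, y, z) + hzz (x, y, z)) + a * hz (x, y, z)
          = lam * h (x, y, z)"
        using L[of "(x, y, z)"] unfolding L_Sol_eq[OF D] .
      thus "exp (2 * p * z) * (exp (a * z) * hxx (x, y, z)) + exp (- 2 * q * z) * (exp (a * z) * hyy (x, y, z)) +
         exp (a * z) * (a\<^sup>2 * h (x, y, z) + 2 * a * hz (x, y, z) + hzz (x, y, z)) =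
         (2 * lam + a\<^sup>2) * (exp (a * z) * h (x, y, z))" by algebra
      show "((\<lambda>t. exp (a * t) * h (x, y, t)) has_real_derivative exp (a * z) * (a * h (x, y, z) + hz (x, y, z))) (at z)"
        by (auto intro!: derivative_eq_intros D simp: algebra_simps)
      show "((\<lambda>t. exp (a * t) * (a * h (x, y, t) + hz (x, y, t))) has_real_derivative
         exp (a * z) * (a\<^sup>2 * h (x, y, z) + 2 * a * hz (x, y, z) + hzz (x, y, z))) (at z)"
        by (auto intro!: derivative_eq_intros D simp: algebra_simps power2_eq_square)
    qed (intro DERIV_cmult D)+
  qed
qed

lemma L_Sol_of_pde_sol:
  assumes "pde_sol p q (2 * lam + a\<^sup>2) g"
  shows "L_Sol p q a (\<lambda>(x, y, z). exp (- a * z) * g (x, y, z)) P = lam * (case P of (x, y, z) \<Rightarrow> exp (- a * z) * g (x, y, z))"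
proof -
  obtain gx gy gz gxx gyy gzz where "pde_partials p q (2 * lam + a\<^sup>2) g gx gy gz gxx gyy gzz"
    using assms by (rule pde_solE)
  note D = pde_partialsD[OF this]
  obtain x y z where P: "P = (x, y, z)" by (cases P)
  have "L_Sol p q a (\<lambda>(x, y, z). exp (- a * z) * g (x, y, z)) (x, y, z) = 1/2 * (
     exp (2 * p * z) * (\<lambda>(x, y, z). exp (- a * z) * gxx (x, y, z)) (x, y, z) +
     exp (- 2 * q * z) * (\<lambda>(x, y, z). exp (- a * z) * gyy (x, y, z)) (x, y, z) +
     (\<lambda>(x, y, z). exp (- a * z) * (a\<^sup>2 * g (x, y, z) - 2 * a * gz (x, y, z) + gzz (x, y, z))) (x, y, z)) +
     a * (\<lambda>(x, y, z). exp (- a * z) * (- a * g (x, y, z) + gz (x, y, z))) (x, y, z)"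
  proof (rule L_Sol_eq[where hx = "\<lambda>(x, y, z). exp (- a * z) * gx (x, y, z)"
        and hy = "\<lambda>(x, y, z). exp (- a * z) * gy (x, y, z)"])
    fix x y z
    show "((\<lambda>t. case (x, y, t) of (x, y, z) \<Rightarrow> exp (- a * z) * g (x, y, z)) has_real_derivative
        (case (x, y, z) of (x, y, z) \<Rightarrow> exp (- a * z) * (- a * g (x, y, z) + gz (x, y, z)))) (at z)"
      by (auto intro!: derivative_eq_intros D(5) simp: algebra_simps)
    show "((\<lambda>t. case (x, y, t) of (x, y, z) \<Rightarrow> exp (- a * z) * (- a * g (x, y, z) + gz (x, y, z))) has_real_derivative
        (case (x, y, z) of (x, y, z) \<Rightarrow> exp (- a * z) * (a\<^sup>2 * g (x, y, z) - 2 * a * gz (x, y, z) + gzz (x, y, z)))) (at z)"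
      by (auto intro!: derivative_eq_intros D(5,6) simp: algebra_simps power2_eq_square)
  qed (unfold prod.case, (intro DERIV_cmult D)+)
  also have "\<dots> = lam * (exp (- a * z) * g (x, y, z))"
    using D(7)[of z x y] unfolding prod.case by algebra
  finally show ?thesis by (simp add: P)
qed

lemma L_Sol_of_xz: "L_Sol p q a (\<lambda>(x, y, z). f (x, z)) (x, y, z) = L_H p a f (x, z)"
  by (simp add: L_Sol_def L_H_def)

lemma C2_realD:
  fixes m :: "real \<Rightarrow> real"
  assumes "C2 m"
  obtains m1 m2 where "\<And>t. (m has_real_derivative m1 t) (at t)" "\<And>t. (m1 has_real_derivative m2 t) (at t)"
proof -
  obtain f' f'' where f: "\<And>x. (m has_derivative blinfun_apply (f' x)) (at x)"
    "\<And>x. (f' has_derivative blinfun_apply (f'' x)) (at x)"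
    using assms unfolding C2_def by blast
  have lin: "F t = F 1 * t" if "linear F" for F :: "real \<Rightarrow> real" and t
    using linear_scale[OF that, of t 1] by (simp add: mult.commute)
  show thesis
  proof (rule that[of "\<lambda>t. f' t 1" "\<lambda>t. f'' t 1 1"])
    fix t
    show "(m has_real_derivative f' t 1) (at t)"
      unfolding has_field_derivative_def using f(1)
      by (rule has_derivative_eq_rhs) (intro ext lin has_derivative_linear[OF f(1)])
    have d: "((\<lambda>t. f' t 1) has_derivative (\<lambda>u. f'' t u 1)) (at t)" by (auto intro!: derivative_eq_intros f(2))
    thus "((\<lambda>t. f' t 1) has_real_derivative f'' t 1 1) (at t)"
      unfolding has_field_derivative_def
      by (rule has_derivative_eq_rhs) (intro ext lin[OF has_derivative_linear[OF d]])
  qed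
qed

text \<open>Reflecting \<open>z\<close> turns the coefficient \<open>exp (- 2 * q * z)\<close> into
  the one of the hyperbolic plane with parameter \<open>q\<close>, and reverses the sign of the
  first \<open>z\<close>-derivative, hence of the drift.\<close>

lemma L_Sol_of_yz:
  assumes "C2 f"
  shows "L_Sol p q a (\<lambda>(x, y, z). f (y, - z)) (x, y, z) = L_H q (- a) f (y, - z)"
proof -
  have "bounded_linear (\<lambda>t :: real. (0 :: real, t))" by (intro bounded_linear_Pair bounded_linear_zero bounded_linear_ident)
  hence c2: "C2 (\<lambda>t. f (y, t))" using C2_compose_affine[OF assms, of "\<lambda>t. (0, t)" "(y, 0)"] by simp
  obtain m1 m2 where m: "\<And>t. ((\<lambda>t. f (y, t)) has_real_derivative m1 t) (at t)" "\<And>t. (m1 has_real_derivative m2 t) (at t)"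
    by (rule C2_realD[OF c2], rule that)
  have n: "((\<lambda>t. f (y, - t)) has_real_derivative - m1 (- t)) (at t)" "((\<lambda>t. - m1 (- t)) has_real_derivative m2 (- t)) (at t)" for t
    using DERIV_affine_arg[where m = "-1" and b = 0, OF m(1)] DERIV_minus[OF DERIV_affine_arg[where m = "-1" and b = 0, OF m(2)]]
    by simp_all
  have "deriv (\<lambda>t. f (y, t)) = m1" "deriv m1 = m2" "deriv (\<lambda>t. f (y, - t)) = (\<lambda>t. - m1 (- t))"
    "deriv (\<lambda>t. - m1 (- t)) = (\<lambda>t. m2 (- t))"
    by (intro ext DERIV_imp_deriv m n)+
  thus ?thesis by (simp add: L_Sol_def L_H_def)
qed

section \<open>Transfer of minimality to the hyperbolic planes and the dichotomy\<close>

text \<open>Both alternatives are instances: \<open>\<pi>\<close> is the projection, up to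
  reflection, and \<open>\<sigma>\<close> a linear section. A competitor \<open>f\<close> below on
  the quotient pulls back to the competitor \<open>f \<circ> \<pi>\<close> of \<open>h\<close>, and
  the resulting constant quotient is read off along \<open>\<sigma>\<close>.\<close>

lemma minimal_eigen_descends:
  fixes \<pi> :: "'a::real_normed_vector \<Rightarrow> 'b::real_normed_vector" and \<sigma> :: "'b \<Rightarrow> 'a"
  assumes min: "minimal_eigen L lam h"
    and \<pi>: "bounded_linear \<pi>" and \<sigma>: "bounded_linear \<sigma>" and \<pi>\<sigma>: "\<And>w. \<pi> (\<sigma> w) = w"
    and h: "\<And>P. h P = h (\<sigma> (\<pi> P))"
    and L: "\<And>f P. C2 f \<Longrightarrow> L (\<lambda>P. f (\<pi> P)) P = L' f (\<pi> P)"
  shows "minimal_eigen L' lam (\<lambda>w. h (\<sigma> w))"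
proof -
  have hC: "C2 h" "\<And>P. h P \<ge> 0" "\<And>P. L h P = lam * h P" "h 0 = 1"
    "\<And>f. f \<in> pos_eigen L lam \<Longrightarrow> (\<And>P. f P \<le> h P) \<Longrightarrow> \<exists>c. \<forall>P. f P / h P = c"
    using min unfolding minimal_eigen_def pos_eigen_def by auto
  have C: "C2 (\<lambda>w. h (\<sigma> w))" using C2_compose_affine[OF hC(1) \<sigma>, of 0] by simp
  have "L' (\<lambda>w. h (\<sigma> w)) w = lam * h (\<sigma> w)" for w
    using L[OF C, of "\<sigma> w"] hC(3)[of "\<sigma> w"] by (simp add: \<pi>\<sigma> flip: h)
  moreover have "\<exists>c. \<forall>w. f w / h (\<sigma> w) = c" if f: "f \<in> pos_eigen L' lam" "\<And>w. f w \<le> h (\<sigma> w)" for f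
  proof -
    have "C2 (\<lambda>P. f (\<pi> P))" using f C2_compose_affine[OF _ \<pi>, of f 0] by (simp add: pos_eigen_def)
    hence "(\<lambda>P. f (\<pi> P)) \<in> pos_eigen L lam" using f(1) L by (simp add: pos_eigen_def)
    moreover have "f (\<pi> P) \<le> h P" for P using f(2)[of "\<pi> P"] by (simp flip: h)
    ultimately obtain c where "\<And>P. f (\<pi> P) / h P = c" using hC(5) by blast
    from this[of "\<sigma> _"] show ?thesis by (auto simp: \<pi>\<sigma>)
  qed
  ultimately show ?thesis
    using C hC linear_0[OF bounded_linear.linear[OF \<sigma>]] unfolding minimal_eigen_def pos_eigen_def by auto
qed

theorem theorem6p1:
  fixes p q a lam :: real and h :: "real \<times> real \<times> real \<Rightarrow> real"
  assumes "p > 0" and "q > 0" and "lam \<ge> - (a\<^sup>2 / 2)"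
    and "minimal_eigen (L_Sol p q a) lam h"
  shows "(\<exists>h1. minimal_eigen (L_H p a) lam h1 \<and> (\<forall>x y z. h (x, y, z) = h1 (x, z))) \<or>
         (\<exists>h2. minimal_eigen (L_H q (- a)) lam h2 \<and> (\<forall>x y z. h (x, y, z) = h2 (y, - z)))"
proof -
  have h: "C2 h" "\<And>P. h P \<ge> 0" "\<And>P. L_Sol p q a h P = lam * h P"
    and min: "\<And>f. f \<in> pos_eigen (L_Sol p q a) lam \<Longrightarrow> (\<And>P. f P \<le> h P) \<Longrightarrow> \<exists>c. \<forall>P. f P / h P = c"
    using assms(4) unfolding minimal_eigen_def pos_eigen_def by auto
  define k where "k = 2 * lam + a\<^sup>2"
  have k: "k \<ge> 0" using assms(3) by (simp add: k_def)
  define g where "g = (\<lambda>(x, y, z). exp (a * z) * h (x, y, z))"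
  have ex: "C2 (\<lambda>t. exp (b * t))" for b :: real
    by (rule C2_realI[of _ "\<lambda>t. b * exp (b * t)" "\<lambda>t. b * (b * exp (b * t))"])
       (auto intro!: derivative_eq_intros continuous_intros)
  have g: "C2 g" "pde_sol p q k g" "\<And>P. g P \<ge> 0"
  proof -
    show "C2 g" using C2_mult[OF C2_vertical[OF ex[of a]] h(1)] by (simp add: g_def case_prod_beta')
    show "pde_sol p q k g" unfolding g_def k_def by (rule pde_sol_of_L_Sol[OF h(1,3)])
    show "g P \<ge> 0" for P using h(2) by (simp add: g_def case_prod_beta)
  qed
  obtain l where l: "C2 l" "pde_sol p q k (\<lambda>(x, y, z). g (x, 0, z) - l z)"
    "\<And>x z. l z \<le> g (x, 0, z)" "\<And>x y z. g (x, 0, z) - l z \<le> g (x, y, z)"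
    by (rule nonneg_solution_splits[OF assms(1,2) k g], rule that)
  \<comment> \<open>The first summand of the splitting with the drift put back; it does not depend
    on \<open>y\<close> and lies between 0 and \<open>h\<close>, so minimality applies to
    it.\<close>
  define f where "f = (\<lambda>(x, y :: real, z). exp (- a * z) * (g (x, 0, z) - l z))"
  have "C2 f"
  proof -
    have "bounded_linear (\<lambda>P :: real \<times> real \<times> real. (fst P, 0 :: real, snd (snd P)))"
      by (intro bounded_linear_Pair bounded_linear_zero bounded_linear_fst bounded_linear_snd_comp bounded_linear_snd)
    from C2_compose_affine[OF g(1) this, of 0] have "C2 (\<lambda>(x, y :: real, z). g (x, 0, z))"
      by (simp add: case_prod_beta')
    from C2_mult[OF C2_vertical[OF ex[of "- a"]] C2_lincomb[OF this C2_vertical[OF l(1)], of 1 "-1"]]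
    show ?thesis by (simp add: f_def case_prod_beta')
  qed
  moreover have "f P \<ge> 0" for P using l(3) by (simp add: f_def case_prod_beta)
  moreover have "L_Sol p q a f P = lam * f P" for P
    using L_Sol_of_pde_sol[of p q lam a "\<lambda>(x, y, z). g (x, 0, z) - l z" P] l(2) by (simp add: f_def k_def)
  moreover have "f P \<le> h P" for P
  proof -
    obtain x y z where P: "P = (x, y, z)" by (cases P)
    have "f P \<le> exp (- a * z) * g (x, y, z)" unfolding f_def P prod.case using l(4) by (intro mult_left_mono) auto
    also have "\<dots> = h P" by (simp add: g_def P flip: mult.assoc exp_add)
    finally show ?thesis .
  qed
  ultimately obtain c where c: "\<And>P. f P / h P = c"
    using min[of f] unfolding pos_eigen_def by auto
  \<comment> \<open>Where \<open>h P = 0\<close>, the quotient is the default value 0 and does not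
    determine \<open>f P\<close>; there \<open>0 \<le> f P \<le> h P\<close> gives
    \<open>f P = 0\<close>.\<close>
  have fc: "f P = c * h P" for P
    using c[of P] \<open>\<And>P. f P \<le> h P\<close>[of P] \<open>\<And>P. f P \<ge> 0\<close>[of P] by (cases "h P = 0") auto
  show ?thesis
  proof (cases "c = 0")
    case False
    \<comment> \<open>A non-zero multiple of \<open>h\<close> is free of \<open>y\<close>, so
      \<open>h\<close> is.\<close>
    have dep: "h (x, y, z) = h (x, 0, z)" for x y z
      using fc[of "(x, y, z)"] fc[of "(x, 0, z)"] False by (simp add: f_def)
    have "minimal_eigen (L_H p a) lam (\<lambda>w. h (fst w, 0, snd w))"
    proof (rule minimal_eigen_descends[OF assms(4), where \<pi> = "\<lambda>P. (fst P, snd (snd P))"])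
      show "L_Sol p q a (\<lambda>P. f (fst P, snd (snd P))) P = L_H p a f (fst P, snd (snd P))" for f P
        using L_Sol_of_xz[of p q a f "fst P" "fst (snd P)" "snd (snd P)"] by (simp add: case_prod_beta')
      show "h P = h (fst (fst P, snd (snd P)), 0, snd (fst P, snd (snd P)))" for P
        using dep[of "fst P" "fst (snd P)" "snd (snd P)"] by simp
    qed (auto intro!: bounded_linear_intros bounded_linear_minus)
    moreover have "h (x, y, z) = h (fst (x, z), 0, snd (x, z))" for x y z
      using dep[of x y z] by simp
    ultimately show ?thesis by blast
  next
    case True
    \<comment> \<open>Here the first summand vanishes identically, so the slice \<open>y = 0\<close>
      is free of \<open>x\<close>; the vanishing mixed difference extends this to all
      \<open>y\<close>.\<close>
    have "g (x, 0, z) = l z" for x z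
      using fc[of "(x, 0, z)"] True by (simp add: f_def)
    hence "g (x, y, z) = g (0, y, z)" for x y z
      using mixed_difference_eq_0[OF assms(1,2) k g, of 0 x 0 y z] by simp
    hence dep: "h (x, y, z) = h (0, y, z)" for x y z by (simp add: g_def)
    have "minimal_eigen (L_H q (- a)) lam (\<lambda>w. h (0, fst w, - snd w))"
    proof (rule minimal_eigen_descends[OF assms(4), where \<pi> = "\<lambda>P. (fst (snd P), - snd (snd P))"])
      show "L_Sol p q a (\<lambda>P. f (fst (snd P), - snd (snd P))) P = L_H q (- a) f (fst (snd P), - snd (snd P))"
        if "C2 f" for f P
        using L_Sol_of_yz[OF that, of p q a "fst P" "fst (snd P)" "snd (snd P)"] by (simp add: case_prod_beta')
      show "h P = h (0, fst (fst (snd P), - snd (snd P)), - snd (fst (snd P), - snd (snd P)))" for P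
        using dep[of "fst P" "fst (snd P)" "snd (snd P)"] by simp
    qed (auto intro!: bounded_linear_intros bounded_linear_minus)
    moreover have "h (x, y, z) = h (0, fst (y, - z), - snd (y, - z))" for x y z
      using dep[of x y z] by simp
    ultimately show ?thesis by blast
  qed
qed

end
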